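(* Let $n\ge 1$ and let $\Sigma^n\subset\mathbb{C}^n$ be a Lagrangian translating soliton, i.e. a smooth $n$-dimensional Lagrangian submanifold of $\mathbb{C}^n$ for which there is a constant vector $\mathbf{T}\in\mathbb{C}^n\cong\mathbb{R}^{2n}$ such that $\mathbf{T}^{\perp}=\mathbf{H}$ holds on $\Sigma$. Then $\Sigma$ is Lagrangian $L$-stable: for every smooth compactly supported normal vector field $\mathbf{V}$ on $\Sigma$ which is a Lagrangian variation (that is, the 1-form $\theta_{\mathbf{V}}=-i_{\mathbf{V}}\bar\omega$ on $\Sigma$ is closed), one has $$-\int_{\Sigma}\langle L\mathbf{V},\mathbf{V}\rangle\, e^{\langle\mathbf{T},\mathbf{x}\rangle}\,d\mu\;\ge\;0 .$$
   Context: $\mathbb{C}^n\cong\mathbb{R}^{2n}$ carries its standard Euclidean metric $\bar g=\langle\cdot,\cdot\rangle$, complex structure $J$ and Kähler form $\bar\omega$, with the convention $\bar g=\bar\omega(\cdot,J\cdot)$. An $n$-dimensional submanifold $\Sigma$ of $\mathbb{C}^n$ is Lagrangian if $\bar\omega|_{\Sigma}=0$, equivalently if $J$ maps each tangent space of $\Sigma$ onto the normal space at that point. Here $\mathbf{x}$ is the position vector, $d\mu$ is the induced area element on $\Sigma$, $\mathbf{T}^\perp$ is the normal component of $\mathbf{T}$, and $\mathbf{H}$ is the mean curvature vector of $\Sigma$ (the trace, not normalized, of the second fundamental form). A submanifold satisfying $\mathbf{T}^\perp=\mathbf{H}$ for a constant vector $\mathbf{T}$ is called a translating soliton; it is a critical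 point of the functional $F(\Sigma)=\int_\Sigma e^{\langle\mathbf{T},\mathbf{x}\rangle}d\mu$. For a normal vector field $\mathbf{V}$ on $\Sigma$, $\theta_{\mathbf{V}}:=-i_{\mathbf{V}}\bar\omega$ (restricted to $\Sigma$) is a 1-form on $\Sigma$; this gives a bijection between normal vector fields and 1-forms on $\Sigma$. If $\{e_i\}$ is a local orthonormal tangent frame, $\{\omega^i\}$ its dual coframe, $\nu_i=Je_i$ and $\mathbf{V}=V_i\nu_i$, then $\theta_{\mathbf{V}}=V_i\omega^i$. The stability operator $L$ acts on normal vector fields $\mathbf{V}$ by $$L\mathbf{V}=\Delta^{\perp}\mathbf{V}+\nabla^{\perp}_{\mathbf{T}^{\top}}\mathbf{V}+\sum_{i,j}\langle A(e_i,e_j),\mathbf{V}\rangle A(e_i,e_j),$$ where $\nabla^\perp$ is the normal connection, $\Delta^\perp$ the associated Laplacian (trace of the second covariant derivative) on the normal bundle, $\mathbf{T}^\top$ the tangential component of $\mathbf{T}$, $A$ the second fundamental form, and $\{e_i\}$ a local orthonormal tangent frame. In components with $\mathbf{V}=V_i\nu_i$ and $h_{ijk}=\bar g(\overline\nabla_{e_i}e_j,\nu_k)$ this is $L\mathbf{V}=\left(\Delta V_i+\langle\mathbf{T},\nabla V_i\rangle+h_{kli}h_{klj}V_j\right)\nu_i$, where the derivatives of $V_i$ are covariant derivatives. The quantity $-\int_\Sigma\langle L\mathbf{V},\mathbf{V}\rangle e^{\langle\mathbf{T},\mathbf{x}\rangle}d\mu$ is the second variation of $F$ at $\Sigma$ in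 the direction $\mathbf{V}$. *)

theory Defs
  imports "HOL-Analysis.Analysis"
begin

section \<open>Smooth submanifolds of complex n-space\<close>

(* On an open set of a Euclidean space, Ck_on k is the usual class of k times continuously
   differentiable maps; the derivative in a fixed direction v is again required to be of class
   C^(k-1). *)
primrec Ck_on :: "nat \<Rightarrow> 'a::euclidean_space set \<Rightarrow> ('a \<Rightarrow> 'b::real_normed_vector) \<Rightarrow> bool" where
  "Ck_on 0 U f \<longleftrightarrow> continuous_on U f"
| "Ck_on (Suc k) U f \<longleftrightarrow>
     (\<forall>x\<in>U. f differentiable (at x)) \<and> (\<forall>v. Ck_on k U (\<lambda>x. frechet_derivative f (at x) v))"

definition smooth_on :: "'a::euclidean_space set \<Rightarrow> ('a \<Rightarrow> 'b::real_normed_vector) \<Rightarrow> bool" where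
  "smooth_on U f \<longleftrightarrow> (\<forall>k. Ck_on k U f)"

text \<open>
  The ambient space is \<^typ>\<open>complex^'n\<close>, a Euclidean space of real dimension \<open>2n\<close> with
  \<open>n = CARD('n)\<close> (so \<open>n \<ge> 1\<close>); its inner product is the standard Euclidean metric.
  Parameter domains live in \<^typ>\<open>real^'n\<close>, so the submanifolds below are \<open>n\<close>-dimensional.
\<close>

definition local_param ::
    "(complex^'n::finite) set \<Rightarrow> (real^'n) set \<Rightarrow> (real^'n \<Rightarrow> complex^'n) \<Rightarrow> bool" where
  "local_param \<Sigma> U \<phi> \<longleftrightarrow>
     open U \<and> smooth_on U \<phi> \<and> (\<forall>x\<in>U. inj (frechet_derivative \<phi> (at x))) \<and>
     openin (top_of_set \<Sigma>) (\<phi> ` U) \<and> (\<exists>\<psi>. homeomorphism U (\<phi> ` U) \<phi> \<psi>)"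

definition submanifold :: "(complex^'n::finite) set \<Rightarrow> bool" where
  "submanifold \<Sigma> \<longleftrightarrow> (\<forall>p\<in>\<Sigma>. \<exists>U \<phi>. local_param \<Sigma> U \<phi> \<and> p \<in> \<phi> ` U)"

text \<open>
  Functions, vector fields and 1-forms on a submanifold \<open>\<Sigma>\<close> are represented by total functions on
  the ambient space; nothing below depends on their values outside \<open>\<Sigma>\<close>.
\<close>

definition smooth_on_submanifold ::
    "(complex^'n::finite) set \<Rightarrow> (complex^'n \<Rightarrow> 'b::real_normed_vector) \<Rightarrow> bool" where
  "smooth_on_submanifold \<Sigma> f \<longleftrightarrow> (\<forall>U \<phi>. local_param \<Sigma> U \<phi> \<longrightarrow> smooth_on U (f \<circ> \<phi>))"

definition tangent_space :: "(complex^'n::finite) set \<Rightarrow> complex^'n \<Rightarrow> (complex^'n) set" where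
  "tangent_space \<Sigma> p =
     {v. \<exists>U \<phi> x. local_param \<Sigma> U \<phi> \<and> x \<in> U \<and> \<phi> x = p \<and> v \<in> range (frechet_derivative \<phi> (at x))}"

abbreviation normal_space :: "(complex^'n::finite) set \<Rightarrow> complex^'n \<Rightarrow> (complex^'n) set" where
  "normal_space \<Sigma> p \<equiv> (tangent_space \<Sigma> p)\<^sup>\<bottom>"

definition tangent_part :: "(complex^'n::finite) set \<Rightarrow> complex^'n \<Rightarrow> complex^'n \<Rightarrow> complex^'n" where
  "tangent_part \<Sigma> p w = (THE u. u \<in> tangent_space \<Sigma> p \<and> w - u \<in> normal_space \<Sigma> p)"

definition normal_part :: "(complex^'n::finite) set \<Rightarrow> complex^'n \<Rightarrow> complex^'n \<Rightarrow> complex^'n" where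
  "normal_part \<Sigma> p w = w - tangent_part \<Sigma> p w"

definition tangent_field :: "(complex^'n::finite) set \<Rightarrow> (complex^'n \<Rightarrow> complex^'n) \<Rightarrow> bool" where
  "tangent_field \<Sigma> X \<longleftrightarrow> smooth_on_submanifold \<Sigma> X \<and> (\<forall>p\<in>\<Sigma>. X p \<in> tangent_space \<Sigma> p)"

definition normal_field :: "(complex^'n::finite) set \<Rightarrow> (complex^'n \<Rightarrow> complex^'n) \<Rightarrow> bool" where
  "normal_field \<Sigma> V \<longleftrightarrow> smooth_on_submanifold \<Sigma> V \<and> (\<forall>p\<in>\<Sigma>. V p \<in> normal_space \<Sigma> p)"

(* Compactness of the support, i.e. of the closure relative to the submanifold of the set where V
   does not vanish. *)
definition compactly_supported :: "(complex^'n::finite) set \<Rightarrow> (complex^'n \<Rightarrow> complex^'n) \<Rightarrow> bool" where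
  "compactly_supported \<Sigma> V \<longleftrightarrow> compact (\<Sigma> \<inter> closure {p \<in> \<Sigma>. V p \<noteq> 0})"


section \<open>Connections and curvature\<close>

(* Derivative at p of a function on the submanifold in a tangent direction v. The Frechet derivative
   within a submanifold is determined only on tangent vectors, so v must lie in the tangent space.
   In a local parametrisation f this is the derivative of u o f along the preimage of v. *)
definition dir_deriv ::
    "(complex^'n::finite) set \<Rightarrow> (complex^'n \<Rightarrow> 'b::real_normed_vector) \<Rightarrow> complex^'n \<Rightarrow> complex^'n \<Rightarrow> 'b" where
  "dir_deriv \<Sigma> u p v = frechet_derivative u (at p within \<Sigma>) v"

(* A smooth tangent vector field with value y at p, for y tangent at p. It serves as the extension
   of y in the tensorial expressions below, which do not depend on the chosen extension. *)
definition tangent_ext :: "(complex^'n::finite) set \<Rightarrow> complex^'n \<Rightarrow> complex^'n \<Rightarrow> complex^'n" where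
  "tangent_ext \<Sigma> y = (\<lambda>q. tangent_part \<Sigma> q y)"

definition levi_civita ::
    "(complex^'n::finite) set \<Rightarrow> (complex^'n \<Rightarrow> complex^'n) \<Rightarrow> complex^'n \<Rightarrow> complex^'n \<Rightarrow> complex^'n" where
  "levi_civita \<Sigma> Y p x = tangent_part \<Sigma> p (dir_deriv \<Sigma> Y p x)"

definition normal_connection ::
    "(complex^'n::finite) set \<Rightarrow> (complex^'n \<Rightarrow> complex^'n) \<Rightarrow> complex^'n \<Rightarrow> complex^'n \<Rightarrow> complex^'n" where
  "normal_connection \<Sigma> V p x = normal_part \<Sigma> p (dir_deriv \<Sigma> V p x)"

definition second_fundamental_form ::
    "(complex^'n::finite) set \<Rightarrow> complex^'n \<Rightarrow> complex^'n \<Rightarrow> complex^'n \<Rightarrow> complex^'n" where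
  "second_fundamental_form \<Sigma> p x y = normal_part \<Sigma> p (dir_deriv \<Sigma> (tangent_ext \<Sigma> y) p x)"

(* The second covariant derivative of V in the directions x, y is
   nabla_x (nabla_Y V) - nabla_(nabla_x Y) V  with Y a tangent field extending y. *)
definition normal_hessian ::
    "(complex^'n::finite) set \<Rightarrow> (complex^'n \<Rightarrow> complex^'n) \<Rightarrow> complex^'n \<Rightarrow> complex^'n \<Rightarrow> complex^'n \<Rightarrow> complex^'n" where
  "normal_hessian \<Sigma> V p x y =
     normal_connection \<Sigma> (\<lambda>q. normal_connection \<Sigma> V q (tangent_ext \<Sigma> y q)) p x
     - normal_connection \<Sigma> V p (levi_civita \<Sigma> (tangent_ext \<Sigma> y) p x)"

(* An arbitrary orthonormal basis; it is used only in traces, which do not depend on the choice. *)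
definition tangent_onb :: "(complex^'n::finite) set \<Rightarrow> complex^'n \<Rightarrow> (complex^'n) set" where
  "tangent_onb \<Sigma> p =
     (SOME B. pairwise orthogonal B \<and> (\<forall>e\<in>B. norm e = 1) \<and> span B = tangent_space \<Sigma> p)"

definition mean_curvature :: "(complex^'n::finite) set \<Rightarrow> complex^'n \<Rightarrow> complex^'n" where
  "mean_curvature \<Sigma> p = (\<Sum>e\<in>tangent_onb \<Sigma> p. second_fundamental_form \<Sigma> p e e)"

definition normal_laplacian ::
    "(complex^'n::finite) set \<Rightarrow> (complex^'n \<Rightarrow> complex^'n) \<Rightarrow> complex^'n \<Rightarrow> complex^'n" where
  "normal_laplacian \<Sigma> V p = (\<Sum>e\<in>tangent_onb \<Sigma> p. normal_hessian \<Sigma> V p e e)"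

definition stability_operator ::
    "(complex^'n::finite) set \<Rightarrow> complex^'n \<Rightarrow> (complex^'n \<Rightarrow> complex^'n) \<Rightarrow> complex^'n \<Rightarrow> complex^'n" where
  "stability_operator \<Sigma> T V p =
     normal_laplacian \<Sigma> V p
     + normal_connection \<Sigma> V p (tangent_part \<Sigma> p T)
     + (\<Sum>e\<in>tangent_onb \<Sigma> p. \<Sum>e'\<in>tangent_onb \<Sigma> p.
          (second_fundamental_form \<Sigma> p e e' \<bullet> V p) *\<^sub>R second_fundamental_form \<Sigma> p e e')"

definition translating_soliton :: "(complex^'n::finite) set \<Rightarrow> complex^'n \<Rightarrow> bool" where
  "translating_soliton \<Sigma> T \<longleftrightarrow>
     submanifold \<Sigma> \<and> (\<forall>p\<in>\<Sigma>. normal_part \<Sigma> p T = mean_curvature \<Sigma> p)"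


section \<open>Lagrangian submanifolds and Lagrangian variations\<close>

definition cplx_J :: "complex^'n::finite \<Rightarrow> complex^'n" where
  "cplx_J v = (\<chi> k. \<i> * v $ k)"

definition kahler_form :: "complex^'n::finite \<Rightarrow> complex^'n \<Rightarrow> real" where
  "kahler_form x y = cplx_J x \<bullet> y"

(* The sign convention: the metric is kahler_form applied to the first argument and J of the second. *)
lemma kahler_form_cplx_J: "kahler_form x (cplx_J y) = x \<bullet> y"
  by (simp add: kahler_form_def cplx_J_def inner_vec_def inner_complex_def algebra_simps)

definition lagrangian :: "(complex^'n::finite) set \<Rightarrow> bool" where
  "lagrangian \<Sigma> \<longleftrightarrow>
     submanifold \<Sigma> \<and>
     (\<forall>p\<in>\<Sigma>. \<forall>x\<in>tangent_space \<Sigma> p. \<forall>y\<in>tangent_space \<Sigma> p. kahler_form x y = 0)"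

definition lie_bracket ::
    "(complex^'n::finite) set \<Rightarrow> (complex^'n \<Rightarrow> complex^'n) \<Rightarrow> (complex^'n \<Rightarrow> complex^'n) \<Rightarrow> complex^'n \<Rightarrow> complex^'n" where
  "lie_bracket \<Sigma> X Y p = dir_deriv \<Sigma> Y p (X p) - dir_deriv \<Sigma> X p (Y p)"

(* Exterior derivative of a 1-form:  (d theta)(X,Y) = X(theta(Y)) - Y(theta(X)) - theta([X,Y]). *)
definition ext_deriv ::
    "(complex^'n::finite) set \<Rightarrow> (complex^'n \<Rightarrow> complex^'n \<Rightarrow> real) \<Rightarrow>
     (complex^'n \<Rightarrow> complex^'n) \<Rightarrow> (complex^'n \<Rightarrow> complex^'n) \<Rightarrow> complex^'n \<Rightarrow> real" where
  "ext_deriv \<Sigma> \<theta> X Y p =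
     dir_deriv \<Sigma> (\<lambda>q. \<theta> q (Y q)) p (X p) - dir_deriv \<Sigma> (\<lambda>q. \<theta> q (X q)) p (Y p)
     - \<theta> p (lie_bracket \<Sigma> X Y p)"

definition closed_form :: "(complex^'n::finite) set \<Rightarrow> (complex^'n \<Rightarrow> complex^'n \<Rightarrow> real) \<Rightarrow> bool" where
  "closed_form \<Sigma> \<theta> \<longleftrightarrow>
     (\<forall>X Y. tangent_field \<Sigma> X \<and> tangent_field \<Sigma> Y \<longrightarrow> (\<forall>p\<in>\<Sigma>. ext_deriv \<Sigma> \<theta> X Y p = 0))"

definition theta_form :: "(complex^'n::finite \<Rightarrow> complex^'n) \<Rightarrow> complex^'n \<Rightarrow> complex^'n \<Rightarrow> real" where
  "theta_form V p w = - kahler_form (V p) w"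

definition lagrangian_variation :: "(complex^'n::finite) set \<Rightarrow> (complex^'n \<Rightarrow> complex^'n) \<Rightarrow> bool" where
  "lagrangian_variation \<Sigma> V \<longleftrightarrow> normal_field \<Sigma> V \<and> closed_form \<Sigma> (theta_form V)"


section \<open>The induced area measure and Lagrangian stability\<close>

definition gram_matrix :: "(real^'n::finite \<Rightarrow> complex^'n) \<Rightarrow> real^'n \<Rightarrow> real^'n^'n" where
  "gram_matrix \<phi> x =
     (\<chi> i j. frechet_derivative \<phi> (at x) (axis i 1) \<bullet> frechet_derivative \<phi> (at x) (axis j 1))"

(* The unique Borel measure on the submanifold that is sqrt(det g) dx in every local
   parametrisation. *)
definition area_measure :: "(complex^'n::finite) set \<Rightarrow> (complex^'n) measure" where
  "area_measure \<Sigma> =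
     (THE \<mu>. sets \<mu> = sets (restrict_space borel \<Sigma>) \<and>
        (\<forall>U \<phi> B. local_param \<Sigma> U \<phi> \<and> B \<in> sets borel \<and> B \<subseteq> U \<longrightarrow>
           emeasure \<mu> (\<phi> ` B) = (\<integral>\<^sup>+x\<in>B. ennreal (sqrt (det (gram_matrix \<phi> x))) \<partial>lborel)))"

definition lagrangian_L_stable :: "(complex^'n::finite) set \<Rightarrow> complex^'n \<Rightarrow> bool" where
  "lagrangian_L_stable \<Sigma> T \<longleftrightarrow>
     (\<forall>V. lagrangian_variation \<Sigma> V \<and> compactly_supported \<Sigma> V \<longrightarrow>
        - (LINT p|area_measure \<Sigma>. (stability_operator \<Sigma> T V p \<bullet> V p) * exp (T \<bullet> p)) \<ge> 0)"

end

theory Submission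
  imports Defs
begin

text \<open>
  Let \<open>P\<close> be the orthogonal projection onto the tangent spaces. The Lagrangian condition reads
  \<open>P J = J (1 - P)\<close>, so a normal field is \<open>V = J W\<close> with \<open>W\<close> tangent, and the variation is
  Lagrangian iff the covariant derivative \<open>S = P (DW) P\<close> of \<open>W\<close> is symmetric. Commuting covariant
  derivatives and using the total symmetry of \<open>\<langle>A(x,y), J z\<rangle>\<close> and \<open>T\<^sup>\<bottom> = H\<close>, all curvature terms
  cancel: \<open>\<langle>L V, V\<rangle>\<close> is the derivative along \<open>W\<close> of the weighted divergence
  \<open>u = tr S + \<langle>T, W\<rangle>\<close>. Hence \<open>div (exp \<langle>T, x\<rangle> u W) = exp \<langle>T, x\<rangle> (u\<^sup>2 + \<langle>L V, V\<rangle>)\<close>, and the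
  divergence theorem turns the second variation into the integral of \<open>exp \<langle>T, x\<rangle> u\<^sup>2\<close>.
\<close>

section \<open>Differentiable maps of finite order\<close>

text \<open>The cancellation of curvature has a structural reason. For the weight exp <T,x> the
  relevant tensor is the Bakry-Emery tensor, Ric minus the Hessian of <T,x>. By the Gauss equation
  Ric(w,w) is the sum of <A(e,e),A(w,w)> - |A(e,w)|^2 over an orthonormal basis, and the Hessian at
  (w,w) is <T,A(w,w)> = <H,A(w,w)>. The difference is minus the sum of |A(e,w)|^2, exactly opposite
  to the quadratic term of L. So on closed forms L is minus a weighted Hodge Laplacian.

  The form of the proof is dictated by derivatives within the submanifold, which are determined on
  tangent vectors only. Tensors are therefore operators on the ambient space composed with P, and A
  is the derivative of P; charts serve for second derivatives, regularity and the measure. The area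
  measure is a definite description, so it is usable only after existence and uniqueness are proved.
  The partition of unity behind the divergence theorem is only of class C^1.\<close>

abbreviation der :: "('a::real_normed_vector \<Rightarrow> 'b::real_normed_vector) \<Rightarrow> 'a \<Rightarrow> 'a \<Rightarrow> 'b" where
  "der f x \<equiv> frechet_derivative f (at x)"

text \<open>The inverse is given on \<open>S\<close> alone, which may have smaller dimension, so
  that f' has only a left inverse. Applying that left inverse to the first order error of f at
  \<open>g z\<close> gives the error of g.\<close>

lemma has_derivative_left_inverse_within:
  fixes f :: "'a::real_normed_vector \<Rightarrow> 'b::real_normed_vector"
  assumes f: "(f has_derivative f') (at x)"
    and g': "bounded_linear g'" and inv: "\<And>h. g' (f' h) = h"
    and cont: "continuous (at (f x) within S) g"
    and fg: "\<And>z. z \<in> S \<Longrightarrow> f (g z) = z" and gf: "g (f x) = x"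
  shows "(g has_derivative g') (at (f x) within S)"
  unfolding has_derivative_within_alt
proof (intro conjI allI impI)
  show "bounded_linear g'" by fact
  interpret g': bounded_linear g' by fact
  obtain C where C: "C > 0" "\<And>z. norm (g' z) \<le> norm z * C"
    using g'.pos_bounded by blast
  fix e :: real assume e: "e > 0"
  \<comment> \<open>The first bound makes \<open>C * \<eta>\<close> at most 1/2, so that the error
    can be absorbed into \<open>norm h\<close>; the second makes what remains at most e.\<close>
  define \<eta> where "\<eta> = min (1 / (2 * C)) (e / (2 * C * C))"
  have \<eta>: "\<eta> > 0" "C * \<eta> \<le> 1/2" "C * \<eta> * (2 * C) \<le> e"
    using C(1) e by (auto simp: \<eta>_def min_def field_simps)
  obtain d0 where d0: "d0 > 0"
    "\<And>y. norm (y - x) < d0 \<Longrightarrow> norm (f y - f x - f' (y - x)) \<le> \<eta> * norm (y - x)"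
    using f \<eta>(1) unfolding has_derivative_at_alt by blast
  obtain d where d: "d > 0" "\<And>z. z \<in> S \<Longrightarrow> dist z (f x) < d \<Longrightarrow> dist (g z) (g (f x)) < d0"
    using cont d0(1) unfolding continuous_within_eps_delta by blast
  show "\<exists>d>0. \<forall>z\<in>S. norm (z - f x) < d \<longrightarrow> norm (g z - g (f x) - g' (z - f x)) \<le> e * norm (z - f x)"
  proof (intro exI[of _ d] conjI ballI impI)
    fix z assume z: "z \<in> S" "norm (z - f x) < d"
    define h where "h = g z - x"
    have "norm h < d0" using d(2)[OF z(1)] z(2) gf by (simp add: h_def dist_norm)
    then have r: "norm (z - f x - f' h) \<le> \<eta> * norm h"
      using d0(2)[of "g z"] fg[OF z(1)] by (simp add: h_def)
    have "h - g' (z - f x) = - g' (z - f x - f' h)"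
      using inv[of h] by (simp add: g'.diff)
    then have 1: "norm (h - g' (z - f x)) \<le> C * \<eta> * norm h"
      using order_trans[OF C(2)[of "z - f x - f' h"] mult_right_mono[OF r, of C]] C(1)
      by (simp add: mult_ac)
    have "norm h \<le> norm (g' (z - f x)) + norm (h - g' (z - f x))"
      by (metis add.commute diff_add_cancel norm_triangle_ineq)
    also have "C * \<eta> * norm h \<le> 1/2 * norm h" using \<eta>(2) by (rule mult_right_mono) simp
    ultimately have "norm h \<le> 2 * C * norm (z - f x)"
      using 1 C(2)[of "z - f x"] by (simp add: mult_ac)
    then have "C * \<eta> * norm h \<le> C * \<eta> * (2 * C * norm (z - f x))"
      using C(1) \<eta>(1) by (intro mult_left_mono) auto
    also have "\<dots> \<le> e * norm (z - f x)"
      using mult_right_mono[OF \<eta>(3), of "norm (z - f x)"] by (simp add: mult_ac)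
    finally show "norm (g z - g (f x) - g' (z - f x)) \<le> e * norm (z - f x)"
      using 1 by (simp add: gf h_def)
  qed (use d in auto)
qed

lemma Ck_on_cong:
  assumes "open U" "\<And>x. x \<in> U \<Longrightarrow> f x = g x" "Ck_on k U f"
  shows "Ck_on k U g"
  using assms
proof (induction k arbitrary: f g)
  case 0
  then show ?case using continuous_on_cong[of U U f g] by simp
next
  case (Suc k)
  have der: "(g has_derivative der f x) (at x)" if "x \<in> U" for x
    using Suc.prems that has_derivative_transform_within_open[of f _ x UNIV U g]
    by (auto simp: frechet_derivative_works)
  have "Ck_on k U (\<lambda>x. der g x v)" for v
  proof (rule Suc.IH[OF assms(1)])
    show "der f x v = der g x v" if "x \<in> U" for x
      using frechet_derivative_at[OF der[OF that]] by simp
  qed (use Suc.prems in simp)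
  then show ?case using der by (auto simp: differentiable_def)
qed

lemma Ck_onI:
  assumes "open U" and der: "\<And>x. x \<in> U \<Longrightarrow> (f has_derivative f' x) (at x)"
    and Ck: "\<And>v. Ck_on k U (\<lambda>x. f' x v)"
  shows "Ck_on (Suc k) U f"
proof -
  have "Ck_on k U (\<lambda>x. der f x v)" for v
  proof (rule Ck_on_cong[OF assms(1) _ Ck])
    show "f' x v = der f x v" if "x \<in> U" for x
      using frechet_derivative_at[OF der[OF that]] by simp
  qed
  then show ?thesis
    using der by (auto simp: differentiable_def)
qed

lemma Ck_on_has_derivative:
  "Ck_on (Suc k) U f \<Longrightarrow> x \<in> U \<Longrightarrow> (f has_derivative der f x) (at x)"
  by (simp add: frechet_derivative_works)

lemma Ck_on_Suc_imp: "Ck_on (Suc k) U f \<Longrightarrow> Ck_on k U f"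
proof (induction k arbitrary: f)
  case 0
  then show ?case
    by (auto intro!: continuous_at_imp_continuous_on differentiable_imp_continuous_within)
next
  case (Suc k)
  then show ?case by (metis Ck_on.simps(2))
qed

lemma Ck_on_imp_continuous: "Ck_on k U f \<Longrightarrow> continuous_on U f"
  by (cases k) (auto intro!: continuous_at_imp_continuous_on differentiable_imp_continuous_within)

lemma Ck_on_subset: "Ck_on k U f \<Longrightarrow> V \<subseteq> U \<Longrightarrow> Ck_on k V f"
  by (induction k arbitrary: f) (auto intro: continuous_on_subset)

lemma Ck_on_const: "open U \<Longrightarrow> Ck_on k U (\<lambda>_. c)"
  by (induction k arbitrary: c) (auto intro!: Ck_onI derivative_eq_intros)

lemma Ck_on_linear:
  assumes "open U" "bounded_linear h" "Ck_on k U f"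
  shows "Ck_on k U (\<lambda>x. h (f x))"
  using assms(3)
proof (induction k arbitrary: f)
  case 0
  then show ?case using assms(2) by (simp add: bounded_linear.continuous_on)
next
  case (Suc k)
  show ?case
  proof (rule Ck_onI[OF assms(1)])
    show "((\<lambda>x. h (f x)) has_derivative (\<lambda>v. h (der f x v))) (at x)" if "x \<in> U" for x
      by (intro bounded_linear.has_derivative[OF assms(2)] Ck_on_has_derivative[OF Suc.prems that])
  qed (use Suc in auto)
qed

lemma Ck_on_add:
  assumes "open U" "Ck_on k U f" "Ck_on k U g"
  shows "Ck_on k U (\<lambda>x. f x + g x)"
  using assms(2,3)
proof (induction k arbitrary: f g)
  case 0
  then show ?case by (simp add: continuous_on_add)
next
  case (Suc k)
  show ?case
  proof (rule Ck_onI[OF assms(1)])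
    show "((\<lambda>x. f x + g x) has_derivative
        (\<lambda>v. der f x v + der g x v)) (at x)" if "x \<in> U" for x
      by (intro has_derivative_add Ck_on_has_derivative[OF Suc.prems(1) that]
          Ck_on_has_derivative[OF Suc.prems(2) that])
  qed (use Suc in auto)
qed

lemma Ck_on_sum:
  assumes "open U" "\<And>i. i \<in> I \<Longrightarrow> Ck_on k U (f i)"
  shows "Ck_on k U (\<lambda>x. \<Sum>i\<in>I. f i x)"
  using assms(2)
  by (induction I rule: infinite_finite_induct) (auto intro: Ck_on_add Ck_on_const assms(1))

lemma Ck_on_bilinear:
  assumes "open U" "bounded_bilinear h" "Ck_on k U f" "Ck_on k U g"
  shows "Ck_on k U (\<lambda>x. h (f x) (g x))"
  using assms(3,4)
proof (induction k arbitrary: f g)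
  case 0
  then show ?case using assms(2) by (simp add: bounded_bilinear.continuous_on)
next
  case (Suc k)
  show ?case
  proof (rule Ck_onI[OF assms(1)])
    show "((\<lambda>x. h (f x) (g x)) has_derivative (\<lambda>v. h (f x) (der g x v)
        + h (der f x v) (g x))) (at x)" if "x \<in> U" for x
      by (intro bounded_bilinear.FDERIV[OF assms(2)] Ck_on_has_derivative[OF Suc.prems(1) that]
          Ck_on_has_derivative[OF Suc.prems(2) that])
  next
    show "Ck_on k U (\<lambda>x. h (f x) (der g x v) + h (der f x v) (g x))" for v
      using Suc.prems Suc.prems[THEN Ck_on_Suc_imp]
      by (intro Ck_on_add assms Suc.IH) (auto simp del: Ck_on.simps dest: iffD1[OF Ck_on.simps(2)])
  qed
qed

lemmas Ck_on_mult = Ck_on_bilinear[OF _ bounded_bilinear_mult]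
lemmas Ck_on_scaleR = Ck_on_bilinear[OF _ bounded_bilinear_scaleR]
lemmas Ck_on_inner = Ck_on_bilinear[OF _ bounded_bilinear_inner]

lemma Ck_on_prod:
  fixes f :: "'i \<Rightarrow> 'a::euclidean_space \<Rightarrow> real"
  assumes "open U" "\<And>i. i \<in> I \<Longrightarrow> Ck_on k U (f i)"
  shows "Ck_on k U (\<lambda>x. \<Prod>i\<in>I. f i x)"
  using assms(2)
  by (induction I rule: infinite_finite_induct) (auto intro: Ck_on_mult Ck_on_const assms(1))

lemma Ck_on_inverse:
  fixes f :: "'a::euclidean_space \<Rightarrow> real"
  assumes "open U" "\<And>x. x \<in> U \<Longrightarrow> f x \<noteq> 0" "Ck_on k U f"
  shows "Ck_on k U (\<lambda>x. inverse (f x))"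
  using assms(3)
proof (induction k)
  case 0
  then show ?case using assms(2) by (simp add: continuous_on_inverse)
next
  case (Suc k)
  have k: "Ck_on k U (\<lambda>x. inverse (f x))" using Suc Ck_on_Suc_imp by blast
  show ?case
  proof (rule Ck_onI[OF assms(1)])
    show "((\<lambda>x. inverse (f x)) has_derivative
        (\<lambda>v. (- 1) * (inverse (f x) * der f x v * inverse (f x)))) (at x)" if "x \<in> U" for x
      using Deriv.has_derivative_inverse[OF assms(2)[OF that] Ck_on_has_derivative[OF Suc.prems that]] by simp
  next
    show "Ck_on k U (\<lambda>x. (- 1) * (inverse (f x) * der f x v * inverse (f x)))" for v
      using Suc.prems by (intro Ck_on_mult Ck_on_const k assms(1)) auto
  qed
qed

lemma blinfun_eq_sum:
  fixes f :: "'b::euclidean_space \<Rightarrow>\<^sub>L 'c::euclidean_space"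
  shows "f = (\<Sum>j\<in>Basis. blinfun_scaleR_left (blinfun_apply f j) o\<^sub>L blinfun_inner_left j)"
  by (rule blinfun_eqI)
     (simp add: blinfun.sum_left blinfun.scaleR_left euclidean_representation
        flip: blinfun.scaleR_right blinfun.sum_right)

lemma bounded_linear_rank_one:
  "bounded_linear (\<lambda>c. blinfun_scaleR_left c o\<^sub>L (blinfun_inner_left j :: 'b::euclidean_space \<Rightarrow>\<^sub>L real))"
  by (intro bounded_linear_intros bounded_linear_blinfun_scaleR_left)

text \<open>In finite dimension an operator is a finite sum of rank one operators whose coefficients
  are its values on a basis, so regularity of all values is regularity in the operator norm.\<close>

lemma Ck_on_blinfun:
  fixes f :: "'a::euclidean_space \<Rightarrow> 'b::euclidean_space \<Rightarrow>\<^sub>L 'c::euclidean_space"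
  assumes "open U" "\<And>a. Ck_on k U (\<lambda>x. f x a)"
  shows "Ck_on k U f"
proof -
  have "Ck_on k U (\<lambda>x. \<Sum>j\<in>Basis. blinfun_scaleR_left (blinfun_apply (f x) j) o\<^sub>L blinfun_inner_left j)"
    by (intro Ck_on_sum assms(1) Ck_on_linear[OF assms(1) bounded_linear_rank_one assms(2)])
  then show ?thesis by (simp flip: blinfun_eq_sum)
qed

section \<open>Calculus in Euclidean space\<close>

lemma has_vector_derivative_along_line:
  assumes "(g has_derivative g') (at (y + s *\<^sub>R u))"
  shows "((\<lambda>s. g (y + s *\<^sub>R u)) has_vector_derivative g' u) (at s)"
proof -
  have "((\<lambda>s. g (y + s *\<^sub>R u)) has_derivative (\<lambda>h. g' (h *\<^sub>R u))) (at s)"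
    by (rule has_derivative_compose[of "\<lambda>s. y + s *\<^sub>R u" _ s UNIV g g'])
       (auto intro!: derivative_eq_intros assms)
  then show ?thesis
    using linear_cmul[OF has_derivative_linear[OF assms]]
    by (simp add: has_vector_derivative_def)
qed

text \<open>The mean value theorem is applied along u to the increment
  \<open>g (y + t *\<^sub>R v) - g y\<close>, and then along v to the derivative in direction
  u.\<close>

lemma second_difference_mean_value:
  fixes g :: "'a::euclidean_space \<Rightarrow> real" and u v :: 'a
  assumes g: "Ck_on (Suc (Suc 0)) U g" and t: "t > 0"
    and sub: "\<And>a b. 0 \<le> a \<Longrightarrow> a \<le> t \<Longrightarrow> 0 \<le> b \<Longrightarrow> b \<le> t \<Longrightarrow> x + a *\<^sub>R u + b *\<^sub>R v \<in> U"
  obtains a b where "0 < a" "a < t" "0 < b" "b < t"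
    "g (x + t *\<^sub>R u + t *\<^sub>R v) - g (x + t *\<^sub>R u) - g (x + t *\<^sub>R v) + g x
      = t * t * der (\<lambda>y. der g y u) (x + a *\<^sub>R u + b *\<^sub>R v) v"
proof -
  define G where "G y = der g y u" for y
  have g1: "(g has_derivative der g y) (at y)" if "y \<in> U" for y
    using Ck_on_has_derivative[OF g that] .
  have G1: "(G has_derivative der G y) (at y)" if "y \<in> U" for y
    using g that unfolding G_def by (auto simp: frechet_derivative_works)
  have "((\<lambda>s. g ((x + t *\<^sub>R v) + s *\<^sub>R u) - g (x + s *\<^sub>R u)) has_real_derivative
      (G ((x + t *\<^sub>R v) + s *\<^sub>R u) - G (x + s *\<^sub>R u))) (at s)" if "0 \<le> s" "s \<le> t" for s
  proof -
    have "x + t *\<^sub>R v + s *\<^sub>R u \<in> U" "x + s *\<^sub>R u \<in> U"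
      using sub[of s t] sub[of s 0] that t by (auto simp: add_ac)
    then show ?thesis
      unfolding G_def has_real_derivative_iff_has_vector_derivative
      by (intro has_vector_derivative_diff has_vector_derivative_along_line g1)
  qed
  from MVT2[OF t this] obtain a where a: "0 < a" "a < t"
    and eq1: "g (x + t *\<^sub>R v + t *\<^sub>R u) - g (x + t *\<^sub>R u) - (g (x + t *\<^sub>R v) - g x)
      = t * (G (x + t *\<^sub>R v + a *\<^sub>R u) - G (x + a *\<^sub>R u))" by auto
  have "((\<lambda>s. G ((x + a *\<^sub>R u) + s *\<^sub>R v)) has_real_derivative
      (der G (x + a *\<^sub>R u + s *\<^sub>R v) v)) (at s)" if "0 \<le> s" "s \<le> t" for s
    unfolding has_real_derivative_iff_has_vector_derivative
    using that a by (intro has_vector_derivative_along_line G1 sub) auto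
  from MVT2[OF t this] obtain b where b: "0 < b" "b < t"
    and eq2: "G (x + a *\<^sub>R u + t *\<^sub>R v) - G (x + a *\<^sub>R u)
      = t * der G (x + a *\<^sub>R u + b *\<^sub>R v) v" by auto
  show thesis
    by (rule that[OF a b]) (use eq1 eq2 in \<open>simp add: G_def[abs_def] add_ac\<close>)
qed

text \<open>The second difference over a parallelogram is symmetric in u and v. Evaluated in both
  orders it equates the two mixed derivatives at points near x, which contradicts continuity if they
  differ at x.\<close>

lemma symmetric_second_derivative_real:
  fixes g :: "'a::euclidean_space \<Rightarrow> real"
  assumes U: "open U" "x \<in> U" and g: "Ck_on (Suc (Suc 0)) U g"
  shows "der (\<lambda>y. der g y u) x v
    = der (\<lambda>y. der g y v) x u"
proof (rule ccontr)
  define A where "A y = der (\<lambda>y. der g y u) y v" for y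
  define B where "B y = der (\<lambda>y. der g y v) y u" for y
  assume "der (\<lambda>y. der g y u) x v
    \<noteq> der (\<lambda>y. der g y v) x u"
  then have e: "dist (A x) (B x) / 2 > 0" by (simp add: A_def B_def)
  have "continuous_on U A" "continuous_on U B" using g by (auto simp: A_def[abs_def] B_def[abs_def])
  then have "isCont A x" "isCont B x" using U by (simp_all add: continuous_on_eq_continuous_at)
  then obtain d1 d2 where d: "d1 > 0" "d2 > 0"
    "\<And>y. dist y x < d1 \<Longrightarrow> dist (A y) (A x) < dist (A x) (B x) / 2"
    "\<And>y. dist y x < d2 \<Longrightarrow> dist (B y) (B x) < dist (A x) (B x) / 2"
    using e unfolding continuous_at_eps_delta by metis
  obtain d0 where d0: "d0 > 0" "ball x d0 \<subseteq> U" using U openE by blast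
  define d where "d = min d0 (min d1 d2)"
  \<comment> \<open>The parallelogram with sides t u and t v then stays within distance d of x; the
    summand 1 covers u = v = 0.\<close>
  define t where "t = d / (norm u + norm v + 1) / 2"
  have d': "d > 0" using d d0 by (simp add: d_def)
  then have t: "t > 0" unfolding t_def
    by (intro divide_pos_pos) (auto intro: add_nonneg_pos)
  have td: "t * (norm u + norm v + 1) < d" using d'
  proof -
    have "norm u + norm v + 1 > 0" by (simp add: add_nonneg_pos)
    then have "t * (norm u + norm v + 1) = d / 2" by (simp add: t_def divide_simps)
    then show ?thesis using d' by simp
  qed
  have near: "dist (x + a *\<^sub>R u + b *\<^sub>R v) x < d" if "0 \<le> a" "a \<le> t" "0 \<le> b" "b \<le> t" for a b
  proof -
    have "norm (a *\<^sub>R u + b *\<^sub>R v) \<le> a * norm u + b * norm v"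
      using that norm_triangle_ineq[of "a *\<^sub>R u" "b *\<^sub>R v"] by simp
    also have "\<dots> \<le> t * norm u + t * norm v" using that by (intro add_mono mult_right_mono) auto
    also have "\<dots> < d" using td t by (simp add: algebra_simps)
    finally show ?thesis by (simp add: dist_norm algebra_simps)
  qed
  have sub: "x + a *\<^sub>R u + b *\<^sub>R v \<in> U" if "0 \<le> a" "a \<le> t" "0 \<le> b" "b \<le> t" for a b
    using near[OF that] d0(2) by (auto simp: d_def dist_commute subset_eq)
  obtain a b where ab: "0 < a" "a < t" "0 < b" "b < t"
    "g (x + t *\<^sub>R u + t *\<^sub>R v) - g (x + t *\<^sub>R u) - g (x + t *\<^sub>R v) + g x
      = t * t * A (x + a *\<^sub>R u + b *\<^sub>R v)"
    using second_difference_mean_value[where x=x and u=u and v=v, OF g t sub] unfolding A_def by blast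
  have sub': "x + a *\<^sub>R v + b *\<^sub>R u \<in> U" if "0 \<le> a" "a \<le> t" "0 \<le> b" "b \<le> t" for a b
    using sub[of b a] that by (simp add: add_ac)
  obtain a' b' where ab': "0 < a'" "a' < t" "0 < b'" "b' < t"
    "g (x + t *\<^sub>R v + t *\<^sub>R u) - g (x + t *\<^sub>R v) - g (x + t *\<^sub>R u) + g x
      = t * t * B (x + a' *\<^sub>R v + b' *\<^sub>R u)"
    using second_difference_mean_value[where x=x and u=v and v=u, OF g t sub'] unfolding B_def by blast
  have "t * t * A (x + a *\<^sub>R u + b *\<^sub>R v) = t * t * B (x + b' *\<^sub>R u + a' *\<^sub>R v)"
    using ab(5) ab'(5) by (simp add: algebra_simps)
  then have "A (x + a *\<^sub>R u + b *\<^sub>R v) = B (x + b' *\<^sub>R u + a' *\<^sub>R v)" using t by simp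
  moreover have "dist (A (x + a *\<^sub>R u + b *\<^sub>R v)) (A x) < dist (A x) (B x) / 2"
    using near[of a b] ab(1-4) by (intro d(3)) (simp add: d_def)
  moreover have "dist (B (x + b' *\<^sub>R u + a' *\<^sub>R v)) (B x) < dist (A x) (B x) / 2"
    using near[of b' a'] ab'(1-4) by (intro d(4)) (simp add: d_def)
  ultimately show False
    by (metis dist_commute dist_triangle_half_r less_irrefl)
qed

lemma symmetric_second_derivative:
  fixes f :: "'a::euclidean_space \<Rightarrow> 'b::euclidean_space"
  assumes U: "open U" "x \<in> U" and f: "Ck_on (Suc (Suc 0)) U f"
  shows "der (\<lambda>y. der f y u) x v
    = der (\<lambda>y. der f y v) x u"
proof (rule euclidean_eqI)
  fix b :: 'b assume "b \<in> Basis"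
  let ?g = "\<lambda>y. f y \<bullet> b"
  have g: "Ck_on (Suc (Suc 0)) U ?g"
    by (rule Ck_on_linear[OF U(1) bounded_linear_inner_left f])
  have D: "der ?g y w = der f y w \<bullet> b" if "y \<in> U" for y w
    using has_derivative_inner_left[OF Ck_on_has_derivative[OF f that], of b]
    by (metis frechet_derivative_at)
  have D2: "der (\<lambda>y. der ?g y w) x z
     = der (\<lambda>y. der f y w) x z \<bullet> b" for w z
  proof -
    have "((\<lambda>y. der f y w) has_derivative
        der (\<lambda>y. der f y w) x) (at x)"
      using f U(2) by (auto simp: frechet_derivative_works)
    from has_derivative_inner_left[OF this, of b]
    have "((\<lambda>y. der ?g y w) has_derivative
        (\<lambda>z. der (\<lambda>y. der f y w) x z \<bullet> b)) (at x)"
      by (rule has_derivative_transform_within_open[OF _ U]) (simp add: D)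
    then show ?thesis by (metis frechet_derivative_at)
  qed
  show "der (\<lambda>y. der f y u) x v \<bullet> b
    = der (\<lambda>y. der f y v) x u \<bullet> b"
    using symmetric_second_derivative_real[OF U g] by (simp only: D2)
qed

text \<open>A permutation other than the identity moves at least two points. Its product with one
  factor removed still contains an off-diagonal entry of the identity matrix, so only the identity
  permutation contributes.\<close>

lemma det_has_derivative_at_identity:
  fixes C :: "'a::real_normed_vector \<Rightarrow> real^'n::finite^'n"
  assumes C: "\<And>i j. ((\<lambda>y. C y $ i $ j) has_derivative C' i j) (at x)" and id: "C x = mat 1"
  shows "((\<lambda>y. det (C y)) has_derivative (\<lambda>h. \<Sum>i\<in>UNIV. C' i i h)) (at x)"
proof -
  let ?D = "\<lambda>p h. of_int (sign p) * (\<Sum>i\<in>UNIV. C' i (p i) h * (\<Prod>j\<in>UNIV - {i}. C x $ j $ p j))"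
  have "((\<lambda>y. det (C y)) has_derivative (\<lambda>h. \<Sum>p\<in>{p. p permutes (UNIV::'n set)}. ?D p h)) (at x)"
    unfolding det_def
    by (intro has_derivative_sum has_derivative_mult_right has_derivative_prod C)
  moreover have "(\<Sum>p\<in>{p. p permutes (UNIV::'n set)}. ?D p h) = (\<Sum>i\<in>UNIV. C' i i h)" for h
  proof -
    have "?D p h = (if p = id then (\<Sum>i\<in>UNIV. C' i i h) else 0)" if p: "p permutes UNIV" for p :: "'n \<Rightarrow> 'n"
    proof (cases "p = id")
      case True
      then show ?thesis by (simp add: id mat_def sign_id)
    next
      case False
      have "(\<Prod>j\<in>UNIV - {i}. C x $ j $ p j) = 0" for i
      proof -
        obtain j where j: "p j \<noteq> j" using False by fastforce
        moreover have "p (p j) \<noteq> p j" using j permutes_inj[OF p] by (metis injD)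
        ultimately obtain k where "k \<noteq> i" "p k \<noteq> k" by metis
        then show ?thesis
          using prod_zero[of "UNIV - {i}" "\<lambda>j. C x $ j $ p j"] by (force simp: id mat_def)
      qed
      then have "(\<Sum>i\<in>UNIV. C' i (p i) h * (\<Prod>j\<in>UNIV - {i}. C x $ j $ p j)) = 0"
        by (intro sum.neutral ballI) (simp only: mult_zero_right)
      then show ?thesis using False by simp
    qed
    then show ?thesis
      using permutes_id[of "UNIV::'n set"] by (simp add: sum.delta' finite_permutations cong: sum.cong_simp)
  qed
  ultimately show ?thesis by simp
qed

text \<open>Multiplication by the inverse B moves the base point to the identity matrix, and
  \<open>det (A x)\<close> restores the scale.\<close>

lemma Jacobi_formula:
  fixes A :: "'a::real_normed_vector \<Rightarrow> real^'n::finite^'n"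
  assumes A: "\<And>i j. ((\<lambda>y. A y $ i $ j) has_derivative A' i j) (at x)"
    and inv: "A x ** B = mat 1"
  shows "((\<lambda>y. det (A y)) has_derivative (\<lambda>h. det (A x) * (\<Sum>i\<in>UNIV. \<Sum>j\<in>UNIV. B $ i $ j * A' j i h))) (at x)"
proof -
  have BA: "B ** A x = mat 1" using inv matrix_left_right_inverse by blast
  have "((\<lambda>y. det (B ** A y)) has_derivative (\<lambda>h. \<Sum>i\<in>UNIV. \<Sum>j\<in>UNIV. B $ i $ j * A' j i h)) (at x)"
  proof (rule det_has_derivative_at_identity[where C' = "\<lambda>i j h. \<Sum>k\<in>UNIV. B $ i $ k * A' k j h"])
    show "((\<lambda>y. (B ** A y) $ i $ j) has_derivative (\<lambda>h. \<Sum>k\<in>UNIV. B $ i $ k * A' k j h)) (at x)" for i j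
      unfolding matrix_matrix_mult_def
      by (simp, intro has_derivative_sum has_derivative_mult_right A)
  qed (rule BA)
  then have "((\<lambda>y. det (A x) * det (B ** A y)) has_derivative
      (\<lambda>h. det (A x) * (\<Sum>i\<in>UNIV. \<Sum>j\<in>UNIV. B $ i $ j * A' j i h))) (at x)"
    by (rule has_derivative_mult_right)
  moreover have "det (A x) * det (B ** A y) = det (A y)" for y
    by (metis det_mul inv matrix_mul_assoc matrix_mul_lid)
  ultimately show ?thesis by simp
qed

section \<open>Determinants under a relabelling of the index type\<close>

lemma swapidseq_conjugate:
  assumes "swapidseq n p" "bij r"
  shows "swapidseq n (inv r \<circ> p \<circ> r)"
  using assms(1)
proof induction
  case id
  have "inv r \<circ> id \<circ> r = id"
    using inv_o_cancel[OF bij_is_inj[OF assms(2)]] by (simp only: comp_id)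
  then show ?case by (simp only: swapidseq.id)
next
  case (comp_Suc n p a b)
  have "inv r \<circ> (Transposition.transpose a b \<circ> p) \<circ> r = Transposition.transpose (inv r a) (inv r b) \<circ> (inv r \<circ> p \<circ> r)"
  proof
    fix x
    have "inv r c = inv r d \<longleftrightarrow> c = d" for c d
      using assms(2) bij_imp_bij_inv bij_is_inj inj_eq by metis
    moreover have "r (inv r c) = c" for c
      using assms(2) by (simp add: bij_is_surj surj_f_inv_f)
    ultimately show "(inv r \<circ> (Transposition.transpose a b \<circ> p) \<circ> r) x
      = (Transposition.transpose (inv r a) (inv r b) \<circ> (inv r \<circ> p \<circ> r)) x"
      by (simp add: Transposition.transpose_def)
  qed
  moreover have "inv r a \<noteq> inv r b" using comp_Suc assms(2) by (metis bij_inv_eq_iff)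
  ultimately show ?case using swapidseq.comp_Suc[OF comp_Suc.IH] by metis
qed

lemma sign_conjugate:
  assumes "permutation p" "bij r"
  shows "sign (inv r \<circ> p \<circ> r) = sign p"
proof -
  obtain n where n: "swapidseq n p" using assms(1) by (auto simp: permutation_def)
  have "evenperm (inv r \<circ> p \<circ> r) = evenperm p"
    using evenperm_unique[OF n refl] evenperm_unique[OF swapidseq_conjugate[OF n assms(2)] refl] by simp
  then show ?thesis by (simp add: sign_def)
qed

text \<open>The bijection connects two index types, so permutations are carried over by conjugation;
  it turns transpositions into transpositions and therefore keeps signs.\<close>

lemma det_reindex:
  fixes A :: "real^'n::finite^'n" and r :: "'m::finite \<Rightarrow> 'n"
  assumes r: "bij r"
  shows "det (\<chi> i j. A $ r i $ r j :: real^'m^'m) = det A"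
proof -
  have conj: "inv r \<circ> p \<circ> r permutes UNIV" if "p permutes UNIV" for p
    using that r by (intro bij_imp_permutes bij_comp bij_imp_bij_inv) (auto simp: permutes_bij)
  have conj': "r \<circ> q \<circ> inv r permutes UNIV" if "q permutes UNIV" for q
    using that r by (intro bij_imp_permutes bij_comp bij_imp_bij_inv) (auto simp: permutes_bij)
  show ?thesis
    unfolding det_def
  proof (rule sum.reindex_bij_witness[where i = "\<lambda>p. inv r \<circ> p \<circ> r" and j = "\<lambda>q. r \<circ> q \<circ> inv r"])
    fix q :: "'m \<Rightarrow> 'm" assume "q \<in> {p. p permutes UNIV}"
    then have q: "q permutes UNIV" by simp
    show "inv r \<circ> (r \<circ> q \<circ> inv r) \<circ> r = q" using r by (auto simp: fun_eq_iff bij_is_inj)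
    show "r \<circ> q \<circ> inv r \<in> {p. p permutes UNIV}" using conj'[OF q] by simp
    have s: "sign (r \<circ> q \<circ> inv r) = sign q"
      using sign_conjugate[of "r \<circ> q \<circ> inv r" r] r conj'[OF q] \<open>inv r \<circ> (r \<circ> q \<circ> inv r) \<circ> r = q\<close>
      by (metis permutation_permutes finite_class.finite_UNIV)
    have "(\<Prod>i\<in>UNIV. A $ i $ (r \<circ> q \<circ> inv r) i) = (\<Prod>i\<in>UNIV. A $ r i $ r (q i))"
      using prod.reindex_bij_betw[of r UNIV UNIV "\<lambda>i. A $ i $ (r \<circ> q \<circ> inv r) i"] r
      by (simp add: bij_is_inj)
    then show "of_int (sign (r \<circ> q \<circ> inv r)) * (\<Prod>i\<in>UNIV. A $ i $ (r \<circ> q \<circ> inv r) i)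
      = of_int (sign q) * (\<Prod>i\<in>UNIV. (\<chi> i j. A $ r i $ r j) $ i $ q i)"
      by (simp add: s)
  next
    fix p :: "'n \<Rightarrow> 'n" assume "p \<in> {p. p permutes UNIV}"
    then show "inv r \<circ> p \<circ> r \<in> {p. p permutes UNIV}" using conj by simp
    show "r \<circ> (inv r \<circ> p \<circ> r) \<circ> inv r = p" using r by (auto simp: fun_eq_iff bij_is_surj surj_f_inv_f)
  qed
qed

text \<open>Difference quotients along v have integral zero by translation invariance of Lebesgue
  measure. By the mean value theorem they are uniformly bounded, and all vanish outside one compact
  set, so dominated convergence passes to the derivative.\<close>

lemma integral_derivative_eq_0:
  fixes F :: "'a::euclidean_space \<Rightarrow> real"
  assumes K: "compact K" "\<And>x. x \<notin> K \<Longrightarrow> F x = 0"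
    and F: "\<And>x. (F has_derivative F' x) (at x)" and cont: "continuous_on UNIV (\<lambda>x. F' x v)"
  shows "has_bochner_integral lborel (\<lambda>x. F' x v) 0"
proof -
  \<comment> \<open>The points from which some step s v with 0 \<le> s \<le> 1 leads into K. The
    supports of all difference quotients below lie in this set, as their step lengths are at most
    1.\<close>
  define K' where "K' = (\<lambda>(y, s). y - s *\<^sub>R v) ` (K \<times> {0..1::real})"
  have K': "compact K'" unfolding K'_def
    by (intro compact_continuous_image compact_Times K)
       (auto intro!: continuous_intros simp: case_prod_unfold)
  have F'0: "F' x v = 0" if "x \<notin> K" for x
  proof -
    have "open (- K)" using K(1) by (simp add: compact_imp_closed open_Compl)
    then have "((\<lambda>_. 0) has_derivative F' x) (at x)"
      using has_derivative_transform_within_open[OF F[of x], of "- K" "\<lambda>_. 0"] K(2) that by auto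
    then have "F' x = (\<lambda>_. 0)" by (rule has_derivative_unique) (rule has_derivative_const)
    then show ?thesis by simp
  qed
  obtain M where M: "\<And>x. \<bar>F' x v\<bar> \<le> M" "M \<ge> 0"
  proof -
    have "bounded ((\<lambda>x. F' x v) ` K)"
      by (intro compact_imp_bounded compact_continuous_image K continuous_on_subset[OF cont]) auto
    then obtain B where "\<And>x. x \<in> K \<Longrightarrow> \<bar>F' x v\<bar> \<le> B" by (auto simp: bounded_iff)
    then have "\<bar>F' x v\<bar> \<le> max B 0" for x using F'0[of x] by (cases "x \<in> K") (auto intro: max.coboundedI1)
    then show thesis by (rule that) simp
  qed
  have contF: "continuous_on UNIV F"
    using F by (auto intro!: continuous_at_imp_continuous_on has_derivative_continuous)
  have intF: "integrable lborel F"
  proof -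
    have "set_integrable lborel K F"
      unfolding set_integrable_def
      using borel_integrable_compact[OF K(1) continuous_on_subset[OF contF]] by (simp add: indicator_def of_bool_def)
    moreover have "(\<lambda>x. indicator K x *\<^sub>R F x) = F" using K(2) by (force simp: indicator_def)
    ultimately show ?thesis by (simp add: set_integrable_def)
  qed
  define c where "c n = real (Suc n)" for n
  define h where "h n x = c n * (F (x + (1 / c n) *\<^sub>R v) - F x)" for n x
  have c: "c n > 0" "1 / c n \<le> 1" for n by (auto simp: c_def)
  have mvt: "\<exists>s. 0 < s \<and> s < 1 / c n \<and> h n x = F' (x + s *\<^sub>R v) v" for n x
  proof -
    have "((\<lambda>s. F (x + s *\<^sub>R v)) has_real_derivative F' (x + s *\<^sub>R v) v) (at s)" for s
      unfolding has_real_derivative_iff_has_vector_derivative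
      by (rule has_vector_derivative_along_line[OF F])
    moreover have "0 < 1 / c n" using c(1) by simp
    ultimately obtain s where "0 < s" "s < 1 / c n"
      "F (x + (1 / c n) *\<^sub>R v) - F (x + 0 *\<^sub>R v) = (1 / c n - 0) * F' (x + s *\<^sub>R v) v"
      using MVT2[of 0 "1 / c n" "\<lambda>s. F (x + s *\<^sub>R v)" "\<lambda>s. F' (x + s *\<^sub>R v) v"] by blast
    then show ?thesis using c(1)[of n] by (intro exI[of _ s]) (auto simp: h_def)
  qed
  have bound: "norm (h n x) \<le> M * indicator K' x" for n x
  proof (cases "x \<in> K'")
    case True
    obtain t where "h n x = F' (x + t *\<^sub>R v) v" using mvt[of n x] by blast
    then have "norm (h n x) \<le> M" using M(1)[of "x + t *\<^sub>R v"] by (simp only: real_norm_def)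
    then show ?thesis using True by (simp only: indicator_simps mult_1_right)
  next
    case False
    have notin: "x + s *\<^sub>R v \<notin> K" if "0 \<le> s" "s \<le> 1" for s
    proof
      assume "x + s *\<^sub>R v \<in> K"
      then have "(\<lambda>(y, s). y - s *\<^sub>R v) (x + s *\<^sub>R v, s) \<in> K'" unfolding K'_def
        using that by (intro imageI) simp
      then show False using False by simp
    qed
    have "0 \<le> 1 / c n" using c(1)[of n] by simp
    then have "F (x + (1 / c n) *\<^sub>R v) = 0" "F x = 0"
      using K(2)[OF notin[of "1 / c n"]] K(2)[OF notin[of 0]] c(2)[of n] by simp_all
    then have "h n x = 0" by (simp only: h_def) simp
    then show ?thesis using M(2) by simp
  qed
  have lim: "(\<lambda>n. h n x) \<longlonglongrightarrow> F' x v" for x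
  proof -
    have "\<forall>n. \<exists>s. 0 < s \<and> s < 1 / c n \<and> h n x = F' (x + s *\<^sub>R v) v"
      using mvt by blast
    from choice[OF this] obtain s
      where s: "\<And>n. 0 < s n \<and> s n < 1 / c n \<and> h n x = F' (x + s n *\<^sub>R v) v" by blast
    have "s \<longlonglongrightarrow> 0"
    proof (rule tendsto_sandwich)
      show "(\<lambda>n. 0) \<longlonglongrightarrow> (0::real)" by simp
      show "(\<lambda>n. 1 / c n) \<longlonglongrightarrow> 0" unfolding c_def
        using LIMSEQ_inverse_real_of_nat by (simp add: inverse_eq_divide)
    qed (use s in \<open>auto intro!: always_eventually less_imp_le\<close>)
    then have "(\<lambda>n. x + s n *\<^sub>R v) \<longlonglongrightarrow> x + 0 *\<^sub>R v" by (intro tendsto_intros)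
    then have "(\<lambda>n. F' (x + s n *\<^sub>R v) v) \<longlonglongrightarrow> F' (x + 0 *\<^sub>R v) v"
      using continuous_on_tendsto_compose[OF cont] by simp
    then show ?thesis using s by simp
  qed
  have int0: "(\<integral>x. h n x \<partial>lborel) = 0" for n
  proof -
    have eq: "(\<integral>x. F (x + a) \<partial>lborel) = (\<integral>x. F x \<partial>lborel)" and int: "integrable lborel (\<lambda>x. F (x + a))" for a
    proof -
      have [measurable]: "F \<in> borel_measurable borel"
        using contF by (rule borel_measurable_continuous_onI)
      have "(\<integral>x. F x \<partial>distr lborel borel ((+) a)) = (\<integral>x. F (a + x) \<partial>lborel)"
        by (rule integral_distr) auto
      then show "(\<integral>x. F (x + a) \<partial>lborel) = (\<integral>x. F x \<partial>lborel)" by (simp add: lborel_distr_plus add_ac)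
      have "integrable (distr lborel borel ((+) a)) F = integrable lborel (\<lambda>x. F (a + x))"
        by (rule integrable_distr_eq) auto
      then show "integrable lborel (\<lambda>x. F (x + a))" using intF by (simp add: lborel_distr_plus add_ac)
    qed
    show ?thesis unfolding h_def using int eq intF by simp
  qed
  have meas: "(\<lambda>x. F' x v) \<in> borel_measurable lborel"
    using borel_measurable_continuous_onI[OF cont] by simp
  have hm: "h n \<in> borel_measurable lborel" for n
    unfolding h_def by (simp, intro borel_measurable_continuous_onI continuous_intros continuous_on_compose2[OF contF]) auto
  have w: "integrable lborel (\<lambda>x. M * indicator K' x)"
    using K' emeasure_bounded_finite[OF compact_imp_bounded[OF K']]
    by (intro integrable_mult_right integrable_real_indicator) (auto simp: compact_imp_closed)
  have "(\<lambda>n. \<integral>x. h n x \<partial>lborel) \<longlonglongrightarrow> (\<integral>x. F' x v \<partial>lborel)"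
    by (rule integral_dominated_convergence[OF meas hm w]) (use lim bound in auto)
  then have "(\<integral>x. F' x v \<partial>lborel) = 0" using int0 by (simp add: LIMSEQ_const_iff)
  moreover have "integrable lborel (\<lambda>x. F' x v)"
    by (rule integrable_dominated_convergence[where s = h, OF meas _ w]) (use hm lim bound in auto)
  ultimately show ?thesis by (simp add: has_bochner_integral_iff)
qed

section \<open>Tangent spaces and derivatives along a submanifold\<close>

lemma linear_eq_sum_axis:
  fixes f :: "real^'n::finite \<Rightarrow> 'b::real_vector"
  assumes "linear f"
  shows "f c = (\<Sum>k\<in>UNIV. c $ k *\<^sub>R f (axis k 1))"
proof -
  have "f c = f (\<Sum>k\<in>UNIV. c $ k *\<^sub>R axis k 1)"
    by (simp add: scalar_mult_eq_scaleR[symmetric] basis_expansion)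
  also have "\<dots> = (\<Sum>k\<in>UNIV. c $ k *\<^sub>R f (axis k 1))"
    using assms by (simp add: linear_sum linear_cmul)
  finally show ?thesis .
qed

definition gram :: "(real^'n::finite \<Rightarrow> 'b::real_inner) \<Rightarrow> real^'n^'n" where
  "gram f = (\<chi> i j. f (axis i 1) \<bullet> f (axis j 1))"

lemma gram_matrix_eq_gram: "gram_matrix \<phi> x = gram (der \<phi> x)"
  by (simp add: gram_matrix_def gram_def)

lemma gram_mult_inner:
  assumes "linear f"
  shows "(gram f *v c) $ i = f (axis i 1) \<bullet> f c"
  by (subst (2) linear_eq_sum_axis[OF assms])
     (simp add: gram_def matrix_vector_mult_def inner_sum_right mult_ac)

text \<open>With f the derivative of a chart and t that of a transition map, this is the
  transformation law of the squared area density.\<close>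

lemma det_gram_compose:
  fixes f :: "real^'n::finite \<Rightarrow> 'b::real_inner" and t :: "real^'n \<Rightarrow> real^'n"
  assumes f: "linear f" and t: "linear t"
  shows "det (gram (\<lambda>c. f (t c))) = (det (matrix t))\<^sup>2 * det (gram f)"
proof -
  have "gram (\<lambda>c. f (t c)) = Finite_Cartesian_Product.transpose (matrix t) ** (gram f ** matrix t)"
  proof -
    have "(gram f ** matrix t) $ k $ j = f (axis k 1) \<bullet> f (t (axis j 1))" for k j
      using gram_mult_inner[OF f, of "t (axis j 1)" k]
      by (simp add: matrix_matrix_mult_def matrix_vector_mult_def matrix_def)
    then have "(Finite_Cartesian_Product.transpose (matrix t) ** (gram f ** matrix t)) $ i $ j
        = (\<Sum>k\<in>UNIV. t (axis i 1) $ k * (f (axis k 1) \<bullet> f (t (axis j 1))))" for i j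
      by (subst matrix_matrix_mult_def) (simp add: transpose_def matrix_def)
    also have "\<dots> i j = f (t (axis i 1)) \<bullet> f (t (axis j 1))" for i j
      by (subst linear_eq_sum_axis[OF f, of "t (axis i 1)"]) (simp add: inner_sum_left)
    finally show ?thesis by (simp add: vec_eq_iff gram_def)
  qed
  then show ?thesis by (simp add: det_mul det_transpose power2_eq_square)
qed

text \<open>An isometry h from the parameter space onto the range of f has the identity as Gram
  matrix. Factoring f as h after a bijection t leaves the square of a nonzero determinant.\<close>

lemma det_gram_pos:
  fixes f :: "real^'n::finite \<Rightarrow> 'b::euclidean_space"
  assumes f: "linear f" "inj f"
  shows "det (gram f) > 0"
proof -
  have "dim (UNIV :: (real^'n) set) = dim (range f)"
    using dim_image_eq[of f UNIV] f by simp
  then obtain h g :: "_ \<Rightarrow> _" where hg: "linear h" "linear g" "h ` (UNIV :: (real^'n) set) = range f"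
      "g ` range f = UNIV" "\<And>x. norm (h x) = norm x" "\<And>x. g (h x) = x" "\<And>x. x \<in> range f \<Longrightarrow> h (g x) = x"
    using isometries_subspaces[of "UNIV :: (real^'n) set" "range f"] f(1)
    by (metis UNIV_I linear_subspace_image subspace_UNIV)
  have inner: "h x \<bullet> h y = x \<bullet> y" for x y
  proof -
    have "h (x + y) = h x + h y" using hg(1) by (simp add: linear_add)
    then show ?thesis using hg(5)[of "x + y"] by (simp add: dot_norm hg(5))
  qed
  let ?t = "\<lambda>x. g (f x)"
  have t: "linear ?t" using f(1) hg(2) linear_compose[of f g] by (simp add: o_def)
  have "inj ?t" using f(2) hg(7) by (intro injI) (metis injD rangeI)
  then have "det (matrix ?t) \<noteq> 0" using t det_nz_iff_inj by blast
  moreover have "gram h = mat 1" by (auto simp: gram_def mat_def vec_eq_iff inner inner_axis_axis)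
  moreover have "(\<lambda>x. h (?t x)) = f" using hg(7) by (auto simp: fun_eq_iff)
  ultimately show ?thesis using det_gram_compose[OF hg(1) t] by simp
qed

text \<open>Cramer's rule makes the smooth dependence on \<open>f\<close> evident.\<close>
definition coords :: "(real^'n::finite \<Rightarrow> 'b::real_inner) \<Rightarrow> 'b \<Rightarrow> real^'n" where
  "coords f a = (\<chi> k. det (\<chi> i j. if j = k then f (axis i 1) \<bullet> a else gram f $ i $ j) / det (gram f))"

text \<open>The linear system behind \<open>coords\<close> is that of the normal equations, so
  \<open>f (coords f a)\<close> is the orthogonal projection of a onto the range of f.\<close>

lemma coords_orthogonal:
  fixes f :: "real^'n::finite \<Rightarrow> 'b::euclidean_space"
  assumes f: "linear f" "inj f"
  shows "f c \<bullet> (a - f (coords f a)) = 0"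
proof -
  have "gram f *v coords f a = (\<chi> i. f (axis i 1) \<bullet> a)"
    using cramer[of "gram f" "coords f a" "\<chi> i. f (axis i 1) \<bullet> a"] det_gram_pos[OF f]
    by (simp add: coords_def cong: if_cong)
  then have "f (axis i 1) \<bullet> (a - f (coords f a)) = 0" for i
    using gram_mult_inner[OF f(1), of "coords f a" i] by (simp add: inner_diff_right)
  then show ?thesis
    by (subst linear_eq_sum_axis[OF f(1)]) (simp add: inner_sum_left)
qed

lemma coords_apply:
  fixes f :: "real^'n::finite \<Rightarrow> 'b::euclidean_space"
  assumes f: "linear f" "inj f"
  shows "coords f (f c) = c"
proof -
  have "f (c - coords f (f c)) \<bullet> f (c - coords f (f c)) = 0"
    using coords_orthogonal[OF f, of "c - coords f (f c)" "f c"] f(1) by (simp add: linear_diff)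
  then have "f (c - coords f (f c)) = f 0" using f(1) by (simp add: linear_0)
  then show ?thesis using injD[OF f(2)] by fastforce
qed

lemma Ck_on_det:
  fixes A :: "'a::euclidean_space \<Rightarrow> real^'n::finite^'n"
  assumes "open U" "\<And>i j. Ck_on k U (\<lambda>x. A x $ i $ j)"
  shows "Ck_on k U (\<lambda>x. det (A x))"
  unfolding det_def
  by (intro Ck_on_sum Ck_on_mult Ck_on_const Ck_on_prod assms)

section \<open>Calculus in local parametrisations\<close>

lemma local_param_open: "local_param \<Sigma> U \<phi> \<Longrightarrow> open U"
  by (simp add: local_param_def)

lemma local_param_Ck: "local_param \<Sigma> U \<phi> \<Longrightarrow> Ck_on k U \<phi>"
  by (simp add: local_param_def smooth_on_def)

lemma local_param_has_derivative:
  "local_param \<Sigma> U \<phi> \<Longrightarrow> x \<in> U \<Longrightarrow> (\<phi> has_derivative der \<phi> x) (at x)"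
  using local_param_Ck[of \<Sigma> U \<phi> "Suc 0"] Ck_on_has_derivative by blast

lemma local_param_linear:
  "local_param \<Sigma> U \<phi> \<Longrightarrow> x \<in> U \<Longrightarrow> linear (der \<phi> x)"
  using local_param_has_derivative has_derivative_linear by blast

lemma local_param_inj:
  "local_param \<Sigma> U \<phi> \<Longrightarrow> x \<in> U \<Longrightarrow> inj (der \<phi> x)"
  by (simp add: local_param_def)

lemma local_param_image_subset: "local_param \<Sigma> U \<phi> \<Longrightarrow> \<phi> ` U \<subseteq> \<Sigma>"
  by (auto simp: local_param_def dest: openin_imp_subset)

lemma local_param_mem: "local_param \<Sigma> U \<phi> \<Longrightarrow> x \<in> U \<Longrightarrow> \<phi> x \<in> \<Sigma>"
  using local_param_image_subset by blast

lemma local_param_continuous: "local_param \<Sigma> U \<phi> \<Longrightarrow> continuous_on U \<phi>"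
  using Ck_on_imp_continuous local_param_Ck by blast

lemma local_param_inverse:
  assumes "local_param \<Sigma> U \<phi>"
  obtains \<psi> where "continuous_on (\<phi> ` U) \<psi>" "\<And>x. x \<in> U \<Longrightarrow> \<psi> (\<phi> x) = x"
    "\<And>p. p \<in> \<phi> ` U \<Longrightarrow> \<psi> p \<in> U" "\<And>p. p \<in> \<phi> ` U \<Longrightarrow> \<phi> (\<psi> p) = p"
proof -
  obtain \<psi> where h: "homeomorphism U (\<phi> ` U) \<phi> \<psi>" using assms by (auto simp: local_param_def)
  show thesis
  proof (rule that[of \<psi>])
    show "\<psi> p \<in> U" if "p \<in> \<phi> ` U" for p using h that by (auto simp: homeomorphism_def)
  qed (use h in \<open>auto simp: homeomorphism_def\<close>)
qed

lemma local_param_inj_on: "local_param \<Sigma> U \<phi> \<Longrightarrow> inj_on \<phi> U"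
  by (metis inj_on_inverseI local_param_inverse)

lemma at_within_local_param:
  assumes "local_param \<Sigma> U \<phi>" "p \<in> \<phi> ` U"
  shows "at p within \<Sigma> = at p within (\<phi> ` U)"
proof -
  obtain W where "open W" "\<phi> ` U = \<Sigma> \<inter> W"
    using assms(1) by (auto simp: local_param_def openin_open)
  then show ?thesis using assms(2) by (intro at_within_nhd[of p W]) auto
qed

text \<open>The inverse chart lives on a set of half the ambient dimension; its differentiability
  there comes from its continuity and a left inverse of the derivative of the chart.\<close>

lemma local_param_inverse_has_derivative:
  assumes lp: "local_param \<Sigma> U \<phi>" and x: "x \<in> U"
    and \<psi>: "continuous_on (\<phi> ` U) \<psi>" "\<And>x. x \<in> U \<Longrightarrow> \<psi> (\<phi> x) = x"
  obtains g where "(\<psi> has_derivative g) (at (\<phi> x) within \<Sigma>)"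
    "\<And>h. g (der \<phi> x h) = h"
proof -
  obtain g where g: "linear g" "g \<circ> der \<phi> x = id"
    using linear_injective_left_inverse[OF local_param_linear[OF lp x] local_param_inj[OF lp x]] by blast
  have "(\<psi> has_derivative g) (at (\<phi> x) within \<phi> ` U)"
  proof (rule has_derivative_left_inverse_within[OF local_param_has_derivative[OF lp x]])
    show "bounded_linear g" using g(1) by (simp add: linear_conv_bounded_linear)
    show "g (der \<phi> x h) = h" for h using g(2) by (metis comp_apply id_apply)
    show "continuous (at (\<phi> x) within \<phi> ` U) \<psi>"
      using \<psi>(1) x by (auto simp: continuous_on_eq_continuous_within)
  qed (use \<psi>(2) x in auto)
  moreover have "at (\<phi> x) within \<Sigma> = at (\<phi> x) within \<phi> ` U"
    using at_within_local_param[OF lp] x by blast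
  ultimately show thesis using that g(2) by (metis comp_apply id_apply)
qed

lemma has_derivative_in_local_param:
  assumes lp: "local_param \<Sigma> U \<phi>" and x: "x \<in> U"
    and f: "(f has_derivative f') (at (\<phi> x) within \<Sigma>)"
  shows "((\<lambda>y. f (\<phi> y)) has_derivative (\<lambda>h. f' (der \<phi> x h))) (at x)"
proof -
  have "((\<lambda>y. f (\<phi> y)) has_derivative (\<lambda>h. f' (der \<phi> x h))) (at x within U)"
  proof (rule has_derivative_in_compose[where f = \<phi> and g = f])
    show "(\<phi> has_derivative der \<phi> x) (at x within U)"
      using local_param_has_derivative[OF lp x] has_derivative_at_withinI by blast
    show "(f has_derivative f') (at (\<phi> x) within \<phi> ` U)"
      using f local_param_image_subset[OF lp] has_derivative_subset by blast
  qed
  then show ?thesis using at_within_open[OF x local_param_open[OF lp]] by simp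
qed

text \<open>Composition with the inverse chart turns a derivative in the parameters into one within
  the submanifold. In directions that are not tangent its values depend on the left inverse that was
  chosen.\<close>

lemma has_derivative_from_local_param:
  assumes lp: "local_param \<Sigma> U \<phi>" and x: "x \<in> U"
    and f: "((\<lambda>y. f (\<phi> y)) has_derivative F') (at x)"
  obtains f' where "(f has_derivative f') (at (\<phi> x) within \<Sigma>)"
proof -
  obtain \<psi> where \<psi>: "continuous_on (\<phi> ` U) \<psi>" "\<And>x. x \<in> U \<Longrightarrow> \<psi> (\<phi> x) = x"
     "\<And>p. p \<in> \<phi> ` U \<Longrightarrow> \<phi> (\<psi> p) = p" using local_param_inverse[OF lp] by metis
  obtain g where g: "(\<psi> has_derivative g) (at (\<phi> x) within \<Sigma>)"
    using local_param_inverse_has_derivative[OF lp x \<psi>(1,2)] by blast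
  have eq: "at (\<phi> x) within \<Sigma> = at (\<phi> x) within \<phi> ` U"
    using at_within_local_param[OF lp] x by blast
  have "((\<lambda>p. f (\<phi> (\<psi> p))) has_derivative (\<lambda>h. F' (g h))) (at (\<phi> x) within \<phi> ` U)"
  proof (rule has_derivative_compose[where f = \<psi> and g = "\<lambda>y. f (\<phi> y)"])
    show "(\<psi> has_derivative g) (at (\<phi> x) within \<phi> ` U)" using g eq by simp
    show "((\<lambda>y. f (\<phi> y)) has_derivative F') (at (\<psi> (\<phi> x)))" using f \<psi>(2)[OF x] by simp
  qed
  then have "(f has_derivative (\<lambda>h. F' (g h))) (at (\<phi> x) within \<phi> ` U)"
    by (rule has_derivative_transform[rotated -1]) (use x \<psi>(3) in auto)
  then show thesis using that eq by simp
qed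

text \<open>Since the inverse chart is differentiable within the submanifold, transition maps are
  differentiable without any extension to ambient diffeomorphisms. The factorisation of the
  derivative is what makes tangent spaces and the area density independent of the chart.\<close>

lemma local_param_transition:
  assumes lp: "local_param \<Sigma> U \<phi>" and lp': "local_param \<Sigma> V \<rho>" and y: "y \<in> V" "\<rho> y \<in> \<phi> ` U"
    and \<psi>: "continuous_on (\<phi> ` U) \<psi>" "\<And>x. x \<in> U \<Longrightarrow> \<psi> (\<phi> x) = x"
  obtains t where "((\<lambda>z. \<psi> (\<rho> z)) has_derivative t) (at y)"
    "der \<rho> y = (\<lambda>h. der \<phi> (\<psi> (\<rho> y)) (t h))"
proof -
  obtain x where x: "x \<in> U" "\<rho> y = \<phi> x" using y by auto
  obtain g where g: "(\<psi> has_derivative g) (at (\<phi> x) within \<Sigma>)"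
    using local_param_inverse_has_derivative[OF lp x(1) \<psi>] by blast
  let ?t = "\<lambda>h. g (der \<rho> y h)"
  have t: "((\<lambda>z. \<psi> (\<rho> z)) has_derivative ?t) (at y)"
    using has_derivative_in_local_param[OF lp' y(1)] g x by simp
  obtain W where W: "open W" "\<phi> ` U = \<Sigma> \<inter> W"
    using lp by (auto simp: local_param_def openin_open)
  have "open (V \<inter> \<rho> -` W)"
    using continuous_open_preimage[OF local_param_continuous[OF lp'] local_param_open[OF lp'] W(1)] .
  moreover have "y \<in> V \<inter> \<rho> -` W" using y W by auto
  moreover have "\<phi> (\<psi> (\<rho> z)) = \<rho> z" if "z \<in> V \<inter> \<rho> -` W" for z
  proof -
    have "\<rho> z \<in> \<phi> ` U" using that W(2) local_param_mem[OF lp'] by blast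
    then show ?thesis using \<psi>(2) by auto
  qed
  moreover have "((\<lambda>z. \<phi> (\<psi> (\<rho> z))) has_derivative (\<lambda>h. der \<phi> x (?t h))) (at y)"
    using has_derivative_compose[OF t, of \<phi>] local_param_has_derivative[OF lp x(1)] x \<psi>(2) by simp
  ultimately have "(\<rho> has_derivative (\<lambda>h. der \<phi> x (?t h))) (at y)"
    using has_derivative_transform_within_open by blast
  then have "der \<rho> y = (\<lambda>h. der \<phi> x (?t h))"
    using has_derivative_unique local_param_has_derivative[OF lp' y(1)] by blast
  then show thesis using that[OF t] x \<psi>(2) by simp
qed

lemma tangent_space_local_param:
  assumes lp: "local_param \<Sigma> U \<phi>" and x: "x \<in> U"
  shows "tangent_space \<Sigma> (\<phi> x) = range (der \<phi> x)"
proof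
  show "range (der \<phi> x) \<subseteq> tangent_space \<Sigma> (\<phi> x)"
    using lp x unfolding tangent_space_def by blast
  obtain \<psi> where \<psi>: "continuous_on (\<phi> ` U) \<psi>" "\<And>x. x \<in> U \<Longrightarrow> \<psi> (\<phi> x) = x"
    using local_param_inverse[OF lp] by metis
  show "tangent_space \<Sigma> (\<phi> x) \<subseteq> range (der \<phi> x)"
  proof
    fix v assume "v \<in> tangent_space \<Sigma> (\<phi> x)"
    then obtain V \<rho> y h where lp': "local_param \<Sigma> V \<rho>" "y \<in> V" "\<rho> y = \<phi> x"
      and v: "v = der \<rho> y h"
      unfolding tangent_space_def by blast
    have "\<rho> y \<in> \<phi> ` U" using lp'(3) x by simp
    note tr = local_param_transition[OF lp lp'(1,2) this \<psi>]
    obtain t where "((\<lambda>z. \<psi> (\<rho> z)) has_derivative t) (at y)"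
      and t: "der \<rho> y = (\<lambda>h. der \<phi> (\<psi> (\<rho> y)) (t h))"
      using tr .
    show "v \<in> range (der \<phi> x)" using v t lp'(3) \<psi>(2)[OF x] by simp
  qed
qed

lemma submanifold_local_param:
  assumes "submanifold \<Sigma>" "p \<in> \<Sigma>"
  obtains U \<phi> x where "local_param \<Sigma> U \<phi>" "x \<in> U" "p = \<phi> x"
    "tangent_space \<Sigma> p = range (der \<phi> x)"
proof -
  obtain U \<phi> where lp: "local_param \<Sigma> U \<phi>" "p \<in> \<phi> ` U"
    using assms unfolding submanifold_def by blast
  then obtain x where x: "x \<in> U" "p = \<phi> x" by blast
  show thesis
    using that[OF lp(1) x] tangent_space_local_param[OF lp(1) x(1)] x(2) by simp
qed

lemma subspace_tangent_space:
  assumes "submanifold \<Sigma>" "p \<in> \<Sigma>"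
  shows "subspace (tangent_space \<Sigma> p)"
proof -
  obtain U \<phi> x where *: "local_param \<Sigma> U \<phi>" "x \<in> U"
    "tangent_space \<Sigma> p = range (der \<phi> x)" using submanifold_local_param[OF assms] .
  then show ?thesis
    using linear_subspace_image[OF local_param_linear[OF *(1,2)] subspace_UNIV] by simp
qed

lemma dim_tangent_space:
  fixes \<Sigma> :: "(complex^'n::finite) set"
  assumes "submanifold \<Sigma>" "p \<in> \<Sigma>"
  shows "dim (tangent_space \<Sigma> p) = CARD('n)"
proof -
  obtain U \<phi> x where *: "local_param \<Sigma> U \<phi>" "x \<in> U" 
    "tangent_space \<Sigma> p = range (der \<phi> x)" using submanifold_local_param[OF assms] .
  then show ?thesis
    using dim_image_eq[of "der \<phi> x" UNIV] local_param_linear[OF *(1,2)]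
      local_param_inj[OF *(1,2)] by simp
qed

text \<open>Pulling back by a chart determines a derivative within the submanifold on tangent
  vectors. This is the device for differentiating identities that hold on the submanifold
  only.\<close>

lemma tangent_derivative_unique:
  assumes "submanifold \<Sigma>" "p \<in> \<Sigma>" "v \<in> tangent_space \<Sigma> p"
    and f: "(f has_derivative f') (at p within \<Sigma>)" and g: "(g has_derivative g') (at p within \<Sigma>)"
    and eq: "\<And>q. q \<in> \<Sigma> \<Longrightarrow> f q = g q"
  shows "f' v = g' v"
proof -
  obtain U \<phi> x where lp: "local_param \<Sigma> U \<phi>" "x \<in> U" "p = \<phi> x"
    and ts: "tangent_space \<Sigma> p = range (der \<phi> x)"
    using submanifold_local_param[OF assms(1,2)] .
  obtain h where h: "v = der \<phi> x h" using assms(3) ts by blast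
  have "((\<lambda>y. f (\<phi> y)) has_derivative (\<lambda>h. f' (der \<phi> x h))) (at x)"
    using has_derivative_in_local_param[OF lp(1,2)] f lp(3) by simp
  then have "((\<lambda>y. g (\<phi> y)) has_derivative (\<lambda>h. f' (der \<phi> x h))) (at x)"
    by (rule has_derivative_transform_within_open[OF _ local_param_open[OF lp(1)] lp(2)])
       (use eq local_param_mem[OF lp(1)] in auto)
  moreover have "((\<lambda>y. g (\<phi> y)) has_derivative (\<lambda>h. g' (der \<phi> x h))) (at x)"
    using has_derivative_in_local_param[OF lp(1,2)] g lp(3) by simp
  ultimately have "(\<lambda>h. f' (der \<phi> x h)) = (\<lambda>h. g' (der \<phi> x h))"
    by (rule has_derivative_unique)
  then show ?thesis using h by meson
qed

lemma dir_deriv_eq: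
  assumes "submanifold \<Sigma>" "p \<in> \<Sigma>" "v \<in> tangent_space \<Sigma> p"
    and f: "(f has_derivative f') (at p within \<Sigma>)"
  shows "dir_deriv \<Sigma> f p v = f' v"
proof -
  have "(f has_derivative frechet_derivative f (at p within \<Sigma>)) (at p within \<Sigma>)"
    using f frechet_derivative_works differentiable_def by blast
  then show ?thesis
    unfolding dir_deriv_def using tangent_derivative_unique[OF assms(1-3) _ f] by blast
qed

section \<open>The orthogonal projection onto the tangent spaces\<close>

lemma tangent_part_eq:
  assumes "submanifold \<Sigma>" "p \<in> \<Sigma>" and u: "u \<in> tangent_space \<Sigma> p" "w - u \<in> normal_space \<Sigma> p"
  shows "tangent_part \<Sigma> p w = u"
  unfolding tangent_part_def
proof (rule the_equality)
  fix u' assume u': "u' \<in> tangent_space \<Sigma> p \<and> w - u' \<in> normal_space \<Sigma> p"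
  have s: "subspace (tangent_space \<Sigma> p)" by (rule subspace_tangent_space[OF assms(1,2)])
  have "u - u' \<in> tangent_space \<Sigma> p" using u u' s subspace_diff by blast
  moreover have "u - u' \<in> normal_space \<Sigma> p"
    using subspace_diff[OF subspace_orthogonal_comp, of "w - u'" "tangent_space \<Sigma> p" "w - u"] u u' by simp
  ultimately have "orthogonal (u - u') (u - u')" by (simp add: orthogonal_comp_def)
  then show "u' = u" by (simp add: orthogonal_def)
qed (use u in simp)

lemma tangent_part_local_param:
  assumes lp: "local_param \<Sigma> U \<phi>" and x: "x \<in> U" and "submanifold \<Sigma>"
  shows "tangent_part \<Sigma> (\<phi> x) a
    = der \<phi> x (coords (der \<phi> x) a)"
  using tangent_space_local_param[OF lp x]
    coords_orthogonal[OF local_param_linear[OF lp x] local_param_inj[OF lp x]]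
  by (intro tangent_part_eq assms local_param_mem[OF lp x])
     (auto simp: orthogonal_comp_def orthogonal_def)

lemma tangent_part_in:
  assumes "submanifold \<Sigma>" "p \<in> \<Sigma>"
  shows "tangent_part \<Sigma> p w \<in> tangent_space \<Sigma> p"
    and "w - tangent_part \<Sigma> p w \<in> normal_space \<Sigma> p"
proof -
  obtain U \<phi> x where lp: "local_param \<Sigma> U \<phi>" "x \<in> U" "p = \<phi> x" 
    "tangent_space \<Sigma> p = range (der \<phi> x)" using submanifold_local_param[OF assms] .
  show "tangent_part \<Sigma> p w \<in> tangent_space \<Sigma> p"
    using tangent_part_local_param[OF lp(1,2) assms(1)] lp(3,4) by simp
  show "w - tangent_part \<Sigma> p w \<in> normal_space \<Sigma> p"
    using tangent_part_local_param[OF lp(1,2) assms(1)] lp(3,4)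
      coords_orthogonal[OF local_param_linear[OF lp(1,2)] local_param_inj[OF lp(1,2)]]
    by (auto simp: orthogonal_comp_def orthogonal_def)
qed

text \<open>As an operator-valued function the projection can be differentiated as a whole, so that
  identities such as P P = P yield identities for its derivative.\<close>

definition tproj :: "(complex^'n::finite) set \<Rightarrow> complex^'n \<Rightarrow> (complex^'n) \<Rightarrow>\<^sub>L (complex^'n)" where
  "tproj \<Sigma> p = Blinfun (tangent_part \<Sigma> p)"

lemma tproj_apply:
  assumes "submanifold \<Sigma>" "p \<in> \<Sigma>"
  shows "tproj \<Sigma> p a = tangent_part \<Sigma> p a"
proof -
  have "linear (tangent_part \<Sigma> p)"
  proof (rule linearI)
    show "tangent_part \<Sigma> p (a + b) = tangent_part \<Sigma> p a + tangent_part \<Sigma> p b" for a b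
    proof (rule tangent_part_eq[OF assms])
      show "a + b - (tangent_part \<Sigma> p a + tangent_part \<Sigma> p b) \<in> normal_space \<Sigma> p"
        using subspace_add[OF subspace_orthogonal_comp tangent_part_in(2)[OF assms, of a] tangent_part_in(2)[OF assms, of b]]
        by (simp add: algebra_simps)
    qed (intro subspace_add subspace_tangent_space tangent_part_in assms)
    show "tangent_part \<Sigma> p (r *\<^sub>R a) = r *\<^sub>R tangent_part \<Sigma> p a" for r a
    proof (rule tangent_part_eq[OF assms])
      show "r *\<^sub>R a - r *\<^sub>R tangent_part \<Sigma> p a \<in> normal_space \<Sigma> p"
        using subspace_scale[OF subspace_orthogonal_comp tangent_part_in(2)[OF assms, of a], of r]
        by (simp add: algebra_simps)
    qed (intro subspace_scale subspace_tangent_space tangent_part_in assms)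
  qed
  then show ?thesis unfolding tproj_def by (simp add: bounded_linear_Blinfun_apply linear_conv_bounded_linear)
qed

lemma
  assumes "submanifold \<Sigma>" "p \<in> \<Sigma>"
  shows tproj_in: "tproj \<Sigma> p a \<in> tangent_space \<Sigma> p"
    and tproj_diff_normal: "a - tproj \<Sigma> p a \<in> normal_space \<Sigma> p"
    and tproj_tangent: "a \<in> tangent_space \<Sigma> p \<Longrightarrow> tproj \<Sigma> p a = a"
    and tproj_idem: "tproj \<Sigma> p (tproj \<Sigma> p a) = tproj \<Sigma> p a"
    and tproj_sym: "tproj \<Sigma> p a \<bullet> b = a \<bullet> tproj \<Sigma> p b"
proof -
  note ta = tproj_apply[OF assms]
  show 1: "tproj \<Sigma> p a \<in> tangent_space \<Sigma> p" for a using tangent_part_in[OF assms] ta by simp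
  show 2: "a - tproj \<Sigma> p a \<in> normal_space \<Sigma> p" for a using tangent_part_in[OF assms] ta by simp
  show 3: "a \<in> tangent_space \<Sigma> p \<Longrightarrow> tproj \<Sigma> p a = a" for a
    using tangent_part_eq[OF assms, of a a] ta by (simp add: subspace_0 subspace_orthogonal_comp)
  show "tproj \<Sigma> p (tproj \<Sigma> p a) = tproj \<Sigma> p a" using 1 3 by blast
  have "tproj \<Sigma> p a \<bullet> (b - tproj \<Sigma> p b) = 0" for a b
    using 1[of a] 2[of b] by (simp add: orthogonal_comp_def orthogonal_def)
  from this[of a b] this[of b a] show "tproj \<Sigma> p a \<bullet> b = a \<bullet> tproj \<Sigma> p b"
    by (simp add: inner_diff_right inner_commute)
qed

text \<open>Finite orders are tracked because the cut-off functions of the divergence theorem are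
  only of class C^1.\<close>

definition Ck_on_submanifold ::
    "nat \<Rightarrow> (complex^'n::finite) set \<Rightarrow> (complex^'n \<Rightarrow> 'b::real_normed_vector) \<Rightarrow> bool" where
  "Ck_on_submanifold k \<Sigma> f \<longleftrightarrow> (\<forall>U \<phi>. local_param \<Sigma> U \<phi> \<longrightarrow> Ck_on k U (\<lambda>x. f (\<phi> x)))"

lemma smooth_on_submanifold_iff: "smooth_on_submanifold \<Sigma> f \<longleftrightarrow> (\<forall>k. Ck_on_submanifold k \<Sigma> f)"
  by (auto simp: smooth_on_submanifold_def Ck_on_submanifold_def smooth_on_def o_def)

lemma Ck_on_coords:
  assumes lp: "local_param \<Sigma> U \<phi>" and a: "Ck_on k U a"
  shows "Ck_on k U (\<lambda>x. coords (der \<phi> x) (a x) $ i)"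
proof -
  note o = local_param_open[OF lp]
  have D: "Ck_on k U (\<lambda>x. der \<phi> x v)" for v
    using local_param_Ck[OF lp, of "Suc k"] by simp
  have G: "Ck_on k U (\<lambda>x. gram (der \<phi> x) $ i $ j)" for i j
    unfolding gram_def by (simp, intro Ck_on_inner o D)
  have "Ck_on k U (\<lambda>x. det (\<chi> l j. if j = i then der \<phi> x (axis l 1) \<bullet> a x
      else gram (der \<phi> x) $ l $ j) * inverse (det (gram (der \<phi> x))))"
  proof (intro Ck_on_mult Ck_on_inverse Ck_on_det o G)
    show "Ck_on k U (\<lambda>x. (\<chi> l j. if j = i then der \<phi> x (axis l 1) \<bullet> a x
      else gram (der \<phi> x) $ l $ j) $ l $ j)" for l j
      by (cases "j = i") (auto intro!: Ck_on_inner Ck_on_const o D G a)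
    show "det (gram (der \<phi> x)) \<noteq> 0" if "x \<in> U" for x
      using det_gram_pos[OF local_param_linear local_param_inj] lp that by fastforce
  qed
  then show ?thesis by (simp add: coords_def field_class.field_divide_inverse)
qed

lemma Ck_on_submanifold_tproj_apply:
  assumes "submanifold \<Sigma>"
  shows "Ck_on_submanifold k \<Sigma> (\<lambda>q. tangent_part \<Sigma> q a)"
  unfolding Ck_on_submanifold_def
proof (intro allI impI)
  fix U \<phi> assume lp: "local_param \<Sigma> U \<phi>"
  note o = local_param_open[OF lp]
  have D: "Ck_on k U (\<lambda>x. der \<phi> x v)" for v
    using local_param_Ck[OF lp, of "Suc k"] by simp
  have "Ck_on k U (\<lambda>x. \<Sum>i\<in>UNIV. coords (der \<phi> x) a $ i *\<^sub>R
      der \<phi> x (axis i 1))"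
    by (intro Ck_on_sum Ck_on_scaleR Ck_on_coords[OF lp Ck_on_const] D o)
  then show "Ck_on k U (\<lambda>x. tangent_part \<Sigma> (\<phi> x) a)"
    by (rule Ck_on_cong[OF o, rotated])
       (simp add: tangent_part_local_param[OF lp _ assms] linear_eq_sum_axis[OF local_param_linear[OF lp], symmetric])
qed

lemma Ck_on_submanifold_tproj:
  assumes "submanifold \<Sigma>"
  shows "Ck_on_submanifold k \<Sigma> (tproj \<Sigma>)"
  unfolding Ck_on_submanifold_def
proof (intro allI impI Ck_on_blinfun)
  fix U \<phi> a assume lp: "local_param \<Sigma> U \<phi>"
  show "open U" by (rule local_param_open[OF lp])
  have "Ck_on k U (\<lambda>x. tangent_part \<Sigma> (\<phi> x) a)"
    using Ck_on_submanifold_tproj_apply[OF assms] lp by (auto simp: Ck_on_submanifold_def)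
  then show "Ck_on k U (\<lambda>x. tproj \<Sigma> (\<phi> x) a)"
    by (rule Ck_on_cong[OF local_param_open[OF lp], rotated])
       (simp add: tproj_apply[OF assms] local_param_mem[OF lp])
qed

lemma Ck_on_submanifold_has_derivative:
  assumes "submanifold \<Sigma>" "p \<in> \<Sigma>" "Ck_on_submanifold (Suc k) \<Sigma> f"
  shows "(f has_derivative frechet_derivative f (at p within \<Sigma>)) (at p within \<Sigma>)"
proof -
  obtain U \<phi> x where lp: "local_param \<Sigma> U \<phi>" "x \<in> U" "p = \<phi> x" using submanifold_local_param[OF assms(1,2)] .
  then have "((\<lambda>y. f (\<phi> y)) has_derivative der (\<lambda>y. f (\<phi> y)) x) (at x)"
    using assms(3) Ck_on_has_derivative unfolding Ck_on_submanifold_def by blast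
  from has_derivative_from_local_param[where f = f, OF lp(1,2) this] obtain f'
    where "(f has_derivative f') (at (\<phi> x) within \<Sigma>)" .
  then have "f differentiable (at p within \<Sigma>)" using lp(3) by (auto simp: differentiable_def)
  then show ?thesis by (simp add: frechet_derivative_works)
qed

lemma Ck_on_submanifoldD: "Ck_on_submanifold k \<Sigma> f \<Longrightarrow> local_param \<Sigma> U \<phi> \<Longrightarrow> Ck_on k U (\<lambda>x. f (\<phi> x))"
  by (simp add: Ck_on_submanifold_def)

lemma Ck_on_submanifoldI:
  "(\<And>U \<phi>. local_param \<Sigma> U \<phi> \<Longrightarrow> Ck_on k U (\<lambda>x. f (\<phi> x))) \<Longrightarrow> Ck_on_submanifold k \<Sigma> f"
  by (simp add: Ck_on_submanifold_def)

lemma Ck_on_submanifold_bilinear: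
  assumes "bounded_bilinear h" "Ck_on_submanifold k \<Sigma> f" "Ck_on_submanifold k \<Sigma> g"
  shows "Ck_on_submanifold k \<Sigma> (\<lambda>x. h (f x) (g x))"
proof (rule Ck_on_submanifoldI)
  fix U \<phi> assume lp: "local_param \<Sigma> U \<phi>"
  show "Ck_on k U (\<lambda>x. h (f (\<phi> x)) (g (\<phi> x)))"
    by (rule Ck_on_bilinear[OF local_param_open[OF lp] assms(1) assms(2,3)[THEN Ck_on_submanifoldD, OF lp]])
qed

lemma Ck_on_submanifold_linear:
  assumes "bounded_linear h" "Ck_on_submanifold k \<Sigma> f"
  shows "Ck_on_submanifold k \<Sigma> (\<lambda>x. h (f x))"
proof (rule Ck_on_submanifoldI)
  fix U \<phi> assume lp: "local_param \<Sigma> U \<phi>"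
  show "Ck_on k U (\<lambda>x. h (f (\<phi> x)))"
    by (rule Ck_on_linear[OF local_param_open[OF lp] assms(1) Ck_on_submanifoldD[OF assms(2) lp]])
qed

lemma Ck_on_submanifold_add:
  assumes "Ck_on_submanifold k \<Sigma> f" "Ck_on_submanifold k \<Sigma> g"
  shows "Ck_on_submanifold k \<Sigma> (\<lambda>x. f x + g x)"
proof (rule Ck_on_submanifoldI)
  fix U \<phi> assume lp: "local_param \<Sigma> U \<phi>"
  show "Ck_on k U (\<lambda>x. f (\<phi> x) + g (\<phi> x))"
    by (rule Ck_on_add[OF local_param_open[OF lp] assms[THEN Ck_on_submanifoldD, OF lp]])
qed

text \<open>\<open>dir_deriv\<close> is meaningful in tangent directions only. Composition with the
  projection gives an operator on the ambient space; for a tangent vector field its trace over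
  \<open>Basis\<close> is the divergence.\<close>

definition tderiv :: "(complex^'n::finite) set \<Rightarrow> (complex^'n \<Rightarrow> 'b::euclidean_space) \<Rightarrow>
    complex^'n \<Rightarrow> (complex^'n) \<Rightarrow>\<^sub>L 'b" where
  "tderiv \<Sigma> f p = Blinfun (\<lambda>a. dir_deriv \<Sigma> f p (tproj \<Sigma> p a))"

lemma tderiv_apply:
  assumes "submanifold \<Sigma>" "p \<in> \<Sigma>" "(f has_derivative f') (at p within \<Sigma>)"
  shows "tderiv \<Sigma> f p a = f' (tproj \<Sigma> p a)"
proof -
  have "dir_deriv \<Sigma> f p (tproj \<Sigma> p a) = f' (tproj \<Sigma> p a)" for a
    by (intro dir_deriv_eq assms tproj_in)
  moreover have "bounded_linear (\<lambda>a. f' (tproj \<Sigma> p a))"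
    by (intro bounded_linear_compose[OF has_derivative_bounded_linear[OF assms(3)]]) (rule blinfun.bounded_linear_right)
  ultimately show ?thesis by (simp add: tderiv_def bounded_linear_Blinfun_apply)
qed

lemma tderiv_local_param:
  assumes "submanifold \<Sigma>" and lp: "local_param \<Sigma> U \<phi>" and x: "x \<in> U"
    and f: "((\<lambda>y. f (\<phi> y)) has_derivative F') (at x)"
  shows "tderiv \<Sigma> f (\<phi> x) a = F' (coords (der \<phi> x) a)"
proof -
  obtain f' where f': "(f has_derivative f') (at (\<phi> x) within \<Sigma>)"
    using has_derivative_from_local_param[OF lp x f] .
  have "F' h = f' (der \<phi> x h)" for h
    using has_derivative_unique[OF f has_derivative_in_local_param[OF lp x f']] by meson
  then show ?thesis
    using tderiv_apply[OF assms(1) local_param_mem[OF lp x] f'] tproj_apply[OF assms(1) local_param_mem[OF lp x]]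
      tangent_part_local_param[OF lp x assms(1)] by simp
qed

lemma Ck_on_submanifold_tderiv:
  assumes "submanifold \<Sigma>" and f: "Ck_on_submanifold (Suc k) \<Sigma> f"
  shows "Ck_on_submanifold k \<Sigma> (tderiv \<Sigma> f)"
  unfolding Ck_on_submanifold_def
proof (intro allI impI Ck_on_blinfun)
  fix U \<phi> a assume lp: "local_param \<Sigma> U \<phi>"
  show o: "open U" by (rule local_param_open[OF lp])
  let ?f = "\<lambda>y. f (\<phi> y)"
  have f': "Ck_on (Suc k) U ?f" using f lp by (auto simp: Ck_on_submanifold_def)
  have C: "Ck_on k U (\<lambda>x. \<Sum>i\<in>UNIV. coords (der \<phi> x) a $ i *\<^sub>R der ?f x (axis i 1))"
    using f'[unfolded Ck_on.simps] by (intro Ck_on_sum Ck_on_scaleR Ck_on_coords[OF lp Ck_on_const] o) blast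
  show "Ck_on k U (\<lambda>x. tderiv \<Sigma> f (\<phi> x) a)"
  proof (rule Ck_on_cong[OF o _ C])
    fix x assume x: "x \<in> U"
    note d = Ck_on_has_derivative[OF f' x]
    show "(\<Sum>i\<in>UNIV. coords (der \<phi> x) a $ i *\<^sub>R der ?f x (axis i 1))
      = tderiv \<Sigma> f (\<phi> x) a"
      unfolding tderiv_local_param[where f = f, OF assms(1) lp x d, of a]
      by (rule linear_eq_sum_axis[OF has_derivative_linear[OF d], symmetric])
  qed
qed

section \<open>Lagrangian submanifolds and the second fundamental form\<close>

lemma Ck_on_exp:
  fixes f :: "'a::euclidean_space \<Rightarrow> real"
  assumes "open U" "Ck_on k U f"
  shows "Ck_on k U (\<lambda>x. exp (f x))"
  using assms(2)
proof (induction k)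
  case 0
  then show ?case by (simp add: continuous_on_exp)
next
  case (Suc k)
  have k: "Ck_on k U (\<lambda>x. exp (f x))" using Suc Ck_on_Suc_imp by blast
  show ?case
  proof (rule Ck_onI[OF assms(1)])
    show "((\<lambda>x. exp (f x)) has_derivative (\<lambda>v. exp (f x) * der f x v)) (at x)" if "x \<in> U" for x
      using has_derivative_exp[OF Ck_on_has_derivative[OF Suc.prems that]] by (simp add: mult.commute)
  next
    show "Ck_on k U (\<lambda>x. exp (f x) * der f x v)" for v
      using Suc.prems by (intro Ck_on_mult[OF assms(1) k]) simp
  qed
qed

section \<open>The complex structure\<close>

lemma linear_cplx_J: "linear cplx_J"
  by (rule linearI) (auto simp: cplx_J_def vec_eq_iff algebra_simps)

lemma bounded_linear_cplx_J: "bounded_linear cplx_J"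
  using linear_cplx_J by (simp add: linear_conv_bounded_linear)

lemma cplx_J_J [simp]: "cplx_J (cplx_J v) = - v"
  by (simp add: cplx_J_def vec_eq_iff)

lemma cplx_J_inner_cplx_J [simp]: "cplx_J x \<bullet> cplx_J y = x \<bullet> y"
  using kahler_form_cplx_J[of x y] by (simp add: kahler_form_def)

lemmas cplx_J_simps = linear_add[OF linear_cplx_J] linear_diff[OF linear_cplx_J] linear_0[OF linear_cplx_J]
  linear_neg[OF linear_cplx_J]

lemma trace_commute:
  fixes A B :: "'a::euclidean_space \<Rightarrow> 'a"
  assumes "linear A" "linear B"
  shows "(\<Sum>b\<in>Basis. A (B b) \<bullet> b) = (\<Sum>b\<in>Basis. B (A b) \<bullet> b)"
proof -
  have expand: "F (G b) \<bullet> b = (\<Sum>c\<in>Basis. (G b \<bullet> c) * (F c \<bullet> b))" if "linear F" for F G :: "'a \<Rightarrow> 'a" and b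
  proof -
    have "F (G b) = F (\<Sum>c\<in>Basis. (G b \<bullet> c) *\<^sub>R c)" by (simp add: euclidean_representation)
    also have "\<dots> = (\<Sum>c\<in>Basis. (G b \<bullet> c) *\<^sub>R F c)" using that by (simp add: linear_sum linear_cmul)
    finally show ?thesis by (simp add: inner_sum_left)
  qed
  have "(\<Sum>b\<in>Basis. A (B b) \<bullet> b) = (\<Sum>b\<in>Basis. \<Sum>c\<in>Basis. (B b \<bullet> c) * (A c \<bullet> b))"
    by (simp add: expand[OF assms(1)])
  also have "\<dots> = (\<Sum>c\<in>Basis. \<Sum>b\<in>Basis. (B b \<bullet> c) * (A c \<bullet> b))" by (rule sum.swap)
  also have "\<dots> = (\<Sum>c\<in>Basis. B (A c) \<bullet> c)"
    by (simp add: expand[OF assms(2)] mult.commute)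
  finally show ?thesis .
qed

section \<open>Orthonormal tangent bases and traces\<close>

lemma tangent_onb:
  assumes "submanifold \<Sigma>" "p \<in> \<Sigma>"
  shows "pairwise orthogonal (tangent_onb \<Sigma> p)" "\<forall>e\<in>tangent_onb \<Sigma> p. norm e = 1"
    "span (tangent_onb \<Sigma> p) = tangent_space \<Sigma> p"
proof -
  obtain B where "pairwise orthogonal B" "\<And>x. x \<in> B \<Longrightarrow> norm x = 1" "span B = tangent_space \<Sigma> p"
    using orthonormal_basis_subspace[OF subspace_tangent_space[OF assms]] by metis
  then have "\<exists>B. pairwise orthogonal B \<and> (\<forall>e\<in>B. norm e = 1) \<and> span B = tangent_space \<Sigma> p" by blast
  from someI_ex[OF this]
  show "pairwise orthogonal (tangent_onb \<Sigma> p)" "\<forall>e\<in>tangent_onb \<Sigma> p. norm e = 1"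
    "span (tangent_onb \<Sigma> p) = tangent_space \<Sigma> p"
    unfolding tangent_onb_def by blast+
qed

lemma tangent_onb_in: "submanifold \<Sigma> \<Longrightarrow> p \<in> \<Sigma> \<Longrightarrow> e \<in> tangent_onb \<Sigma> p \<Longrightarrow> e \<in> tangent_space \<Sigma> p"
  using tangent_onb(3) span_base by blast

lemma finite_tangent_onb:
  assumes "submanifold \<Sigma>" "p \<in> \<Sigma>"
  shows "finite (tangent_onb \<Sigma> p)"
proof -
  have "0 \<notin> tangent_onb \<Sigma> p" using tangent_onb(2)[OF assms] by auto
  then show ?thesis
    using pairwise_orthogonal_independent[OF tangent_onb(1)[OF assms]] independent_imp_finite by blast
qed

lemma tangent_onb_inner:
  assumes "submanifold \<Sigma>" "p \<in> \<Sigma>" "e \<in> tangent_onb \<Sigma> p" "e' \<in> tangent_onb \<Sigma> p"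
  shows "e \<bullet> e' = (if e = e' then 1 else 0)"
  using tangent_onb(1,2)[OF assms(1,2)] assms(3,4)
  by (auto simp: pairwise_def orthogonal_def norm_eq_1)

lemma tangent_onb_expand:
  assumes "submanifold \<Sigma>" "p \<in> \<Sigma>"
  shows "tproj \<Sigma> p v = (\<Sum>e\<in>tangent_onb \<Sigma> p. (v \<bullet> e) *\<^sub>R e)"
proof -
  let ?B = "tangent_onb \<Sigma> p" and ?u = "\<Sum>e\<in>tangent_onb \<Sigma> p. (v \<bullet> e) *\<^sub>R e"
  note fin = finite_tangent_onb[OF assms]
  have 1: "?u \<in> tangent_space \<Sigma> p"
    by (intro subspace_sum subspace_scale subspace_tangent_space assms tangent_onb_in)
  have "?u \<bullet> e = v \<bullet> e" if "e \<in> ?B" for e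
  proof -
    have "?u \<bullet> e = (\<Sum>e'\<in>?B. if e' = e then v \<bullet> e' else 0)"
      unfolding inner_sum_left using that
      by (intro sum.cong) (auto simp: tangent_onb_inner[OF assms])
    then show ?thesis using fin that by simp
  qed
  then have "orthogonal (v - ?u) e" if "e \<in> ?B" for e
    using that by (simp add: orthogonal_def inner_diff_left)
  then have "orthogonal (v - ?u) y" if "y \<in> span ?B" for y
    using that orthogonal_to_span by blast
  then have "v - ?u \<in> normal_space \<Sigma> p"
    unfolding orthogonal_comp_def tangent_onb(3)[OF assms] by (simp add: orthogonal_commute)
  then show ?thesis using tangent_part_eq[OF assms 1] tproj_apply[OF assms] by simp
qed

text \<open>Links the traces over the ambient basis, which are convenient to differentiate, with the
  traces over \<open>tangent_onb\<close> in the definitions of H and L.\<close>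

lemma trace_tangent_onb:
  assumes "submanifold \<Sigma>" "p \<in> \<Sigma>" and K: "linear K"
  shows "(\<Sum>b\<in>Basis. K (tproj \<Sigma> p b) \<bullet> b) = (\<Sum>e\<in>tangent_onb \<Sigma> p. K e \<bullet> e)"
proof -
  have "(\<Sum>b\<in>Basis. K (tproj \<Sigma> p b) \<bullet> b)
      = (\<Sum>b\<in>Basis. \<Sum>e\<in>tangent_onb \<Sigma> p. (b \<bullet> e) * (K e \<bullet> b))"
    by (simp add: tangent_onb_expand[OF assms(1,2)] linear_sum[OF K] linear_cmul[OF K] inner_sum_left)
  also have "\<dots> = (\<Sum>e\<in>tangent_onb \<Sigma> p. \<Sum>b\<in>Basis. (b \<bullet> e) * (K e \<bullet> b))" by (rule sum.swap)
  also have "\<dots> = (\<Sum>e\<in>tangent_onb \<Sigma> p. K e \<bullet> e)"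
    by (intro sum.cong refl) (subst (2) euclidean_inner, simp add: mult.commute inner_commute)
  finally show ?thesis .
qed

lemma tangent_onb_Parseval:
  assumes "submanifold \<Sigma>" "p \<in> \<Sigma>" "z \<in> tangent_space \<Sigma> p"
  shows "(\<Sum>e\<in>tangent_onb \<Sigma> p. (e \<bullet> z)\<^sup>2) = z \<bullet> z"
proof -
  have "z \<bullet> z = (\<Sum>e\<in>tangent_onb \<Sigma> p. (z \<bullet> e) *\<^sub>R e) \<bullet> z"
    using tangent_onb_expand[OF assms(1,2), of z] tproj_tangent[OF assms] by simp
  also have "\<dots> = (\<Sum>e\<in>tangent_onb \<Sigma> p. (z \<bullet> e) * (e \<bullet> z))"
    by (simp only: inner_sum_left inner_scaleR_left)
  finally show ?thesis by (simp add: power2_eq_square inner_commute)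
qed

section \<open>Lagrangian tangent spaces and the derivative of the projection\<close>

lemma lagrangian_submanifold: "lagrangian \<Sigma> \<Longrightarrow> submanifold \<Sigma>"
  by (simp add: lagrangian_def)

text \<open>The vanishing of the Kaehler form puts J of the tangent space into the normal space.
  Both have dimension n, because the real ambient dimension is 2n.\<close>

lemma lagrangian_J_normal:
  assumes "lagrangian \<Sigma>" "p \<in> \<Sigma>"
  shows "normal_space \<Sigma> p = cplx_J ` tangent_space \<Sigma> p"
proof -
  note sm = lagrangian_submanifold[OF assms(1)]
  let ?T = "tangent_space \<Sigma> p"
  have s: "subspace ?T" using subspace_tangent_space[OF sm assms(2)] .
  have inj: "inj cplx_J" by (rule injI) (metis cplx_J_J add.inverse_inverse)
  have sub: "cplx_J ` ?T \<subseteq> normal_space \<Sigma> p"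
  proof
    fix v assume "v \<in> cplx_J ` ?T"
    then obtain u where u: "u \<in> ?T" "v = cplx_J u" by blast
    have "y \<bullet> v = 0" if "y \<in> ?T" for y
      using assms that u unfolding lagrangian_def kahler_form_def by (metis inner_commute)
    then show "v \<in> normal_space \<Sigma> p" by (simp add: orthogonal_comp_def orthogonal_def)
  qed
  have "dim ?T + dim (normal_space \<Sigma> p) = dim (UNIV :: (complex^'a) set)"
    using dim_subspace_orthogonal_to_vectors[OF s subspace_UNIV subset_UNIV]
    by (simp add: orthogonal_comp_def orthogonal_def add.commute)
  then have "dim (normal_space \<Sigma> p) = CARD('a)"
    using dim_tangent_space[OF sm assms(2)] by simp
  moreover have "dim (cplx_J ` ?T) = CARD('a)"
    using dim_image_eq[OF linear_cplx_J, of ?T] inj dim_tangent_space[OF sm assms(2)]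
    by (metis inj_on_subset subset_UNIV)
  ultimately show ?thesis
    using subspace_dim_equal[OF linear_subspace_image[OF linear_cplx_J s] subspace_orthogonal_comp sub] by simp
qed

lemma lagrangian_tproj_J:
  assumes "lagrangian \<Sigma>" "p \<in> \<Sigma>"
  shows "tproj \<Sigma> p (cplx_J v) = cplx_J (v - tproj \<Sigma> p v)"
proof -
  note sm = lagrangian_submanifold[OF assms(1)]
  have "v - tproj \<Sigma> p v \<in> cplx_J ` tangent_space \<Sigma> p"
    using tproj_diff_normal[OF sm assms(2)] lagrangian_J_normal[OF assms] by blast
  then obtain z where z: "z \<in> tangent_space \<Sigma> p" "v - tproj \<Sigma> p v = cplx_J z" by blast
  have 1: "cplx_J (v - tproj \<Sigma> p v) \<in> tangent_space \<Sigma> p"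
    using z subspace_neg[OF subspace_tangent_space[OF sm assms(2)] z(1)] by simp
  have "cplx_J v - cplx_J (v - tproj \<Sigma> p v) = cplx_J (tproj \<Sigma> p v)" by (simp add: cplx_J_simps)
  then have "cplx_J v - cplx_J (v - tproj \<Sigma> p v) \<in> normal_space \<Sigma> p"
    using lagrangian_J_normal[OF assms] tproj_in[OF sm assms(2)] by simp
  from tangent_part_eq[OF sm assms(2) 1 this] show ?thesis
    using tproj_apply[OF sm assms(2)] by simp
qed

text \<open>This derivative carries the whole second fundamental form. For tangent x it sends a
  tangent y to A(x,y), and a normal vector N to the tangent vector whose inner product with y is
  <A(x,y),N>.\<close>

definition dproj :: "(complex^'n::finite) set \<Rightarrow> complex^'n \<Rightarrow> complex^'n \<Rightarrow> (complex^'n) \<Rightarrow>\<^sub>L (complex^'n)" where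
  "dproj \<Sigma> p = frechet_derivative (tproj \<Sigma>) (at p within \<Sigma>)"

context
  fixes \<Sigma> :: "(complex^'n::finite) set" and p :: "complex^'n"
  assumes sm: "submanifold \<Sigma>" and p: "p \<in> \<Sigma>"
begin

lemma tproj_has_derivative: "(tproj \<Sigma> has_derivative dproj \<Sigma> p) (at p within \<Sigma>)"
  unfolding dproj_def by (rule Ck_on_submanifold_has_derivative[OF sm p Ck_on_submanifold_tproj[OF sm]])

lemma tproj_apply_has_derivative: "((\<lambda>q. tproj \<Sigma> q a) has_derivative (\<lambda>h. dproj \<Sigma> p h a)) (at p within \<Sigma>)"
  by (rule bounded_linear.has_derivative[OF blinfun.bounded_linear_left tproj_has_derivative])

lemma tangent_ext_has_derivative: "(tangent_ext \<Sigma> a has_derivative (\<lambda>h. dproj \<Sigma> p h a)) (at p within \<Sigma>)"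
  by (rule has_derivative_transform[OF p _ tproj_apply_has_derivative])
     (simp add: tangent_ext_def tproj_apply[OF sm])

lemma dir_deriv_tangent_ext:
  "x \<in> tangent_space \<Sigma> p \<Longrightarrow> dir_deriv \<Sigma> (tangent_ext \<Sigma> a) p x = dproj \<Sigma> p x a"
  by (rule dir_deriv_eq[OF sm p _ tangent_ext_has_derivative])

text \<open>Differentiating P P = P shows that the derivative of P interchanges tangent and normal
  vectors.\<close>

lemma dproj_tproj:
  assumes x: "x \<in> tangent_space \<Sigma> p"
  shows "tproj \<Sigma> p (dproj \<Sigma> p x a) + dproj \<Sigma> p x (tproj \<Sigma> p a) = dproj \<Sigma> p x a"
proof -
  have "((\<lambda>q. tproj \<Sigma> q o\<^sub>L tproj \<Sigma> q) has_derivative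
      (\<lambda>h. (tproj \<Sigma> p o\<^sub>L dproj \<Sigma> p h) + (dproj \<Sigma> p h o\<^sub>L tproj \<Sigma> p))) (at p within \<Sigma>)"
    by (rule bounded_bilinear.FDERIV[OF bounded_bilinear_blinfun_compose tproj_has_derivative tproj_has_derivative])
  from tangent_derivative_unique[OF sm p x this tproj_has_derivative]
  have "(tproj \<Sigma> p o\<^sub>L dproj \<Sigma> p x) + (dproj \<Sigma> p x o\<^sub>L tproj \<Sigma> p) = dproj \<Sigma> p x"
    by (simp add: blinfun_eqI tproj_idem[OF sm])
  from arg_cong[OF this, of "\<lambda>f. blinfun_apply f a"] show ?thesis by (simp add: blinfun.add_left)
qed

lemma tproj_dproj_tangent:
  assumes "x \<in> tangent_space \<Sigma> p" "y \<in> tangent_space \<Sigma> p"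
  shows "tproj \<Sigma> p (dproj \<Sigma> p x y) = 0"
  using dproj_tproj[OF assms(1), of y] tproj_tangent[OF sm p assms(2)] by simp

lemma dproj_sym:
  assumes x: "x \<in> tangent_space \<Sigma> p"
  shows "dproj \<Sigma> p x a \<bullet> b = a \<bullet> dproj \<Sigma> p x b"
proof -
  have 1: "((\<lambda>q. tproj \<Sigma> q a \<bullet> b) has_derivative (\<lambda>h. dproj \<Sigma> p h a \<bullet> b)) (at p within \<Sigma>)"
    by (rule has_derivative_inner_left[OF tproj_apply_has_derivative])
  have 2: "((\<lambda>q. a \<bullet> tproj \<Sigma> q b) has_derivative (\<lambda>h. a \<bullet> dproj \<Sigma> p h b)) (at p within \<Sigma>)"
    by (rule has_derivative_inner_right[OF tproj_apply_has_derivative])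
  show ?thesis
    using tangent_derivative_unique[OF sm p x 1 2] tproj_sym[OF sm] by simp
qed

text \<open>In a chart phi, differentiating P (D phi k) = D phi k exhibits A as the normal part of
  the second derivative of phi, which is symmetric.\<close>

lemma dproj_commute:
  assumes x: "x \<in> tangent_space \<Sigma> p" and y: "y \<in> tangent_space \<Sigma> p"
  shows "dproj \<Sigma> p x y = dproj \<Sigma> p y x"
proof -
  obtain U \<phi> z where lp: "local_param \<Sigma> U \<phi>" and z: "z \<in> U" "p = \<phi> z"
    and ts: "tangent_space \<Sigma> p = range (der \<phi> z)"
    using submanifold_local_param[OF sm p] .
  let ?D = "\<lambda>k y. der \<phi> y k"
  let ?D2 = "\<lambda>k h. der (?D k) z h"
  have eq: "dproj \<Sigma> p (?D h z) (?D k z) = ?D2 k h - tproj \<Sigma> p (?D2 k h)" for h k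
  proof -
    have D: "(?D k has_derivative ?D2 k) (at z)"
      using local_param_Ck[OF lp, of "Suc (Suc 0)"] z(1) by (auto simp: frechet_derivative_works)
    have P: "((\<lambda>y. tproj \<Sigma> (\<phi> y)) has_derivative (\<lambda>h. dproj \<Sigma> p (?D h z))) (at z)"
      using has_derivative_in_local_param[where f = "tproj \<Sigma>", OF lp z(1)] tproj_has_derivative z(2) by simp
    have "((\<lambda>y. tproj \<Sigma> (\<phi> y) (?D k y)) has_derivative
        (\<lambda>h. tproj \<Sigma> (\<phi> z) (?D2 k h) + dproj \<Sigma> p (?D h z) (?D k z))) (at z)"
      by (rule bounded_bilinear.FDERIV[OF bounded_bilinear_blinfun_apply P D])
    then have "(?D k has_derivative
        (\<lambda>h. tproj \<Sigma> (\<phi> z) (?D2 k h) + dproj \<Sigma> p (?D h z) (?D k z))) (at z)"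
    proof (rule has_derivative_transform_within_open[OF _ local_param_open[OF lp] z(1)])
      fix y assume y: "y \<in> U"
      show "tproj \<Sigma> (\<phi> y) (?D k y) = ?D k y"
        using tproj_tangent[OF sm local_param_mem[OF lp y]] tangent_space_local_param[OF lp y] by simp
    qed
    then have "(\<lambda>h. tproj \<Sigma> (\<phi> z) (?D2 k h) + dproj \<Sigma> p (?D h z) (?D k z)) = ?D2 k"
      using D by (rule has_derivative_unique)
    from fun_cong[OF this, of h] show ?thesis using z(2) by (simp add: algebra_simps)
  qed
  obtain h k where hk: "x = ?D h z" "y = ?D k z" using x y ts by blast
  have "?D2 k h = ?D2 h k"
    by (rule symmetric_second_derivative[OF local_param_open[OF lp] z(1) local_param_Ck[OF lp]])
  then show ?thesis using eq hk by simp
qed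

lemma second_fundamental_form_eq:
  assumes "x \<in> tangent_space \<Sigma> p" "y \<in> tangent_space \<Sigma> p"
  shows "second_fundamental_form \<Sigma> p x y = dproj \<Sigma> p x y"
  using tproj_dproj_tangent[OF assms] dir_deriv_tangent_ext[OF assms(1)] tproj_apply[OF sm p]
  by (simp add: second_fundamental_form_def normal_part_def)

text \<open>The derivative of P J = J (1 - P). Together with \<open>dproj_sym\<close> and
  \<open>dproj_commute\<close> it contains the total symmetry of <A(x,y), J z>.\<close>

lemma dproj_cplx_J:
  assumes "lagrangian \<Sigma>" and x: "x \<in> tangent_space \<Sigma> p"
  shows "dproj \<Sigma> p x (cplx_J a) = - cplx_J (dproj \<Sigma> p x a)"
proof -
  have "((\<lambda>q. cplx_J (a - tproj \<Sigma> q a)) has_derivative (\<lambda>h. cplx_J (0 - dproj \<Sigma> p h a))) (at p within \<Sigma>)"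
    by (intro bounded_linear.has_derivative[OF bounded_linear_cplx_J] has_derivative_diff has_derivative_const
        tproj_apply_has_derivative)
  from tangent_derivative_unique[OF sm p x tproj_apply_has_derivative this]
  show ?thesis using lagrangian_tproj_J[OF assms(1)] by (simp add: cplx_J_simps)
qed

end

section \<open>The weighted Bochner formula\<close>

definition trace_blinfun :: "('a::euclidean_space \<Rightarrow>\<^sub>L 'a) \<Rightarrow> real" where
  "trace_blinfun K = (\<Sum>b\<in>Basis. K b \<bullet> b)"

lemma bounded_linear_trace_blinfun: "bounded_linear trace_blinfun"
  unfolding trace_blinfun_def
  by (intro bounded_linear_sum bounded_linear_compose[OF bounded_linear_inner_left] blinfun.bounded_linear_left)

locale lagrangian_variation_on_soliton =
  fixes \<Sigma> :: "(complex^'n::finite) set" and T :: "complex^'n" and V :: "complex^'n \<Rightarrow> complex^'n"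
  assumes lag: "lagrangian \<Sigma>" and sol: "translating_soliton \<Sigma> T"
    and var: "lagrangian_variation \<Sigma> V"
begin

lemma sm: "submanifold \<Sigma>"
  using lag by (simp add: lagrangian_def)

text \<open>The tangent field metrically dual to the 1-form of \<open>V\<close>.\<close>
definition W :: "complex^'n \<Rightarrow> complex^'n" where
  "W q = - cplx_J (V q)"

definition W' :: "complex^'n \<Rightarrow> complex^'n \<Rightarrow> complex^'n" where
  "W' q = frechet_derivative W (at q within \<Sigma>)"

text \<open>The inner projection is part of \<open>tderiv\<close>. The operator is the covariant
  derivative of W on tangent vectors and zero on normal ones.\<close>

definition S :: "complex^'n \<Rightarrow> (complex^'n) \<Rightarrow>\<^sub>L (complex^'n)" where
  "S q = tproj \<Sigma> q o\<^sub>L tderiv \<Sigma> W q"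

text \<open>A derivative in the ambient space: for tangent x and y only the tangential part of
  \<open>S' p x y\<close> is the second covariant derivative of W.\<close>

definition S' :: "complex^'n \<Rightarrow> complex^'n \<Rightarrow> (complex^'n) \<Rightarrow>\<^sub>L (complex^'n)" where
  "S' q = frechet_derivative S (at q within \<Sigma>)"

text \<open>The divergence of \<open>W\<close> with respect to the weighted measure.\<close>
definition u :: "complex^'n \<Rightarrow> real" where
  "u q = trace_blinfun (S q) + T \<bullet> W q"

lemma V_eq: "V q = cplx_J (W q)"
  by (simp add: W_def cplx_J_simps)

lemma Ck_W: "Ck_on_submanifold k \<Sigma> W"
proof -
  have "Ck_on_submanifold k \<Sigma> V"
    using var by (simp add: lagrangian_variation_def normal_field_def smooth_on_submanifold_iff)
  from Ck_on_submanifold_linear[OF bounded_linear_minus[OF bounded_linear_cplx_J] this]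
  show ?thesis by (simp add: W_def[abs_def])
qed

lemma Ck_S: "Ck_on_submanifold k \<Sigma> S"
  unfolding S_def[abs_def]
  by (rule Ck_on_submanifold_bilinear[OF bounded_bilinear_blinfun_compose
      Ck_on_submanifold_tproj[OF sm] Ck_on_submanifold_tderiv[OF sm Ck_W]])

lemma W_tangent:
  assumes "p \<in> \<Sigma>"
  shows "W p \<in> tangent_space \<Sigma> p"
proof -
  have "V p \<in> cplx_J ` tangent_space \<Sigma> p"
    using var assms lagrangian_J_normal[OF lag assms]
    by (auto simp: lagrangian_variation_def normal_field_def)
  then show ?thesis by (auto simp: W_def)
qed

lemma tangent_field_tangent_ext: "tangent_field \<Sigma> (tangent_ext \<Sigma> a)"
  using Ck_on_submanifold_tproj_apply[OF sm] tangent_part_in(1)[OF sm]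
  by (simp add: tangent_field_def smooth_on_submanifold_iff tangent_ext_def)

context
  fixes p :: "complex^'n"
  assumes p: "p \<in> \<Sigma>"
begin

lemma W_has_derivative: "(W has_derivative W' p) (at p within \<Sigma>)"
  unfolding W'_def by (rule Ck_on_submanifold_has_derivative[OF sm p Ck_W])

lemma S_has_derivative: "(S has_derivative S' p) (at p within \<Sigma>)"
  unfolding S'_def by (rule Ck_on_submanifold_has_derivative[OF sm p Ck_S])

lemma linear_W': "linear (W' p)"
  using W_has_derivative has_derivative_linear by blast

lemma tderiv_W: "tderiv \<Sigma> W p a = W' p (tproj \<Sigma> p a)"
  by (rule tderiv_apply[OF sm p W_has_derivative])

lemma S_apply: "S p a = tproj \<Sigma> p (W' p (tproj \<Sigma> p a))"
  by (simp add: S_def tderiv_W)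

lemma V_has_derivative: "(V has_derivative (\<lambda>h. cplx_J (W' p h))) (at p within \<Sigma>)"
proof -
  have "((\<lambda>q. cplx_J (W q)) has_derivative (\<lambda>h. cplx_J (W' p h))) (at p within \<Sigma>)"
    by (rule bounded_linear.has_derivative[OF bounded_linear_cplx_J W_has_derivative])
  then show ?thesis by (simp add: V_eq[symmetric])
qed

lemma theta_form_tangent_ext_derivative:
  "((\<lambda>q. theta_form V q (tangent_ext \<Sigma> b q)) has_derivative
    (\<lambda>h. W p \<bullet> dproj \<Sigma> p h b + W' p h \<bullet> tproj \<Sigma> p b)) (at p within \<Sigma>)"
proof -
  have "((\<lambda>q. W q \<bullet> tproj \<Sigma> q b) has_derivative
    (\<lambda>h. W p \<bullet> dproj \<Sigma> p h b + W' p h \<bullet> tproj \<Sigma> p b)) (at p within \<Sigma>)"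
    by (rule bounded_bilinear.FDERIV[OF bounded_bilinear_inner W_has_derivative tproj_apply_has_derivative[OF sm p]])
  then show ?thesis
    by (rule has_derivative_transform[OF p, rotated])
       (simp add: theta_form_def kahler_form_def W_def tangent_ext_def tproj_apply[OF sm])
qed

text \<open>The exterior derivative is evaluated on projected constant fields. All terms with the
  derivative of the projection cancel against the Lie bracket, which leaves the symmetry of the
  covariant derivative.\<close>

lemma closedness: "W' p (tproj \<Sigma> p a) \<bullet> tproj \<Sigma> p b = W' p (tproj \<Sigma> p b) \<bullet> tproj \<Sigma> p a"
proof -
  have "ext_deriv \<Sigma> (theta_form V) (tangent_ext \<Sigma> a) (tangent_ext \<Sigma> b) p = 0"
    using var p tangent_field_tangent_ext by (simp add: lagrangian_variation_def closed_form_def)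
  moreover have "tangent_ext \<Sigma> c p = tproj \<Sigma> p c" for c
    by (simp add: tangent_ext_def tproj_apply[OF sm p])
  moreover have "dir_deriv \<Sigma> (\<lambda>q. theta_form V q (tangent_ext \<Sigma> c q)) p (tproj \<Sigma> p d)
      = W p \<bullet> dproj \<Sigma> p (tproj \<Sigma> p d) c + W' p (tproj \<Sigma> p d) \<bullet> tproj \<Sigma> p c" for c d
    by (rule dir_deriv_eq[OF sm p tproj_in[OF sm p] theta_form_tangent_ext_derivative])
  ultimately show ?thesis
    by (simp add: ext_deriv_def lie_bracket_def dir_deriv_tangent_ext[OF sm p] tproj_in[OF sm p]
        theta_form_def kahler_form_def W_def cplx_J_simps inner_diff_right)
qed

lemma S_sym: "S p a \<bullet> b = a \<bullet> S p b"
  using closedness[of a b] by (simp add: S_apply tproj_sym[OF sm p] inner_commute)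

lemma tproj_S [simp]: "tproj \<Sigma> p (S p a) = S p a"
  by (simp add: S_apply tproj_idem[OF sm p])

lemma S_tproj [simp]: "S p (tproj \<Sigma> p a) = S p a"
  by (simp add: S_apply tproj_idem[OF sm p])

end

text \<open>The point is fixed anew because differentiating the identities for \<open>S\<close>
  requires them at all points of the submanifold, not only at p.\<close>

context
  fixes p :: "complex^'n"
  assumes p: "p \<in> \<Sigma>"
begin

lemma S'_sym:
  assumes x: "x \<in> tangent_space \<Sigma> p"
  shows "S' p x a \<bullet> b = a \<bullet> S' p x b"
proof -
  have d: "((\<lambda>q. S q a) has_derivative (\<lambda>h. S' p h a)) (at p within \<Sigma>)" for a
    by (rule bounded_linear.has_derivative[OF blinfun.bounded_linear_left S_has_derivative[OF p]])
  show ?thesis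
    using tangent_derivative_unique[OF sm p x has_derivative_inner_left[OF d] has_derivative_inner_right[OF d]]
      S_sym by blast
qed

lemma S'_tproj:
  assumes x: "x \<in> tangent_space \<Sigma> p"
  shows "S p (dproj \<Sigma> p x a) + S' p x (tproj \<Sigma> p a) = S' p x a"
proof -
  have "((\<lambda>q. S q o\<^sub>L tproj \<Sigma> q) has_derivative
      (\<lambda>h. (S p o\<^sub>L dproj \<Sigma> p h) + (S' p h o\<^sub>L tproj \<Sigma> p))) (at p within \<Sigma>)"
    by (rule bounded_bilinear.FDERIV[OF bounded_bilinear_blinfun_compose S_has_derivative[OF p]
          tproj_has_derivative[OF sm p]])
  from tangent_derivative_unique[OF sm p x this S_has_derivative[OF p]]
  have "(S p o\<^sub>L dproj \<Sigma> p x) + (S' p x o\<^sub>L tproj \<Sigma> p) = S' p x"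
    by (simp add: blinfun_eqI)
  from arg_cong[OF this, of "\<lambda>f. blinfun_apply f a"] show ?thesis by (simp add: blinfun.add_left)
qed

text \<open>Differentiating S = S P splits \<open>S'\<close> into S A + S' P, where A is
  \<open>dproj\<close> in direction x. Cyclicity and S = P S turn the trace of S A into that of S A
  P, which is zero: A maps tangent vectors to normal ones, and S kills those.\<close>

lemma trace_S':
  assumes x: "x \<in> tangent_space \<Sigma> p"
  shows "trace_blinfun (S' p x) = (\<Sum>e\<in>tangent_onb \<Sigma> p. S' p x e \<bullet> e)"
proof -
  have lin: "linear (blinfun_apply f)" for f :: "(complex^'n) \<Rightarrow>\<^sub>L (complex^'n)"
    by (simp add: bounded_linear.linear blinfun.bounded_linear_right)
  have lin2: "linear (\<lambda>a. S p (dproj \<Sigma> p x a))"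
    using linear_compose[OF lin lin] by (simp add: o_def)
  have "tproj \<Sigma> p (dproj \<Sigma> p x (tproj \<Sigma> p a)) = 0" for a
    by (rule tproj_dproj_tangent[OF sm p x tproj_in[OF sm p]])
  then have PDP: "S p (dproj \<Sigma> p x (tproj \<Sigma> p a)) = 0" for a
    using S_tproj[OF p, of "dproj \<Sigma> p x (tproj \<Sigma> p a)"] by simp
  have "(\<Sum>b\<in>Basis. S p (dproj \<Sigma> p x b) \<bullet> b) = (\<Sum>b\<in>Basis. tproj \<Sigma> p (S p (dproj \<Sigma> p x b)) \<bullet> b)"
    using tproj_S[OF p] by simp
  also have "\<dots> = (\<Sum>b\<in>Basis. S p (dproj \<Sigma> p x (tproj \<Sigma> p b)) \<bullet> b)"
    by (rule trace_commute[OF lin lin2])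
  also have "\<dots> = 0" by (simp add: PDP)
  finally have "trace_blinfun (S' p x) = (\<Sum>b\<in>Basis. S' p x (tproj \<Sigma> p b) \<bullet> b)"
    unfolding trace_blinfun_def
    by (subst S'_tproj[OF x, symmetric]) (simp add: inner_add_left sum.distrib)
  then show ?thesis using trace_tangent_onb[OF sm p lin] by simp
qed

text \<open>The derivative of W = P W; the normal part of the derivative of W is thus
  A(x,W).\<close>

lemma dproj_W:
  assumes x: "x \<in> tangent_space \<Sigma> p"
  shows "W' p x - tproj \<Sigma> p (W' p x) = dproj \<Sigma> p x (W p)"
proof -
  have "((\<lambda>q. tproj \<Sigma> q (W q)) has_derivative
      (\<lambda>h. tproj \<Sigma> p (W' p h) + dproj \<Sigma> p h (W p))) (at p within \<Sigma>)"
    by (rule bounded_bilinear.FDERIV[OF bounded_bilinear_blinfun_apply tproj_has_derivative[OF sm p] W_has_derivative[OF p]])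
  from tangent_derivative_unique[OF sm p x this W_has_derivative[OF p]]
  show ?thesis using tproj_tangent[OF sm] W_tangent by (simp add: algebra_simps)
qed

text \<open>The Ricci identity, with the curvature expressed through the projection as in the Gauss equation.\<close>
lemma curvature_identity:
  assumes x: "x \<in> tangent_space \<Sigma> p" and y: "y \<in> tangent_space \<Sigma> p"
  shows "tproj \<Sigma> p (S' p x y - S' p y x)
    = dproj \<Sigma> p x (dproj \<Sigma> p y (W p)) - dproj \<Sigma> p y (dproj \<Sigma> p x (W p))"
proof -
  obtain U \<phi> z where lp: "local_param \<Sigma> U \<phi>" and z: "z \<in> U" "p = \<phi> z"
    and ts: "tangent_space \<Sigma> p = range (der \<phi> z)"
    using submanifold_local_param[OF sm p] .
  let ?D = "\<lambda>k y. der \<phi> y k"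
  let ?D2 = "\<lambda>k h. der (?D k) z h"
  let ?w = "\<lambda>y. W (\<phi> y)"
  let ?E = "\<lambda>k y. der ?w y k"
  let ?E2 = "\<lambda>k h. der (?E k) z h"
  have Ckw: "Ck_on k U ?w" for k by (rule Ck_on_submanifoldD[OF Ck_W lp])
  have w': "?E k y = W' (\<phi> y) (?D k y)" if y: "y \<in> U" for k y
  proof -
    have "(?w has_derivative (\<lambda>k. W' (\<phi> y) (?D k y))) (at y)"
      by (rule has_derivative_in_local_param[OF lp y W_has_derivative[OF local_param_mem[OF lp y]]])
    from frechet_derivative_at[OF this, symmetric] show ?thesis by meson
  qed
  \<comment> \<open>Both sides are derivatives in direction h of S (D phi k) = P (D (W o phi) k).
    The second derivatives of phi and of W o phi are symmetric in h and k, so they disappear on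
    antisymmetrising.\<close>
  have eq: "S' p (?D h z) (?D k z) + S p (?D2 k h) = dproj \<Sigma> p (?D h z) (W' p (?D k z)) + tproj \<Sigma> p (?E2 k h)" for h k
  proof -
    have D: "(?D k has_derivative ?D2 k) (at z)"
      using local_param_Ck[OF lp, of "Suc (Suc 0)"] z(1) by (auto simp: frechet_derivative_works)
    have E: "(?E k has_derivative ?E2 k) (at z)"
      using Ckw[of "Suc (Suc 0)"] z(1) by (auto simp: frechet_derivative_works)
    have P: "((\<lambda>y. tproj \<Sigma> (\<phi> y)) has_derivative (\<lambda>h. dproj \<Sigma> p (?D h z))) (at z)"
      using has_derivative_in_local_param[where f = "tproj \<Sigma>", OF lp z(1)] tproj_has_derivative[OF sm p] z(2) by simp
    have S: "((\<lambda>y. S (\<phi> y)) has_derivative (\<lambda>h. S' p (?D h z))) (at z)"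
      using has_derivative_in_local_param[where f = S, OF lp z(1)] S_has_derivative[OF p] z(2) by simp
    have 1: "((\<lambda>y. S (\<phi> y) (?D k y)) has_derivative
        (\<lambda>h. S (\<phi> z) (?D2 k h) + S' p (?D h z) (?D k z))) (at z)"
      by (rule bounded_bilinear.FDERIV[OF bounded_bilinear_blinfun_apply S D])
    have 2: "((\<lambda>y. tproj \<Sigma> (\<phi> y) (?E k y)) has_derivative
        (\<lambda>h. tproj \<Sigma> (\<phi> z) (?E2 k h) + dproj \<Sigma> p (?D h z) (?E k z))) (at z)"
      by (rule bounded_bilinear.FDERIV[OF bounded_bilinear_blinfun_apply P E])
    have 3: "((\<lambda>y. S (\<phi> y) (?D k y)) has_derivative
        (\<lambda>h. tproj \<Sigma> (\<phi> z) (?E2 k h) + dproj \<Sigma> p (?D h z) (?E k z))) (at z)"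
    proof (rule has_derivative_transform_within_open[OF 2 local_param_open[OF lp] z(1)])
      fix y assume y: "y \<in> U"
      have "?D k y \<in> tangent_space \<Sigma> (\<phi> y)" using tangent_space_local_param[OF lp y] by simp
      then show "tproj \<Sigma> (\<phi> y) (?E k y) = S (\<phi> y) (?D k y)"
        using S_apply[OF local_param_mem[OF lp y]] w'[OF y] tproj_tangent[OF sm local_param_mem[OF lp y]] by simp
    qed
    from fun_cong[OF has_derivative_unique[OF 1 3], of h] show ?thesis
      using z(2) w'[OF z(1)] by (simp add: algebra_simps)
  qed
  obtain h k where hk: "x = ?D h z" "y = ?D k z" using x y ts by blast
  have D2: "?D2 k h = ?D2 h k"
    by (rule symmetric_second_derivative[OF local_param_open[OF lp] z(1) local_param_Ck[OF lp]])
  have E2: "?E2 k h = ?E2 h k"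
    by (rule symmetric_second_derivative[OF local_param_open[OF lp] z(1) Ckw])
  have "S' p x y - S' p y x = dproj \<Sigma> p x (W' p y) - dproj \<Sigma> p y (W' p x)"
    using eq[of h k] eq[of k h] D2 E2 hk by (metis (no_types, lifting) add_diff_cancel_right' add_diff_cancel_right)
  \<comment> \<open>The derivative A of P satisfies P A = A (1 - P), so only the normal part of
    \<open>W' p b\<close> counts, and by \<open>dproj_W\<close> it is A(b,W).\<close>
  moreover have "tproj \<Sigma> p (dproj \<Sigma> p a (W' p b)) = dproj \<Sigma> p a (dproj \<Sigma> p b (W p))"
    if "a \<in> tangent_space \<Sigma> p" "b \<in> tangent_space \<Sigma> p" for a b
  proof -
    have "dproj \<Sigma> p a (dproj \<Sigma> p b (W p)) = dproj \<Sigma> p a (W' p b) - dproj \<Sigma> p a (tproj \<Sigma> p (W' p b))"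
      by (simp only: dproj_W[OF that(2), symmetric] blinfun.diff_right)
    then show ?thesis
      using dproj_tproj[OF sm p that(1), of "W' p b"] by (metis add_diff_cancel_right')
  qed
  ultimately show ?thesis using x y by (simp add: blinfun.diff_right)
qed

text \<open>J is constant and exchanges P with 1 - P, so the normal connection of J W is J of the
  Levi-Civita connection of W.\<close>

lemma normal_connection_V:
  assumes "x \<in> tangent_space \<Sigma> p"
  shows "normal_connection \<Sigma> V p x = cplx_J (tproj \<Sigma> p (W' p x))"
proof -
  have "dir_deriv \<Sigma> V p x = cplx_J (W' p x)"
    by (rule dir_deriv_eq[OF sm p assms V_has_derivative[OF p]])
  then show ?thesis
    using lagrangian_tproj_J[OF lag p, of "W' p x"]
    by (simp add: normal_connection_def normal_part_def tproj_apply[OF sm p, symmetric] cplx_J_simps)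
qed

end

context
  fixes p :: "complex^'n"
  assumes p: "p \<in> \<Sigma>"
begin

lemma normal_hessian_V:
  assumes x: "x \<in> tangent_space \<Sigma> p" and y: "y \<in> tangent_space \<Sigma> p"
  shows "normal_hessian \<Sigma> V p x y = cplx_J (tproj \<Sigma> p (S' p x y))"
proof -
  let ?N = "\<lambda>q. normal_connection \<Sigma> V q (tangent_ext \<Sigma> y q)"
  have 1: "((\<lambda>q. cplx_J (S q y)) has_derivative (\<lambda>h. cplx_J (S' p h y))) (at p within \<Sigma>)"
    by (intro bounded_linear.has_derivative[OF bounded_linear_cplx_J]
        bounded_linear.has_derivative[OF blinfun.bounded_linear_left S_has_derivative[OF p]])
  have "?N q = cplx_J (S q y)" if q: "q \<in> \<Sigma>" for q
    using normal_connection_V[OF q tproj_in[OF sm q]] S_apply[OF q]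
    by (simp add: tangent_ext_def tproj_apply[OF sm q, symmetric])
  then have "(?N has_derivative (\<lambda>h. cplx_J (S' p h y))) (at p within \<Sigma>)"
    by (rule has_derivative_transform[OF p _ 1])
  then have "dir_deriv \<Sigma> ?N p x = cplx_J (S' p x y)"
    by (rule dir_deriv_eq[OF sm p x])
  then have "normal_connection \<Sigma> ?N p x = cplx_J (tproj \<Sigma> p (S' p x y))"
    using lagrangian_tproj_J[OF lag p, of "S' p x y"]
    by (simp add: normal_connection_def normal_part_def tproj_apply[OF sm p, symmetric] cplx_J_simps)
  \<comment> \<open>The projected constant field has a purely normal derivative A(x,y), so its
    covariant derivative at p is zero and the correction term drops out.\<close>
  moreover have "levi_civita \<Sigma> (tangent_ext \<Sigma> y) p x = 0"
    using tproj_dproj_tangent[OF sm p x y]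
    by (simp add: levi_civita_def dir_deriv_tangent_ext[OF sm p x] tproj_apply[OF sm p, symmetric])
  moreover have "normal_connection \<Sigma> V p 0 = 0"
    using normal_connection_V[OF p subspace_0[OF subspace_tangent_space[OF sm p]]] linear_0[OF linear_W'[OF p]]
    by (simp add: cplx_J_simps)
  ultimately show ?thesis by (simp add: normal_hessian_def)
qed

lemma stability_operator_V:
  "stability_operator \<Sigma> T V p \<bullet> V p
    = (\<Sum>e\<in>tangent_onb \<Sigma> p. S' p e e \<bullet> W p) + S p T \<bullet> W p
      + (\<Sum>e\<in>tangent_onb \<Sigma> p. \<Sum>e'\<in>tangent_onb \<Sigma> p. (dproj \<Sigma> p e e' \<bullet> cplx_J (W p))\<^sup>2)"
proof -
  let ?B = "tangent_onb \<Sigma> p"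
  note B = tangent_onb_in[OF sm p]
  have "normal_laplacian \<Sigma> V p = cplx_J (tproj \<Sigma> p (\<Sum>e\<in>?B. S' p e e))"
    using B by (simp add: normal_laplacian_def normal_hessian_V blinfun.sum_right linear_sum[OF linear_cplx_J])
  then have "normal_laplacian \<Sigma> V p \<bullet> V p = (\<Sum>e\<in>?B. S' p e e \<bullet> W p)"
    using tproj_tangent[OF sm p W_tangent[OF p]]
    by (simp add: V_eq tproj_sym[OF sm p] inner_sum_left)
  moreover have "normal_connection \<Sigma> V p (tangent_part \<Sigma> p T) \<bullet> V p = S p T \<bullet> W p"
    using normal_connection_V[OF p tproj_in[OF sm p]] S_apply[OF p]
    by (simp add: tproj_apply[OF sm p, symmetric] V_eq)
  moreover have "(\<Sum>e\<in>?B. \<Sum>e'\<in>?B. (second_fundamental_form \<Sigma> p e e' \<bullet> V p) *\<^sub>R second_fundamental_form \<Sigma> p e e') \<bullet> V p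
      = (\<Sum>e\<in>?B. \<Sum>e'\<in>?B. (dproj \<Sigma> p e e' \<bullet> cplx_J (W p))\<^sup>2)"
    unfolding inner_sum_left
    by (intro sum.cong refl) (simp add: second_fundamental_form_eq[OF sm p] B V_eq power2_eq_square)
  ultimately show ?thesis by (simp add: stability_operator_def inner_add_left)
qed

lemma dproj_normal:
  assumes "x \<in> tangent_space \<Sigma> p" "y \<in> tangent_space \<Sigma> p"
  shows "dproj \<Sigma> p x y \<in> normal_space \<Sigma> p"
  using tproj_diff_normal[OF sm p, of "dproj \<Sigma> p x y"] tproj_dproj_tangent[OF sm p assms] by simp

text \<open>The cubic form \<open>\<langle>A(x,y), J z\<rangle>\<close> is totally symmetric, so the curvature terms of the Bochner
  formula cancel the quadratic term of the stability operator.\<close>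
lemma stability_operator_eq_derivative:
  "stability_operator \<Sigma> T V p \<bullet> V p = trace_blinfun (S' p (W p)) + T \<bullet> W' p (W p)"
proof -
  let ?B = "tangent_onb \<Sigma> p" and ?w = "W p" and ?P = "tproj \<Sigma> p" and ?A = "\<lambda>x. blinfun_apply (dproj \<Sigma> p x)"
  note B = tangent_onb_in[OF sm p] and w = W_tangent[OF p]
  \<comment> \<open>Total symmetry in use: <A(e,e'), J w> = -<e', J A(e,w)>. As J A(e,w) is tangent,
    Parseval sums the squares to |A(e,w)|^2.\<close>
  have cubic: "(\<Sum>e'\<in>?B. (?A e e' \<bullet> cplx_J ?w)\<^sup>2) = ?A e ?w \<bullet> ?A e ?w" if e: "e \<in> ?B" for e
  proof -
    have "(?A e e' \<bullet> cplx_J ?w) = - (e' \<bullet> cplx_J (?A e ?w))" for e'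
      using dproj_sym[OF sm p B[OF e], of e' "cplx_J ?w"] dproj_cplx_J[OF sm p lag B[OF e], of ?w]
      by (simp only: inner_minus_right)
    then have "(\<Sum>e'\<in>?B. (?A e e' \<bullet> cplx_J ?w)\<^sup>2) = (\<Sum>e'\<in>?B. (e' \<bullet> cplx_J (?A e ?w))\<^sup>2)" by simp
    moreover have "cplx_J (?A e ?w) \<in> tangent_space \<Sigma> p"
    proof -
      obtain v where "v \<in> tangent_space \<Sigma> p" "?A e ?w = cplx_J v"
        using dproj_normal[OF B[OF e] w] lagrangian_J_normal[OF lag p] by blast
      then show ?thesis using subspace_neg[OF subspace_tangent_space[OF sm p]] by simp
    qed
    ultimately show ?thesis using tangent_onb_Parseval[OF sm p] by simp
  qed
  \<comment> \<open>Symmetry of \<open>S' p e\<close> makes w its argument, the curvature identity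
    exchanges e and w, and symmetry of \<open>dproj\<close> turns the result into the Gauss terms,
    which sum over e to Ric(w,w).\<close>
  have step: "S' p e e \<bullet> ?w = S' p ?w e \<bullet> e + ?A e e \<bullet> ?A ?w ?w - ?A e ?w \<bullet> ?A e ?w" if e: "e \<in> ?B" for e
  proof -
    have "S' p e e \<bullet> ?w = e \<bullet> S' p e ?w" by (rule S'_sym[OF p B[OF e]])
    also have "\<dots> = e \<bullet> S' p ?w e + ?P e \<bullet> (S' p e ?w - S' p ?w e)"
      using tproj_tangent[OF sm p B[OF e]] by (simp add: inner_diff_right)
    also have "?P e \<bullet> (S' p e ?w - S' p ?w e) = e \<bullet> (?A e (?A ?w ?w) - ?A ?w (?A e ?w))"
      by (simp add: tproj_sym[OF sm p] curvature_identity[OF p B[OF e] w])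
    also have "\<dots> = ?A e e \<bullet> ?A ?w ?w - ?A ?w e \<bullet> ?A e ?w"
      by (simp add: inner_diff_right dproj_sym[OF sm p B[OF e]] dproj_sym[OF sm p w])
    also have "?A ?w e = ?A e ?w" by (rule dproj_commute[OF sm p w B[OF e]])
    finally show ?thesis by (simp add: inner_commute)
  qed
  have H: "mean_curvature \<Sigma> p = (\<Sum>e\<in>?B. ?A e e)"
    using B by (simp add: mean_curvature_def second_fundamental_form_eq[OF sm p])
  have "T \<bullet> W' p ?w = T \<bullet> ?P (W' p ?w) + T \<bullet> ?A ?w ?w"
    using dproj_W[OF p w, symmetric] by (simp add: inner_diff_right)
  also have "T \<bullet> ?P (W' p ?w) = S p T \<bullet> ?w"
    using S_sym[OF p, of T ?w] S_apply[OF p, of ?w] tproj_tangent[OF sm p w] by simp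
  \<comment> \<open>A(w,w) is normal, so it meets only the normal part of T; the soliton equation
    enters here.\<close>
  also have "T \<bullet> ?A ?w ?w = mean_curvature \<Sigma> p \<bullet> ?A ?w ?w"
  proof -
    have "?P T \<bullet> ?A ?w ?w = T \<bullet> ?P (?A ?w ?w)" by (rule tproj_sym[OF sm p])
    also have "\<dots> = 0" using tproj_dproj_tangent[OF sm p w w] by simp
    finally have "T \<bullet> ?A ?w ?w = normal_part \<Sigma> p T \<bullet> ?A ?w ?w"
      by (simp add: normal_part_def tproj_apply[OF sm p, symmetric] inner_diff_left)
    then show ?thesis using sol p by (simp add: translating_soliton_def)
  qed
  finally have T: "T \<bullet> W' p ?w = S p T \<bullet> ?w + (\<Sum>e\<in>?B. ?A e e \<bullet> ?A ?w ?w)"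
    by (simp add: H inner_sum_left)
  have "stability_operator \<Sigma> T V p \<bullet> V p
    = (\<Sum>e\<in>?B. S' p ?w e \<bullet> e + ?A e e \<bullet> ?A ?w ?w - ?A e ?w \<bullet> ?A e ?w) + S p T \<bullet> ?w + (\<Sum>e\<in>?B. ?A e ?w \<bullet> ?A e ?w)"
    unfolding stability_operator_V by (simp add: step cubic cong: sum.cong)
  then show ?thesis
    using T trace_S'[OF p w] by (simp add: sum.distrib sum_subtractf)
qed

lemma u_has_derivative:
  "(u has_derivative (\<lambda>h. trace_blinfun (S' p h) + T \<bullet> W' p h)) (at p within \<Sigma>)"
  unfolding u_def[abs_def]
  by (intro has_derivative_add has_derivative_inner_right W_has_derivative[OF p]
      bounded_linear.has_derivative[OF bounded_linear_trace_blinfun S_has_derivative[OF p]])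

end

definition X :: "complex^'n \<Rightarrow> complex^'n" where
  "X q = (exp (T \<bullet> q) * u q) *\<^sub>R W q"

lemma Ck_u: "Ck_on_submanifold k \<Sigma> u"
  unfolding u_def[abs_def]
  by (intro Ck_on_submanifold_add Ck_on_submanifold_linear[OF bounded_linear_trace_blinfun Ck_S]
      Ck_on_submanifold_linear[OF bounded_linear_inner_right Ck_W])

lemma Ck_X: "Ck_on_submanifold k \<Sigma> X"
proof -
  have e: "Ck_on_submanifold k \<Sigma> (\<lambda>q. exp (T \<bullet> q))"
  proof (rule Ck_on_submanifoldI)
    fix U \<phi> assume lp: "local_param \<Sigma> U \<phi>"
    note o = local_param_open[OF lp]
    have "Ck_on k U (\<lambda>x. T \<bullet> \<phi> x)"
      by (rule Ck_on_linear[OF o bounded_linear_inner_right local_param_Ck[OF lp]])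
    then show "Ck_on k U (\<lambda>x. exp (T \<bullet> \<phi> x))" by (rule Ck_on_exp[OF o])
  qed
  have "Ck_on_submanifold k \<Sigma> (\<lambda>q. exp (T \<bullet> q) * u q)"
    by (rule Ck_on_submanifold_bilinear[OF bounded_bilinear_mult e Ck_u])
  from Ck_on_submanifold_bilinear[OF bounded_bilinear_scaleR this Ck_W]
  show ?thesis by (simp add: X_def[abs_def])
qed

lemma X_tangent: "p \<in> \<Sigma> \<Longrightarrow> X p \<in> tangent_space \<Sigma> p"
  unfolding X_def by (intro subspace_scale subspace_tangent_space[OF sm] W_tangent)

lemma divergence_X:
  assumes p: "p \<in> \<Sigma>"
  shows "trace_blinfun (tderiv \<Sigma> X p)
    = exp (T \<bullet> p) * (u p)\<^sup>2 + (stability_operator \<Sigma> T V p \<bullet> V p) * exp (T \<bullet> p)"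
proof -
  let ?f = "\<lambda>q. exp (T \<bullet> q)" and ?u' = "\<lambda>h. trace_blinfun (S' p h) + T \<bullet> W' p h" and ?P = "tproj \<Sigma> p"
  have "(?f has_derivative (\<lambda>h. (T \<bullet> h) * ?f p)) (at p within \<Sigma>)"
    by (auto intro!: derivative_eq_intros)
  from bounded_bilinear.FDERIV[OF bounded_bilinear_mult this u_has_derivative[OF p]]
  have "((\<lambda>q. ?f q * u q) has_derivative (\<lambda>h. ?f p * ?u' h + (T \<bullet> h) * ?f p * u p)) (at p within \<Sigma>)" .
  from bounded_bilinear.FDERIV[OF bounded_bilinear_scaleR this W_has_derivative[OF p]]
  have X: "(X has_derivative (\<lambda>h. (?f p * u p) *\<^sub>R W' p h
      + (?f p * ?u' h + (T \<bullet> h) * ?f p * u p) *\<^sub>R W p)) (at p within \<Sigma>)"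
    unfolding X_def[abs_def] .
  have lin_u': "linear ?u'" using u_has_derivative[OF p] by (rule has_derivative_linear)
  \<comment> \<open>Contraction of a gradient with W: the sum over the ambient basis evaluates the
    linear form at P W = W.\<close>
  have contract: "(\<Sum>b\<in>Basis. g (?P b) * (W p \<bullet> b)) = g (W p)" if g: "linear g" for g :: "complex^'n \<Rightarrow> real"
  proof -
    have "g (W p) = g (?P (\<Sum>b\<in>Basis. (W p \<bullet> b) *\<^sub>R b))"
      using tproj_tangent[OF sm p W_tangent[OF p]] by (simp add: euclidean_representation)
    also have "\<dots> = (\<Sum>b\<in>Basis. (W p \<bullet> b) * g (?P b))"
      by (simp add: blinfun.sum_right blinfun.scaleR_right linear_sum[OF g] linear_cmul[OF g])
    finally show ?thesis by (simp add: mult.commute)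
  qed
  \<comment> \<open>\<open>S\<close> has a further projection on the left, which the trace does not
    see because of cyclicity and P P = P.\<close>
  have tr: "(\<Sum>b\<in>Basis. W' p (?P b) \<bullet> b) = trace_blinfun (S p)"
  proof -
    have lin: "linear (blinfun_apply f)" for f :: "(complex^'n) \<Rightarrow>\<^sub>L (complex^'n)"
      by (simp add: bounded_linear.linear blinfun.bounded_linear_right)
    have "trace_blinfun (S p) = (\<Sum>b\<in>Basis. ?P (tderiv \<Sigma> W p b) \<bullet> b)"
      by (simp add: trace_blinfun_def S_def)
    also have "\<dots> = (\<Sum>b\<in>Basis. tderiv \<Sigma> W p (?P b) \<bullet> b)" by (rule trace_commute[OF lin lin])
    finally show ?thesis by (simp add: tderiv_W[OF p] tproj_idem[OF sm p])
  qed
  have linT: "linear (\<lambda>h. T \<bullet> h)" by (simp add: bounded_linear.linear bounded_linear_inner_right)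
  have "trace_blinfun (tderiv \<Sigma> X p) = (?f p * u p) * (\<Sum>b\<in>Basis. W' p (?P b) \<bullet> b)
      + ?f p * (\<Sum>b\<in>Basis. ?u' (?P b) * (W p \<bullet> b)) + (?f p * u p) * (\<Sum>b\<in>Basis. (T \<bullet> ?P b) * (W p \<bullet> b))"
    unfolding trace_blinfun_def[of "tderiv \<Sigma> X p"] tderiv_apply[OF sm p X]
    by (simp add: inner_add_left sum.distrib sum_distrib_left algebra_simps)
  \<comment> \<open>The trace of S and the derivative of the exponent along W add up to a second
    factor u.\<close>
  also have "\<dots> = ?f p * u p * u p + ?f p * ?u' (W p)"
    unfolding tr contract[OF lin_u'] contract[OF linT] by (simp add: u_def algebra_simps)
  finally show ?thesis
    using stability_operator_eq_derivative[OF p] by (simp add: power2_eq_square mult_ac)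
qed

end

section \<open>Change of variables\<close>

text \<open>The change of variables theorem of the library is restricted to well-ordered index types.\<close>
typedef 'a windex = "UNIV :: 'a set" morphisms windex_rep windex_abs
  by simp

lemma bij_windex_rep: "bij windex_rep"
proof (rule bijI)
  show "inj windex_rep" by (simp add: inj_def windex_rep_inject)
  show "surj windex_rep" by (rule surjI[of _ windex_abs]) (simp add: windex_abs_inverse)
qed

instance windex :: (finite) finite
proof
  show "finite (UNIV :: 'a windex set)"
    by (rule finite_imageD[of windex_rep]) (simp_all add: bij_is_inj[OF bij_windex_rep])
qed

definition windex_nat :: "'a::finite windex \<Rightarrow> nat" where
  "windex_nat = (SOME f. inj f)"

lemma inj_windex_nat: "inj (windex_nat :: 'a::finite windex \<Rightarrow> nat)"
  unfolding windex_nat_def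
proof (rule someI_ex[of inj])
  show "\<exists>f :: 'a windex \<Rightarrow> nat. inj f"
    using finite_imp_inj_to_nat_seg[OF finite[of "UNIV :: 'a windex set"]] by blast
qed

instantiation windex :: (finite) wellorder
begin

definition less_eq_windex :: "'a windex \<Rightarrow> 'a windex \<Rightarrow> bool" where
  "less_eq_windex a b \<longleftrightarrow> windex_nat a \<le> windex_nat b"

definition less_windex :: "'a windex \<Rightarrow> 'a windex \<Rightarrow> bool" where
  "less_windex a b \<longleftrightarrow> windex_nat a < windex_nat b"

instance
proof
  fix P :: "'a windex \<Rightarrow> bool" and a
  assume step: "\<And>x. (\<And>y. y < x \<Longrightarrow> P y) \<Longrightarrow> P x"
  show "P a"
  proof (induction a rule: measure_induct_rule[of windex_nat])
    case (less a)
    show ?case by (rule step) (simp add: less_windex_def less)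
  qed
qed (auto simp: less_eq_windex_def less_windex_def inj_eq[OF inj_windex_nat])

end

text \<open>A bridge between Lebesgue integrals of nonnegative functions and gauge integrals, in
  which the change of variables is stated; it speaks about finite values only.\<close>

lemma nn_integral_eq_iff_has_integral:
  fixes G :: "'a::euclidean_space \<Rightarrow> real"
  assumes [measurable]: "S \<in> sets borel" "G \<in> borel_measurable borel" and nonneg: "\<And>x. 0 \<le> G x" and r: "0 \<le> r"
  shows "(\<integral>\<^sup>+x\<in>S. ennreal (G x) \<partial>lborel) = ennreal r \<longleftrightarrow> (G has_integral r) S"
proof -
  let ?P = "\<lambda>x. if x \<in> S then G x else 0"
  have eq: "(\<integral>\<^sup>+x\<in>S. ennreal (G x) \<partial>lborel) = (\<integral>\<^sup>+x. ennreal (?P x) \<partial>lborel)"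
    by (intro nn_integral_cong) (auto simp: indicator_def)
  have P: "?P \<in> borel_measurable borel" "\<And>x. 0 \<le> ?P x" by measurable (simp add: nonneg)
  show ?thesis
  proof
    assume "(\<integral>\<^sup>+x\<in>S. ennreal (G x) \<partial>lborel) = ennreal r"
    then have "(?P has_integral r) UNIV" unfolding eq by (rule nn_integral_has_integral[OF P _ r])
    then show "(G has_integral r) S" by (simp add: has_integral_restrict_UNIV)
  next
    assume "(G has_integral r) S"
    then have "(?P has_integral r) UNIV" by (simp add: has_integral_restrict_UNIV)
    then show "(\<integral>\<^sup>+x\<in>S. ennreal (G x) \<partial>lborel) = ennreal r"
      unfolding eq by (rule nn_integral_has_integral_lborel[OF P])
  qed
qed

text \<open>\<open>G\<close> is a separate Borel function that agrees with the Jacobian expression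
  on S, so measurability of the Jacobian never has to be established.\<close>

lemma nn_integral_diffeomorphism_wellorder:
  fixes g h :: "real^'m::{finite,wellorder} \<Rightarrow> real^'m::_"
  assumes A: "open A" and B: "open B"
    and g: "\<And>x. x \<in> A \<Longrightarrow> g x \<in> B \<and> h (g x) = x" and h: "\<And>y. y \<in> B \<Longrightarrow> h y \<in> A \<and> g (h y) = y"
    and dg: "\<And>x. x \<in> A \<Longrightarrow> (g has_derivative g' x) (at x)"
    and dh: "\<And>y. y \<in> B \<Longrightarrow> (h has_derivative h' y) (at y)"
    and F: "F \<in> borel_measurable borel" "\<And>y. 0 \<le> F y"
    and G: "G \<in> borel_measurable borel" "\<And>x. 0 \<le> G x"
    and S: "S \<in> sets borel" "S \<subseteq> A" and gS: "g ` S \<in> sets borel"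
    and eq: "\<And>x. x \<in> S \<Longrightarrow> G x = \<bar>det (matrix (g' x))\<bar> * F (g x)"
  shows "(\<integral>\<^sup>+x\<in>S. ennreal (G x) \<partial>lborel) = (\<integral>\<^sup>+y\<in>g ` S. ennreal (F y) \<partial>lborel)"
proof -
  have id: "h' y \<circ> g' (h y) = id" if y: "y \<in> B" for y
  proof -
    have x: "h y \<in> A" "g (h y) = y" using h[OF y] by auto
    have "((\<lambda>x. h (g x)) has_derivative (\<lambda>v. h' y (g' (h y) v))) (at (h y))"
      using has_derivative_compose[of g "g' (h y)" "h y" UNIV h "h' y"] dg[OF x(1)] dh[OF y] x(2) by simp
    then have "((\<lambda>x. x) has_derivative (\<lambda>v. h' y (g' (h y) v))) (at (h y))"
      by (rule has_derivative_transform_within_open[OF _ A x(1)]) (use g in auto)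
    then have "(\<lambda>v. h' y (g' (h y) v)) = (\<lambda>v. v)"
      by (rule has_derivative_unique) (rule has_derivative_ident)
    then show ?thesis by (simp add: o_def id_def)
  qed
  have iff: "(G has_integral b) S \<longleftrightarrow> (F has_integral b) (g ` S)" for b
  proof -
    have "((\<lambda>x. \<bar>det (matrix (g' x))\<bar> * F (g x)) has_integral b) S \<longleftrightarrow> (F has_integral b) (g ` S)"
    proof (rule cov_invertible_nonneg_eq[where h = h and h' = h'])
      show "(g has_derivative g' x) (at x within S)" if "x \<in> S" for x
        using dg S(2) that has_derivative_at_withinI by blast
      show "(h has_derivative h' y) (at y within g ` S)" if "y \<in> g ` S" for y
        using dh[of y] g S(2) that has_derivative_at_withinI by blast
      show "g x \<in> g ` S \<and> h (g x) = x" if "x \<in> S" for x using g S(2) that by blast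
      show "h y \<in> S \<and> g (h y) = y" if "y \<in> g ` S" for y using g h S(2) that by fastforce
      show "h' y \<circ> g' (h y) = id" if "y \<in> g ` S" for y using id g S(2) that by blast
    qed (use F in auto)
    moreover have "(G has_integral b) S \<longleftrightarrow> ((\<lambda>x. \<bar>det (matrix (g' x))\<bar> * F (g x)) has_integral b) S"
      by (rule has_integral_cong) (rule eq)
    ultimately show ?thesis by simp
  qed
  note G' = nn_integral_eq_iff_has_integral[OF S(1) G] and F' = nn_integral_eq_iff_has_integral[OF gS F]
  define a where "a = (\<integral>\<^sup>+x\<in>S. ennreal (G x) \<partial>lborel)"
  define b where "b = (\<integral>\<^sup>+y\<in>g ` S. ennreal (F y) \<partial>lborel)"
  \<comment> \<open>The equivalence for every finite value also settles the infinite case: if one of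
    the integrals is finite, so is the other.\<close>
  have key: "a = ennreal r \<longleftrightarrow> b = ennreal r" if "0 \<le> r" for r
    unfolding a_def b_def using G'[OF that] F'[OF that] iff[of r] by argo
  have "a = b"
  proof (cases a rule: ennreal_cases)
    case (real r)
    then show ?thesis using key[of r] by simp
  next
    case top
    then show ?thesis using key by (cases b rule: ennreal_cases) auto
  qed
  then show ?thesis by (simp only: a_def b_def)
qed

lemma prod_Basis_vec: "(\<Prod>b\<in>(Basis :: (real^'n::finite) set). f b) = (\<Prod>i\<in>UNIV. f (axis i 1))"
proof -
  have B: "(Basis :: (real^'n) set) = range (\<lambda>i. axis i 1)" by (auto simp: Basis_vec_def)
  have "inj (\<lambda>i. axis i (1::real) :: real^'n)" by (auto simp: inj_def axis_eq_axis)
  then show ?thesis unfolding B by (simp add: prod.reindex)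
qed

text \<open>A relabelling of coordinates carries boxes to boxes of equal volume, and the volumes of
  boxes determine Lebesgue measure.\<close>

lemma distr_lborel_reindex:
  fixes r :: "'m::finite \<Rightarrow> 'n::finite"
  assumes r: "bij r"
  shows "distr lborel borel (\<lambda>x :: real^'n. (\<chi> i. x $ r i) :: real^'m) = (lborel :: (real^'m) measure)"
proof -
  let ?R = "\<lambda>x :: real^'n. (\<chi> i. x $ r i) :: real^'m"
  let ?R' = "\<lambda>y :: real^'m. (\<chi> i. y $ inv r i) :: real^'n"
  have [measurable]: "?R \<in> borel_measurable borel"
    by (intro borel_measurable_continuous_onI continuous_intros)
  show ?thesis
  proof (rule lborel_eqI[symmetric])
    fix l u :: "real^'m" assume lu: "\<And>b. b \<in> Basis \<Longrightarrow> l \<bullet> b \<le> u \<bullet> b"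
    then have lu': "l $ i \<le> u $ i" for i
      using lu[of "axis i 1"] by (simp add: axis_in_Basis_iff inner_axis)
    have "?R -` box l u = box (?R' l) (?R' u)"
    proof -
      have "(\<forall>i. l $ i < x $ r i \<and> x $ r i < u $ i) \<longleftrightarrow> (\<forall>j. l $ inv r j < x $ j \<and> x $ j < u $ inv r j)" for x :: "real^'n"
      proof -
        have "inv r (r i) = i" "r (inv r j) = j" for i j
          using r by (simp_all add: bij_is_inj bij_is_surj surj_f_inv_f)
        then show ?thesis by metis
      qed
      then show ?thesis by (auto simp: mem_box_cart)
    qed
    moreover have "emeasure lborel (box (?R' l) (?R' u)) = (\<Prod>b\<in>Basis. (?R' u - ?R' l) \<bullet> b)"
      by (rule emeasure_lborel_box) (auto simp: Basis_vec_def inner_axis lu')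
    moreover have "(\<Prod>b\<in>Basis. (?R' u - ?R' l) \<bullet> b) = (\<Prod>b\<in>Basis. (u - l) \<bullet> b)"
      unfolding prod_Basis_vec using prod.reindex_bij_betw[OF bij_imp_bij_inv[OF r], of "\<lambda>i. u $ i - l $ i"]
      by (simp add: inner_axis)
    ultimately show "emeasure (distr lborel borel ?R) (box l u) = (\<Prod>b\<in>Basis. (u - l) \<bullet> b)"
      by (simp add: emeasure_distr)
  qed simp
qed

text \<open>All data are moved to the well-ordered copy of the index type by the linear bijection
  \<open>R\<close>. It preserves Lebesgue measure, and by \<open>det_reindex\<close> the Jacobian
  determinant.\<close>

lemma nn_integral_diffeomorphism:
  fixes g h :: "real^'n::finite \<Rightarrow> real^'n"
  assumes A: "open A" and B: "open B"
    and g: "\<And>x. x \<in> A \<Longrightarrow> g x \<in> B \<and> h (g x) = x" and h: "\<And>y. y \<in> B \<Longrightarrow> h y \<in> A \<and> g (h y) = y"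
    and dg: "\<And>x. x \<in> A \<Longrightarrow> (g has_derivative g' x) (at x)"
    and dh: "\<And>y. y \<in> B \<Longrightarrow> (h has_derivative h' y) (at y)"
    and F: "F \<in> borel_measurable borel" "\<And>y. 0 \<le> F y"
    and G: "G \<in> borel_measurable borel" "\<And>x. 0 \<le> G x"
    and S: "S \<in> sets borel" "S \<subseteq> A" and gS: "g ` S \<in> sets borel"
    and eq: "\<And>x. x \<in> S \<Longrightarrow> G x = \<bar>det (matrix (g' x))\<bar> * F (g x)"
  shows "(\<integral>\<^sup>+x\<in>S. ennreal (G x) \<partial>lborel) = (\<integral>\<^sup>+y\<in>g ` S. ennreal (F y) \<partial>lborel)"
proof -
  define r :: "'n windex \<Rightarrow> 'n" where "r = windex_rep"
  have r: "bij r" by (simp add: r_def bij_windex_rep)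
  define R :: "real^'n \<Rightarrow> real^'n windex" where "R = (\<lambda>x. \<chi> i. x $ r i)"
  define R' :: "real^'n windex \<Rightarrow> real^'n" where "R' = (\<lambda>y. \<chi> i. y $ inv r i)"
  have RR' [simp]: "R (R' y) = y" "R' (R x) = x" for x y
    using r by (simp_all add: R_def R'_def vec_eq_iff bij_is_inj bij_is_surj surj_f_inv_f)
  have lin: "linear R" "linear R'" by (auto intro!: linearI simp: R_def R'_def vec_eq_iff)
  then have bl: "bounded_linear R" "bounded_linear R'" by (simp_all add: linear_conv_bounded_linear)
  have cont: "continuous_on X R" "continuous_on Y R'" for X Y
    using bl by (simp_all add: linear_continuous_on)
  have [measurable]: "R \<in> borel_measurable borel" "R' \<in> borel_measurable borel"
    using cont by (auto intro: borel_measurable_continuous_onI)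
  have img: "R ` X = R' -` X" for X 
  proof
    show "R' -` X \<subseteq> R ` X"
    proof
      fix y assume "y \<in> R' -` X"
      then have "R (R' y) \<in> R ` X" by blast
      then show "y \<in> R ` X" by simp
    qed
  qed auto
  have tr: "(\<integral>\<^sup>+x\<in>X. ennreal (f x) \<partial>lborel) = (\<integral>\<^sup>+y\<in>R ` X. ennreal (f (R' y)) \<partial>lborel)"
    if [measurable]: "X \<in> sets borel" "f \<in> borel_measurable borel" for X and f :: "real^'n \<Rightarrow> real"
  proof -
    have [measurable]: "R' -` X \<in> sets borel" using measurable_sets_borel[of R' borel X] by simp
    have "(\<integral>\<^sup>+y\<in>R ` X. ennreal (f (R' y)) \<partial>lborel)
      = (\<integral>\<^sup>+y. ennreal (f (R' y)) * indicator (R' -` X) y \<partial>distr lborel borel R)"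
      using distr_lborel_reindex[OF r] by (simp add: R_def[symmetric] img)
    also have "\<dots> = (\<integral>\<^sup>+x. ennreal (f (R' (R x))) * indicator (R' -` X) (R x) \<partial>lborel)"
      by (rule nn_integral_distr) auto
    also have "\<dots> = (\<integral>\<^sup>+x\<in>X. ennreal (f x) \<partial>lborel)" by (simp add: indicator_def)
    finally show ?thesis by simp
  qed
  let ?g = "\<lambda>y. R (g (R' y))" and ?h = "\<lambda>y. R (h (R' y))"
  have "(\<integral>\<^sup>+y\<in>R ` S. ennreal (G (R' y)) \<partial>lborel) = (\<integral>\<^sup>+z\<in>?g ` (R ` S). ennreal (F (R' z)) \<partial>lborel)"
  proof (rule nn_integral_diffeomorphism_wellorder[where A = "R ` A" and B = "R ` B" and h = ?h
        and g' = "\<lambda>y v. R (g' (R' y) (R' v))" and h' = "\<lambda>y v. R (h' (R' y) (R' v))"])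
    show "open (R ` A)" "open (R ` B)"
      unfolding img using A B cont by (auto intro: continuous_imp_open_vimage)
    show "(?g has_derivative (\<lambda>v. R (g' (R' y) (R' v)))) (at y)" if "y \<in> R ` A" for y
      using that dg
      by (intro bounded_linear.has_derivative[OF bl(1)] has_derivative_compose[OF bounded_linear_imp_has_derivative[OF bl(2)]])
         auto
    show "(?h has_derivative (\<lambda>v. R (h' (R' y) (R' v)))) (at y)" if "y \<in> R ` B" for y
      using that dh
      by (intro bounded_linear.has_derivative[OF bl(1)] has_derivative_compose[OF bounded_linear_imp_has_derivative[OF bl(2)]])
         auto
    show "(\<lambda>y. F (R' y)) \<in> borel_measurable borel" "(\<lambda>y. G (R' y)) \<in> borel_measurable borel"
      using F(1) G(1) by measurable
    show "R ` S \<in> sets borel" using S(1) measurable_sets_borel[of R' borel S] by (simp add: img)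
    have "?g ` (R ` S) = R ` (g ` S)" by (auto simp: image_image)
    then show "?g ` (R ` S) \<in> sets borel" using gS measurable_sets_borel[of R' borel "g ` S"] by (simp add: img)
    show "G (R' y) = \<bar>det (matrix (\<lambda>v. R (g' (R' y) (R' v))))\<bar> * F (R' (?g y))" if y: "y \<in> R ` S" for y
    proof -
      obtain x where x: "x \<in> S" "y = R x" using y by blast
      have "R' (axis j 1) = axis (r j) 1" for j
      proof -
        have "inv r i = j \<longleftrightarrow> i = r j" for i using bij_inv_eq_iff[OF r, of j i] by auto
        then show ?thesis by (simp add: R'_def vec_eq_iff axis_def)
      qed
      then have "matrix (\<lambda>v. R (g' x (R' v))) = (\<chi> i j. matrix (g' x) $ r i $ r j)"
        by (simp add: matrix_def R_def)
      then have "det (matrix (\<lambda>v. R (g' x (R' v)))) = det (matrix (g' x))"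
        using det_reindex[OF r] by simp
      then show ?thesis using eq[OF x(1)] x by simp
    qed
  qed (use F G S g h in auto)
  moreover have "?g ` (R ` S) = R ` (g ` S)" by (auto simp: image_image)
  ultimately show ?thesis using tr[OF S(1) G(1)] tr[OF gS F(1)] by simp
qed

section \<open>The area measure\<close>

abbreviation vol :: "(real^'n::finite \<Rightarrow> complex^'n) \<Rightarrow> real^'n \<Rightarrow> real" where
  "vol \<phi> x \<equiv> sqrt (det (gram_matrix \<phi> x))"

text \<open>The value zero outside U makes the density Borel on the whole space, as nothing is known
  about the chart there.\<close>

definition chart_density :: "(real^'n::finite \<Rightarrow> complex^'n) \<Rightarrow> (real^'n) set \<Rightarrow> real^'n \<Rightarrow> real" where
  "chart_density \<phi> U x = (if x \<in> U then vol \<phi> x else 0)"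

lemma det_gram_matrix_pos:
  assumes "local_param \<Sigma> U \<phi>" "x \<in> U"
  shows "det (gram_matrix \<phi> x) > 0"
  unfolding gram_matrix_eq_gram by (rule det_gram_pos[OF local_param_linear[OF assms] local_param_inj[OF assms]])

lemma Ck_on_det_gram_matrix:
  assumes lp: "local_param \<Sigma> U \<phi>"
  shows "Ck_on k U (\<lambda>x. det (gram_matrix \<phi> x))"
proof -
  have D: "Ck_on k U (\<lambda>x. der \<phi> x v)" for v
    using local_param_Ck[OF lp, of "Suc k"] by simp
  show ?thesis
  proof (rule Ck_on_det[OF local_param_open[OF lp]])
    show "Ck_on k U (\<lambda>x. gram_matrix \<phi> x $ i $ j)" for i j
      unfolding gram_matrix_def using Ck_on_inner[OF local_param_open[OF lp] D D] by simp
  qed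
qed

lemma chart_density_nonneg:
  assumes "local_param \<Sigma> U \<phi>"
  shows "0 \<le> chart_density \<phi> U x"
  using det_gram_matrix_pos[OF assms, of x] by (simp add: chart_density_def less_imp_le)

lemma chart_density_measurable:
  assumes lp: "local_param \<Sigma> U \<phi>"
  shows "chart_density \<phi> U \<in> borel_measurable borel"
proof -
  have "continuous_on U (\<lambda>x. vol \<phi> x)"
    by (intro continuous_on_real_sqrt Ck_on_imp_continuous[OF Ck_on_det_gram_matrix[OF lp]])
  then have "(\<lambda>x. indicator U x *\<^sub>R vol \<phi> x) \<in> borel_measurable borel"
    using local_param_open[OF lp] by (intro borel_measurable_continuous_on_indicator) auto
  moreover have "(\<lambda>x. indicator U x *\<^sub>R vol \<phi> x) = chart_density \<phi> U"
    by (auto simp: chart_density_def indicator_def)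
  ultimately show ?thesis by simp
qed

lemma local_param_vimage_borel:
  assumes lp: "local_param \<Sigma> U \<phi>" and S: "S \<in> sets (restrict_space borel \<Sigma>)"
  shows "U \<inter> \<phi> -` S \<in> sets borel"
proof -
  obtain S0 where S0: "S0 \<in> sets borel" "S = \<Sigma> \<inter> S0" using S by (auto simp: sets_restrict_space)
  have U: "U \<in> sets borel" using local_param_open[OF lp] by simp
  have "\<phi> \<in> borel_measurable (restrict_space borel U)"
    by (rule borel_measurable_continuous_on_restrict[OF local_param_continuous[OF lp]])
  from measurable_sets[OF this S0(1)] have "\<phi> -` S0 \<inter> U \<in> sets borel"
    using U by (simp add: space_restrict_space sets_restrict_space_iff)
  moreover have "\<phi> -` S0 \<inter> U = U \<inter> \<phi> -` S" using S0 local_param_mem[OF lp] by auto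
  ultimately show ?thesis by simp
qed

lemma local_param_measurable:
  assumes lp: "local_param \<Sigma> U \<phi>"
  shows "\<phi> \<in> restrict_space lborel U \<rightarrow>\<^sub>M restrict_space borel \<Sigma>"
proof (rule measurableI)
  show "\<phi> x \<in> space (restrict_space borel \<Sigma>)" if "x \<in> space (restrict_space lborel U)" for x
    using that local_param_mem[OF lp] by (simp add: space_restrict_space)
  show "\<phi> -` S \<inter> space (restrict_space lborel U) \<in> sets (restrict_space lborel U)"
    if "S \<in> sets (restrict_space borel \<Sigma>)" for S
    using local_param_vimage_borel[OF lp that] local_param_open[OF lp]
    by (simp add: space_restrict_space sets_restrict_space_iff Int_commute)
qed

text \<open>The image of B is a preimage under the continuous inverse chart, hence Borel in the
  chart image, and the chart image is relatively open.\<close>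

lemma local_param_image_borel:
  assumes lp: "local_param \<Sigma> U \<phi>" and B: "B \<in> sets borel" "B \<subseteq> U"
  shows "\<phi> ` B \<in> sets (restrict_space borel \<Sigma>)"
proof -
  obtain \<psi> where \<psi>: "continuous_on (\<phi> ` U) \<psi>" "\<And>x. x \<in> U \<Longrightarrow> \<psi> (\<phi> x) = x"
    using local_param_inverse[OF lp] by metis
  obtain W where W: "open W" "\<phi> ` U = \<Sigma> \<inter> W"
    using lp by (auto simp: local_param_def openin_open)
  have "\<psi> \<in> borel_measurable (restrict_space borel (\<phi> ` U))"
    by (rule borel_measurable_continuous_on_restrict[OF \<psi>(1)])
  from measurable_sets[OF this B(1)] obtain S where S: "S \<in> sets borel" "\<psi> -` B \<inter> \<phi> ` U = \<phi> ` U \<inter> S"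
    by (auto simp: space_restrict_space sets_restrict_space)
  have "\<psi> -` B \<inter> \<phi> ` U = \<phi> ` B" using \<psi>(2) B(2) by force
  then have "\<phi> ` B = \<Sigma> \<inter> (W \<inter> S)" using S(2) W(2) by auto
  then show ?thesis using S(1) W(1) by (auto simp: sets_restrict_space)
qed

text \<open>The push-forward lives on the Borel sets of the whole submanifold, so that different
  charts give measures on one sigma-algebra.\<close>

definition chart_measure ::
    "(complex^'n::finite) set \<Rightarrow> (real^'n) set \<Rightarrow> (real^'n \<Rightarrow> complex^'n) \<Rightarrow> (complex^'n) measure" where
  "chart_measure \<Sigma> U \<phi> =
    distr (density (restrict_space lborel U) (\<lambda>x. ennreal (chart_density \<phi> U x))) (restrict_space borel \<Sigma>) \<phi>"

lemma sets_chart_measure: "sets (chart_measure \<Sigma> U \<phi>) = sets (restrict_space borel \<Sigma>)"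
  by (simp add: chart_measure_def)

lemma emeasure_chart_measure:
  assumes lp: "local_param \<Sigma> U \<phi>" and S: "S \<in> sets (restrict_space borel \<Sigma>)"
  shows "emeasure (chart_measure \<Sigma> U \<phi>) S = (\<integral>\<^sup>+x\<in>U \<inter> \<phi> -` S. ennreal (chart_density \<phi> U x) \<partial>lborel)"
proof -
  let ?d = "\<lambda>x. ennreal (chart_density \<phi> U x)"
  have U: "U \<in> sets lborel" using local_param_open[OF lp] by simp
  have d: "?d \<in> borel_measurable (restrict_space lborel U)"
    using chart_density_measurable[OF lp] by (intro measurable_restrict_space1) simp
  have "\<phi> -` S \<inter> U \<in> sets (restrict_space lborel U)"
    using local_param_vimage_borel[OF lp S] U by (simp add: sets_restrict_space_iff Int_commute)
  then have "emeasure (chart_measure \<Sigma> U \<phi>) S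
      = (\<integral>\<^sup>+x. ?d x * indicator (\<phi> -` S \<inter> U) x \<partial>restrict_space lborel U)"
    unfolding chart_measure_def
    using S local_param_measurable[OF lp] d
    by (subst emeasure_distr) (auto simp: emeasure_density space_restrict_space)
  also have "\<dots> = (\<integral>\<^sup>+x. ?d x * indicator (\<phi> -` S \<inter> U) x * indicator U x \<partial>lborel)"
    using U by (subst nn_integral_restrict_space) auto
  also have "\<dots> = (\<integral>\<^sup>+x\<in>U \<inter> \<phi> -` S. ?d x \<partial>lborel)"
    by (intro nn_integral_cong) (auto simp: indicator_def)
  finally show ?thesis .
qed

text \<open>On the overlap the transition map is a diffeomorphism of open sets. The Gram determinant
  changes by the square of its Jacobian determinant, hence the density by the absolute value, as the
  change of variables demands.\<close>

lemma chart_measure_eq: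
  assumes lp: "local_param \<Sigma> U \<phi>" and lp': "local_param \<Sigma> V \<rho>"
    and S: "S \<in> sets (restrict_space borel \<Sigma>)" "S \<subseteq> \<phi> ` U" "S \<subseteq> \<rho> ` V"
  shows "emeasure (chart_measure \<Sigma> V \<rho>) S = emeasure (chart_measure \<Sigma> U \<phi>) S"
proof -
  obtain \<psi> where \<psi>: "continuous_on (\<phi> ` U) \<psi>" "\<And>x. x \<in> U \<Longrightarrow> \<psi> (\<phi> x) = x"
    using local_param_inverse[OF lp] by metis
  obtain \<psi>' where \<psi>': "continuous_on (\<rho> ` V) \<psi>'" "\<And>x. x \<in> V \<Longrightarrow> \<psi>' (\<rho> x) = x"
    using local_param_inverse[OF lp'] by metis
  obtain W where W: "open W" "\<phi> ` U = \<Sigma> \<inter> W"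
    using lp by (auto simp: local_param_def openin_open)
  obtain W' where W': "open W'" "\<rho> ` V = \<Sigma> \<inter> W'"
    using lp' by (auto simp: local_param_def openin_open)
  \<comment> \<open>\<open>A\<close> and \<open>B\<close> are the parameter domains of the overlap
    in the two charts.\<close>
  define A where "A = V \<inter> \<rho> -` W"
  define B where "B = U \<inter> \<phi> -` W'"
  define g where "g y = \<psi> (\<rho> y)" for y
  define h where "h x = \<psi>' (\<phi> x)" for x
  have open_A: "open A" and open_B: "open B"
    unfolding A_def B_def
    using continuous_open_preimage[OF local_param_continuous[OF lp'] local_param_open[OF lp'] W(1)]
      continuous_open_preimage[OF local_param_continuous[OF lp] local_param_open[OF lp] W'(1)] by auto
  have A: "y \<in> V" "\<rho> y \<in> \<phi> ` U" if "y \<in> A" for y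
    using that W(2) local_param_mem[OF lp'] by (auto simp: A_def)
  have B: "x \<in> U" "\<phi> x \<in> \<rho> ` V" if "x \<in> B" for x
    using that W'(2) local_param_mem[OF lp] by (auto simp: B_def)
  have g: "g y \<in> B \<and> h (g y) = y" if yA: "y \<in> A" for y
  proof -
    obtain x where x: "x \<in> U" "\<rho> y = \<phi> x" using A(2)[OF yA] by blast
    have "\<rho> y \<in> W'" using A(1)[OF yA] W'(2) by blast
    then show ?thesis using x \<psi>(2)[OF x(1)] \<psi>'(2)[OF A(1)[OF yA]] by (simp add: g_def h_def B_def)
  qed
  have h: "h x \<in> A \<and> g (h x) = x" if xB: "x \<in> B" for x
  proof -
    obtain y where y: "y \<in> V" "\<phi> x = \<rho> y" using B(2)[OF xB] by blast
    have "\<phi> x \<in> W" using B(1)[OF xB] W(2) by blast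
    then show ?thesis using y \<psi>'(2)[OF y(1)] \<psi>(2)[OF B(1)[OF xB]] by (simp add: g_def h_def A_def)
  qed
  have dg: "(g has_derivative der g y) (at y) \<and>
      der \<rho> y = (\<lambda>v. der \<phi> (g y) (der g y v))"
    if y: "y \<in> A" for y
  proof -
    obtain t where t: "((\<lambda>z. \<psi> (\<rho> z)) has_derivative t) (at y)"
      "der \<rho> y = (\<lambda>h. der \<phi> (\<psi> (\<rho> y)) (t h))"
      using local_param_transition[OF lp lp' A[OF y] \<psi>] .
    have "(g has_derivative t) (at y)" using t(1) by (simp add: g_def[abs_def])
    moreover from frechet_derivative_at[OF this] have "der g y = t" by simp
    ultimately show ?thesis using t(2) by (simp add: g_def)
  qed
  have dh: "(h has_derivative der h x) (at x)" if x: "x \<in> B" for x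
  proof -
    obtain t where t: "((\<lambda>z. \<psi>' (\<phi> z)) has_derivative t) (at x)"
      "der \<phi> x = (\<lambda>h. der \<rho> (\<psi>' (\<phi> x)) (t h))"
      using local_param_transition[OF lp' lp B[OF x] \<psi>'] .
    have "(h has_derivative t) (at x)" using t(1) by (simp add: h_def[abs_def])
    moreover from frechet_derivative_at[OF this] have "der h x = t" by simp
    ultimately show ?thesis by simp
  qed
  have img: "g ` (V \<inter> \<rho> -` S) = U \<inter> \<phi> -` S"
  proof
    show "g ` (V \<inter> \<rho> -` S) \<subseteq> U \<inter> \<phi> -` S" using S(2) \<psi>(2) by (auto simp: g_def)
    show "U \<inter> \<phi> -` S \<subseteq> g ` (V \<inter> \<rho> -` S)"
    proof
      fix x assume x: "x \<in> U \<inter> \<phi> -` S"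
      then obtain y where y: "y \<in> V" "\<phi> x = \<rho> y" using S(3) by blast
      then have "g y = x" using x \<psi>(2)[of x] by (simp add: g_def)
      moreover have "y \<in> V \<inter> \<rho> -` S" using x y by auto
      ultimately show "x \<in> g ` (V \<inter> \<rho> -` S)" by blast
    qed
  qed
  have SA: "V \<inter> \<rho> -` S \<subseteq> A" using S(2) W(2) by (auto simp: A_def)
  have "(\<integral>\<^sup>+y\<in>V \<inter> \<rho> -` S. ennreal (chart_density \<rho> V y) \<partial>lborel)
      = (\<integral>\<^sup>+x\<in>g ` (V \<inter> \<rho> -` S). ennreal (chart_density \<phi> U x) \<partial>lborel)"
  proof (rule nn_integral_diffeomorphism[OF open_A open_B g h _ dh])
    show "(g has_derivative der g y) (at y)" if "y \<in> A" for y using dg[OF that] by simp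
    show "V \<inter> \<rho> -` S \<in> sets borel" "g ` (V \<inter> \<rho> -` S) \<in> sets borel"
      unfolding img by (rule local_param_vimage_borel[OF lp' S(1)] local_param_vimage_borel[OF lp S(1)])+
    show "chart_density \<rho> V y = \<bar>det (matrix (der g y))\<bar> * chart_density \<phi> U (g y)"
      if y: "y \<in> V \<inter> \<rho> -` S" for y
    proof -
      have yA: "y \<in> A" using y SA by blast
      have gy: "g y \<in> U" using g[OF yA] B(1) by blast
      have "det (gram_matrix \<rho> y) = (det (matrix (der g y)))\<^sup>2 * det (gram_matrix \<phi> (g y))"
        unfolding gram_matrix_eq_gram conjunct2[OF dg[OF yA]]
        by (rule det_gram_compose[OF local_param_linear[OF lp gy] has_derivative_linear[OF conjunct1[OF dg[OF yA]]]])
      then show ?thesis using y gy by (simp add: chart_density_def real_sqrt_mult)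
    qed
  qed (rule chart_density_measurable[OF lp] chart_density_measurable[OF lp'] chart_density_nonneg[OF lp]
      chart_density_nonneg[OF lp'] SA | assumption)+
  then show ?thesis using emeasure_chart_measure[OF lp S(1)] emeasure_chart_measure[OF lp' S(1)] img by simp
qed

section \<open>Countable atlases, existence and uniqueness of the area measure\<close>

lemma submanifold_countable_local_params:
  fixes \<Sigma> :: "(complex^'n::finite) set"
  assumes "submanifold \<Sigma>"
  obtains U :: "nat \<Rightarrow> (real^'n) set" and \<phi> :: "nat \<Rightarrow> real^'n \<Rightarrow> complex^'n"
    where "\<forall>n. local_param \<Sigma> (U n) (\<phi> n)" "(\<Union>n. \<phi> n ` U n) = \<Sigma>"
proof -
  define \<F> where "\<F> = {S. \<exists>U \<phi>. local_param \<Sigma> U \<phi> \<and> S = \<phi> ` U}"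
  have op: "openin (top_of_set \<Sigma>) S" if "S \<in> \<F>" for S
    using that by (auto simp: \<F>_def local_param_def)
  obtain F where F: "F \<subseteq> \<F>" "countable F" "\<Union>F = \<Union>\<F>"
    using Lindelof_openin[where U = \<Sigma> and \<F> = \<F>] op by blast
  have cover: "\<Union>\<F> = \<Sigma>"
  proof
    show "\<Union>\<F> \<subseteq> \<Sigma>"
    proof (rule Union_least)
      fix S assume "S \<in> \<F>"
      then obtain U \<phi> where "local_param \<Sigma> U \<phi>" "S = \<phi> ` U" by (auto simp: \<F>_def)
      then show "S \<subseteq> \<Sigma>" using local_param_image_subset by simp
    qed
    show "\<Sigma> \<subseteq> \<Union>\<F>"
    proof
      fix p assume "p \<in> \<Sigma>"
      then obtain U \<phi> where "local_param \<Sigma> U \<phi>" "p \<in> \<phi> ` U"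
        using assms unfolding submanifold_def by blast
      moreover from this(1) have "\<phi> ` U \<in> \<F>"
        unfolding \<F>_def by (intro CollectI exI[of _ U] exI[of _ \<phi>]) simp
      ultimately show "p \<in> \<Union>\<F>" by (intro UnionI[of "\<phi> ` U"])
    qed
  qed
  \<comment> \<open>The empty chart keeps the family nonempty, so that it can be enumerated by all
    natural numbers even if the submanifold is empty.\<close>
  have "local_param \<Sigma> {} (\<lambda>_. 0)"
    by (simp add: local_param_def smooth_on_def homeomorphism_def Ck_on_const)
  then have "{} \<in> \<F>"
    unfolding \<F>_def by (intro CollectI exI[of _ "{}"] exI[of _ "\<lambda>_. 0"]) simp
  then have F': "insert {} F \<subseteq> \<F>" "countable (insert {} F)" "\<Union>(insert {} F) = \<Sigma>"
    using F cover by simp_all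
  define S where "S = from_nat_into (insert {} F)"
  have "\<exists>c. local_param \<Sigma> (fst c) (snd c) \<and> S n = snd c ` fst c" for n
  proof -
    have "S n \<in> insert {} F" unfolding S_def by (rule from_nat_into) simp
    then have "S n \<in> \<F>" using F'(1) by (rule rev_subsetD)
    then obtain U \<phi> where "local_param \<Sigma> U \<phi>" "S n = \<phi> ` U" by (auto simp: \<F>_def)
    then show ?thesis by (intro exI[of _ "(U, \<phi>)"]) simp
  qed
  then have **: "local_param \<Sigma> (fst (c n)) (snd (c n)) \<and> S n = snd (c n) ` fst (c n)"
    if "c = (\<lambda>n. SOME c. local_param \<Sigma> (fst c) (snd c) \<and> S n = snd c ` fst c)" for c n
    unfolding that by (rule someI_ex)
  define c where "c = (\<lambda>n. SOME c. local_param \<Sigma> (fst c) (snd c) \<and> S n = snd c ` fst c)"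
  define U where "U n = fst (c n)" for n
  define \<phi> where "\<phi> n = snd (c n)" for n
  have *: "local_param \<Sigma> (U n) (\<phi> n)" "S n = \<phi> n ` U n" for n
    using **[OF c_def, of n] by (simp_all add: U_def \<phi>_def)
  have "range (\<lambda>n. \<phi> n ` U n) = range S"
    by (rule image_cong[OF refl]) (rule *(2)[symmetric])
  also have "range S = insert {} F"
    unfolding S_def using F'(2) by (intro range_from_nat_into) simp_all
  finally have "(\<Union>n. \<phi> n ` U n) = \<Sigma>" using F'(3) by simp
  then show thesis by (rule that[OF allI[OF *(1)]])
qed

definition is_area_measure :: "(complex^'n::finite) set \<Rightarrow> (complex^'n) measure \<Rightarrow> bool" where
  "is_area_measure \<Sigma> \<mu> \<longleftrightarrow> sets \<mu> = sets (restrict_space borel \<Sigma>) \<and>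
     (\<forall>U \<phi> B. local_param \<Sigma> U \<phi> \<and> B \<in> sets borel \<and> B \<subseteq> U \<longrightarrow>
        emeasure \<mu> (\<phi> ` B) = (\<integral>\<^sup>+x\<in>B. ennreal (vol \<phi> x) \<partial>lborel))"

lemma local_param_vimage_image:
  assumes "local_param \<Sigma> U \<phi>" "B \<subseteq> U"
  shows "U \<inter> \<phi> -` (\<phi> ` B) = B"
  using local_param_inj_on[OF assms(1)] assms(2) by (auto simp: inj_on_def)

text \<open>A chart matches Borel subsets of its domain with Borel subsets of its image. Stated on
  the image, the condition can be compared between charts by
  \<open>chart_measure_eq\<close>.\<close>

lemma is_area_measure_iff:
  "is_area_measure \<Sigma> \<mu> \<longleftrightarrow> sets \<mu> = sets (restrict_space borel \<Sigma>) \<and>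
     (\<forall>U \<phi> S. local_param \<Sigma> U \<phi> \<and> S \<in> sets (restrict_space borel \<Sigma>) \<and> S \<subseteq> \<phi> ` U \<longrightarrow>
        emeasure \<mu> S = emeasure (chart_measure \<Sigma> U \<phi>) S)" (is "?l \<longleftrightarrow> ?r")
proof -
  have cm: "emeasure (chart_measure \<Sigma> U \<phi>) (\<phi> ` B) = (\<integral>\<^sup>+x\<in>B. ennreal (vol \<phi> x) \<partial>lborel)"
    if "local_param \<Sigma> U \<phi>" "B \<in> sets borel" "B \<subseteq> U" for U \<phi> B
    unfolding emeasure_chart_measure[OF that(1) local_param_image_borel[OF that]] local_param_vimage_image[OF that(1,3)]
    using that(3) by (intro nn_integral_cong) (auto simp: chart_density_def indicator_def)
  show ?thesis
  proof
    assume l: ?l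
    have "emeasure \<mu> S = emeasure (chart_measure \<Sigma> U \<phi>) S"
      if lp: "local_param \<Sigma> U \<phi>" and S: "S \<in> sets (restrict_space borel \<Sigma>)" "S \<subseteq> \<phi> ` U" for U \<phi> S
    proof -
      define B where "B = U \<inter> \<phi> -` S"
      have B: "B \<in> sets borel" "B \<subseteq> U" "S = \<phi> ` B"
        using S(2) local_param_vimage_borel[OF lp S(1)] by (auto simp: B_def)
      show ?thesis
        unfolding B(3) cm[OF lp B(1,2)] using l lp B(1,2) by (simp only: is_area_measure_def)
    qed
    then show ?r using l unfolding is_area_measure_def by blast
  next
    assume r: ?r
    show ?l
      unfolding is_area_measure_def
    proof (intro conjI allI impI)
      fix U \<phi> B assume "local_param \<Sigma> U \<phi> \<and> B \<in> sets borel \<and> B \<subseteq> U"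
      then have *: "local_param \<Sigma> U \<phi>" "B \<in> sets borel" "B \<subseteq> U" by auto
      show "emeasure \<mu> (\<phi> ` B) = (\<integral>\<^sup>+x\<in>B. ennreal (vol \<phi> x) \<partial>lborel)"
        unfolding cm[OF *, symmetric]
        using r *(1) local_param_image_borel[OF *] image_mono[OF *(3), of \<phi>] by blast
    qed (use r in simp)
  qed
qed

text \<open>Charts overlap, so a Borel set is cut into disjoint Borel pieces, each inside one chart
  image.\<close>

lemma disjointed_local_params:
  assumes "\<And>n. local_param \<Sigma> (U n) (\<phi> n)" "S \<in> sets (restrict_space borel \<Sigma>)"
  shows "S \<inter> disjointed (\<lambda>n. \<phi> n ` U n) n \<in> sets (restrict_space borel \<Sigma>)"
    and "S \<inter> disjointed (\<lambda>n. \<phi> n ` U n) n \<subseteq> \<phi> n ` U n"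
proof -
  have "range (\<lambda>n. \<phi> n ` U n) \<subseteq> sets (restrict_space borel \<Sigma>)"
    using local_param_image_borel[OF assms(1)] local_param_open[OF assms(1)] by auto
  from sets.range_disjointed_sets[OF this] assms(2)
  show "S \<inter> disjointed (\<lambda>n. \<phi> n ` U n) n \<in> sets (restrict_space borel \<Sigma>)" by auto
  show "S \<inter> disjointed (\<lambda>n. \<phi> n ` U n) n \<subseteq> \<phi> n ` U n"
    using disjointed_subset[of "\<lambda>n. \<phi> n ` U n" n] by blast
qed

lemma suminf_disjointed_local_params:
  assumes lp: "\<And>n. local_param \<Sigma> (U n) (\<phi> n)" and cover: "(\<Union>n. \<phi> n ` U n) = \<Sigma>"
    and S: "S \<in> sets (restrict_space borel \<Sigma>)" and \<mu>: "sets \<mu> = sets (restrict_space borel \<Sigma>)"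
  shows "(\<Sum>n. emeasure \<mu> (S \<inter> disjointed (\<lambda>n. \<phi> n ` U n) n)) = emeasure \<mu> S"
proof -
  let ?A = "disjointed (\<lambda>n. \<phi> n ` U n)"
  have "(\<Sum>n. emeasure \<mu> (S \<inter> ?A n)) = emeasure \<mu> (\<Union>n. S \<inter> ?A n)"
  proof (rule suminf_emeasure)
    show "range (\<lambda>n. S \<inter> ?A n) \<subseteq> sets \<mu>"
      using disjointed_local_params(1)[where U = U and \<phi> = \<phi>, OF lp S] \<mu> by auto
    show "disjoint_family (\<lambda>n. S \<inter> ?A n)"
      using disjoint_family_disjointed[of "\<lambda>n. \<phi> n ` U n"] by (fastforce simp: disjoint_family_on_def)
  qed
  moreover have "(\<Union>n. S \<inter> ?A n) = S"
  proof -
    have "S \<subseteq> \<Sigma>" using S by (auto simp: sets_restrict_space)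
    then show ?thesis using UN_disjointed_eq[of "\<lambda>n. \<phi> n ` U n"] cover by auto
  qed
  ultimately show ?thesis by simp
qed

text \<open>The values on pieces inside single charts are prescribed, and countable additivity
  recovers all others.\<close>

lemma is_area_measure_unique:
  fixes \<Sigma> :: "(complex^'n::finite) set"
  assumes "submanifold \<Sigma>" and \<mu>: "is_area_measure \<Sigma> \<mu>" and \<nu>: "is_area_measure \<Sigma> \<nu>"
  shows "\<mu> = \<nu>"
proof -
  obtain U :: "nat \<Rightarrow> (real^'n) set" and \<phi> :: "nat \<Rightarrow> real^'n \<Rightarrow> complex^'n"
    where "\<forall>n. local_param \<Sigma> (U n) (\<phi> n)" and cover: "(\<Union>n. \<phi> n ` U n) = \<Sigma>"
    using submanifold_countable_local_params[OF assms(1)] .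
  then have lp: "local_param \<Sigma> (U n) (\<phi> n)" for n by blast
  let ?A = "disjointed (\<lambda>n. \<phi> n ` U n)"
  have sets: "sets \<mu> = sets (restrict_space borel \<Sigma>)" "sets \<nu> = sets (restrict_space borel \<Sigma>)"
    using \<mu> \<nu> by (simp_all add: is_area_measure_def)
  show ?thesis
  proof (rule measure_eqI)
    fix S assume "S \<in> sets \<mu>"
    then have S: "S \<in> sets (restrict_space borel \<Sigma>)" using sets by simp
    have "emeasure m (S \<inter> ?A n)
        = emeasure (chart_measure \<Sigma> (U n) (\<phi> n)) (S \<inter> ?A n)"
      if "is_area_measure \<Sigma> m" for m n
      using that lp[of n] disjointed_local_params[where U = U and \<phi> = \<phi>, OF lp S, of n]
      unfolding is_area_measure_iff by blast
    from this[OF \<mu>] this[OF \<nu>] show "emeasure \<mu> S = emeasure \<nu> S"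
      using suminf_disjointed_local_params[where U = U and \<phi> = \<phi>, OF lp cover S sets(1)] suminf_disjointed_local_params[where U = U and \<phi> = \<phi>, OF lp cover S sets(2)]
      by simp
  qed (use sets in simp)
qed

text \<open>The chart measures of a countable atlas are glued along disjoint pieces. An arbitrary
  further chart is compared with the atlas piece by piece through
  \<open>chart_measure_eq\<close>.\<close>

lemma is_area_measure_exists:
  fixes \<Sigma> :: "(complex^'n::finite) set"
  assumes "submanifold \<Sigma>"
  shows "\<exists>\<mu>. is_area_measure \<Sigma> \<mu>"
proof -
  obtain U :: "nat \<Rightarrow> (real^'n) set" and \<phi> :: "nat \<Rightarrow> real^'n \<Rightarrow> complex^'n"
    where "\<forall>n. local_param \<Sigma> (U n) (\<phi> n)" and cover: "(\<Union>n. \<phi> n ` U n) = \<Sigma>"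
    using submanifold_countable_local_params[OF assms] .
  then have lp: "local_param \<Sigma> (U n) (\<phi> n)" for n by blast
  let ?A = "disjointed (\<lambda>n. \<phi> n ` U n)" and ?R = "restrict_space borel \<Sigma>"
  let ?c = "\<lambda>n. chart_measure \<Sigma> (U n) (\<phi> n)"
  \<comment> \<open>Written as an integral for counting measure, the sum over charts can be
    exchanged with the series of countable additivity by \<open>nn_integral_suminf\<close>.\<close>
  define m where "m S = (\<integral>\<^sup>+n. emeasure (?c n) (S \<inter> ?A n) \<partial>count_space UNIV)" for S
  define \<mu> where "\<mu> = measure_of (space ?R) (sets ?R) m"
  have sets: "sets \<mu> = sets ?R" unfolding \<mu>_def by simp
  have emeasure: "emeasure \<mu> S = m S" if S: "S \<in> sets ?R" for S
    unfolding \<mu>_def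
  proof (rule emeasure_measure_of_sigma[OF sets.sigma_algebra_axioms _ _ S])
    show "positive (sets ?R) m" by (simp add: positive_def m_def)
    show "countably_additive (sets ?R) m"
      unfolding countably_additive_def
    proof (intro allI impI)
      fix F :: "nat \<Rightarrow> _" assume F: "range F \<subseteq> sets ?R" "disjoint_family F" "\<Union>(range F) \<in> sets ?R"
      have additive: "(\<Sum>i. emeasure (?c n) (F i \<inter> ?A n)) = emeasure (?c n) (\<Union>(range F) \<inter> ?A n)" for n
      proof -
        have "(\<Sum>i. emeasure (?c n) (F i \<inter> ?A n)) = emeasure (?c n) (\<Union>i. F i \<inter> ?A n)"
        proof (rule suminf_emeasure)
          show "range (\<lambda>i. F i \<inter> ?A n) \<subseteq> sets (?c n)"
            using F(1) disjointed_local_params(1)[where U = U and \<phi> = \<phi>, OF lp] by (auto simp: sets_chart_measure)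
          show "disjoint_family (\<lambda>i. F i \<inter> ?A n)" using F(2) by (fastforce simp: disjoint_family_on_def)
        qed
        then show ?thesis by simp
      qed
      have "(\<Sum>i. m (F i)) = (\<integral>\<^sup>+n. (\<Sum>i. emeasure (?c n) (F i \<inter> ?A n)) \<partial>count_space UNIV)"
        unfolding m_def by (rule nn_integral_suminf[symmetric]) simp
      then show "(\<Sum>i. m (F i)) = m (\<Union>(range F))" by (simp only: additive m_def)
    qed
  qed
  have "emeasure \<mu> S = emeasure (chart_measure \<Sigma> V \<rho>) S"
    if lp': "local_param \<Sigma> V \<rho>" and S: "S \<in> sets ?R" "S \<subseteq> \<rho> ` V" for V \<rho> S
  proof -
    have "emeasure (?c n) (S \<inter> ?A n) = emeasure (chart_measure \<Sigma> V \<rho>) (S \<inter> ?A n)" for n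
      using disjointed_local_params[where U = U and \<phi> = \<phi>, OF lp S(1), of n] S(2)
      by (intro chart_measure_eq[OF lp' lp]) auto
    then have "m S = (\<Sum>n. emeasure (chart_measure \<Sigma> V \<rho>) (S \<inter> ?A n))"
      by (simp add: m_def nn_integral_count_space_nat)
    then show ?thesis
      using emeasure[OF S(1)] suminf_disjointed_local_params[where U = U and \<phi> = \<phi>, OF lp cover S(1) sets_chart_measure] by simp
  qed
  then show ?thesis using sets unfolding is_area_measure_iff by blast
qed

text \<open>Existence together with uniqueness is what gives the definite description in
  \<open>area_measure\<close> its meaning.\<close>

lemma is_area_measure_area_measure:
  assumes "submanifold \<Sigma>"
  shows "is_area_measure \<Sigma> (area_measure \<Sigma>)"
proof -
  have "area_measure \<Sigma> = (THE \<mu>. is_area_measure \<Sigma> \<mu>)"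
    unfolding area_measure_def is_area_measure_def ..
  moreover have "\<exists>!\<mu>. is_area_measure \<Sigma> \<mu>"
    using is_area_measure_exists[OF assms] is_area_measure_unique[OF assms] by blast
  ultimately show ?thesis by (simp add: theI')
qed

text \<open>Localisation of the area measure to a chart, written as a density; integrals then
  transfer by the rules for densities and push-forwards.\<close>

lemma chart_measure_eq_density:
  assumes "submanifold \<Sigma>" and lp: "local_param \<Sigma> U \<phi>"
  shows "chart_measure \<Sigma> U \<phi> = density (area_measure \<Sigma>) (\<lambda>p. ennreal (indicator (\<phi> ` U) p))"
proof (rule measure_eqI)
  have a: "is_area_measure \<Sigma> (area_measure \<Sigma>)" by (rule is_area_measure_area_measure[OF assms(1)])
  then have sets: "sets (area_measure \<Sigma>) = sets (restrict_space borel \<Sigma>)" by (simp add: is_area_measure_def)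
  show "sets (chart_measure \<Sigma> U \<phi>) = sets (density (area_measure \<Sigma>) (\<lambda>p. ennreal (indicator (\<phi> ` U) p)))"
    by (simp add: sets_chart_measure sets)
  fix S assume "S \<in> sets (chart_measure \<Sigma> U \<phi>)"
  then have S: "S \<in> sets (restrict_space borel \<Sigma>)" by (simp add: sets_chart_measure)
  have im: "\<phi> ` U \<in> sets (restrict_space borel \<Sigma>)"
    using local_param_image_borel[OF lp] local_param_open[OF lp] by simp
  have "emeasure (density (area_measure \<Sigma>) (\<lambda>p. ennreal (indicator (\<phi> ` U) p))) S
      = emeasure (area_measure \<Sigma>) (\<phi> ` U \<inter> S)"
    using S im sets by (simp add: emeasure_density ennreal_indicator) (simp flip: indicator_inter_arith)
  also have "\<dots> = emeasure (chart_measure \<Sigma> U \<phi>) (\<phi> ` U \<inter> S)"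
    using a lp S im unfolding is_area_measure_iff by blast
  also have "\<dots> = emeasure (chart_measure \<Sigma> U \<phi>) S"
  proof -
    have "U \<inter> \<phi> -` (\<phi> ` U \<inter> S) = U \<inter> \<phi> -` S" by auto
    then show ?thesis using emeasure_chart_measure[OF lp] S im by (simp add: sets.Int)
  qed
  finally show "emeasure (chart_measure \<Sigma> U \<phi>) S
    = emeasure (density (area_measure \<Sigma>) (\<lambda>p. ennreal (indicator (\<phi> ` U) p))) S" by simp
qed

lemma has_bochner_integral_area_measure:
  fixes f :: "complex^'n::finite \<Rightarrow> real"
  assumes "submanifold \<Sigma>" and lp: "local_param \<Sigma> U \<phi>"
    and f: "f \<in> borel_measurable (restrict_space borel \<Sigma>)"
    and supp: "\<And>p. p \<in> \<Sigma> \<Longrightarrow> p \<notin> \<phi> ` U \<Longrightarrow> f p = 0"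
    and int: "has_bochner_integral lborel (\<lambda>x. indicator U x * (vol \<phi> x * f (\<phi> x))) r"
  shows "has_bochner_integral (area_measure \<Sigma>) f r"
proof -
  let ?\<mu> = "area_measure \<Sigma>" and ?L = "restrict_space lborel U"
  have sets: "sets ?\<mu> = sets (restrict_space borel \<Sigma>)"
    using is_area_measure_area_measure[OF assms(1)] by (simp add: is_area_measure_def)
  have space: "space ?\<mu> = \<Sigma>" using sets_eq_imp_space_eq[OF sets] by (simp add: space_restrict_space)
  have f\<mu>: "f \<in> borel_measurable ?\<mu>" using f measurable_cong_sets[OF sets refl] by blast
  have U: "U \<in> sets lborel" using local_param_open[OF lp] by simp
  have im: "\<phi> ` U \<in> sets ?\<mu>"
    using local_param_image_borel[OF lp] local_param_open[OF lp] sets by simp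
  have d: "chart_density \<phi> U \<in> borel_measurable ?L"
    using chart_density_measurable[OF lp] by (intro measurable_restrict_space1) simp
  have f\<phi>: "(\<lambda>x. f (\<phi> x)) \<in> borel_measurable ?L"
    using measurable_compose[OF local_param_measurable[OF lp] f] .
  have \<phi>: "\<phi> \<in> density ?L (\<lambda>x. ennreal (chart_density \<phi> U x)) \<rightarrow>\<^sub>M restrict_space borel \<Sigma>"
    using local_param_measurable[OF lp] by simp
  have "has_bochner_integral ?L (\<lambda>x. chart_density \<phi> U x *\<^sub>R f (\<phi> x)) r"
  proof -
    have eq: "(\<lambda>x. indicator U x * (chart_density \<phi> U x * f (\<phi> x)))
        = (\<lambda>x. indicator U x * (vol \<phi> x * f (\<phi> x)))"
      by (auto simp: chart_density_def indicator_def)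
    show ?thesis
      using int U unfolding has_bochner_integral_iff
      by (simp add: integrable_restrict_space integral_restrict_space eq set_integrable_def)
  qed
  then have "has_bochner_integral (density ?L (\<lambda>x. ennreal (chart_density \<phi> U x))) (\<lambda>x. f (\<phi> x)) r"
    unfolding has_bochner_integral_iff
    using integrable_density[OF f\<phi> d] integral_density[OF f\<phi> d] chart_density_nonneg[OF lp] by simp
  then have "has_bochner_integral (chart_measure \<Sigma> U \<phi>) f r"
    unfolding has_bochner_integral_iff chart_measure_def
    using integrable_distr_eq[OF \<phi> f] integral_distr[OF \<phi> f] by simp
  then have "has_bochner_integral ?\<mu> (\<lambda>p. indicator (\<phi> ` U) p *\<^sub>R f p) r"
    unfolding has_bochner_integral_iff chart_measure_eq_density[OF assms(1) lp]
    using integrable_density[OF f\<mu>, of "indicator (\<phi> ` U)"] integral_density[OF f\<mu>, of "indicator (\<phi> ` U)"] im by simp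
  then show ?thesis
    by (subst has_bochner_integral_cong[of ?\<mu> ?\<mu> f "\<lambda>p. indicator (\<phi> ` U) p *\<^sub>R f p" r r])
       (use supp space in \<open>auto simp: indicator_def\<close>)
qed

section \<open>The divergence theorem\<close>

lemma Ck_on_Un:
  assumes "open A" "open B" "Ck_on k A f" "Ck_on k B f"
  shows "Ck_on k (A \<union> B) f"
  using assms(3,4)
proof (induction k arbitrary: f)
  case 0
  then show ?case using continuous_on_open_Un[OF assms(1,2)] by simp
qed auto

text \<open>The extension of F by zero is of class C^1, because U and the complement of K are open
  and together cover the space.\<close>

lemma integral_derivative_compact_support:
  fixes F :: "'a::euclidean_space \<Rightarrow> real"
  assumes U: "open U" and F: "Ck_on (Suc 0) U F" and K: "compact K" "K \<subseteq> U"
    and supp: "\<And>x. x \<in> U \<Longrightarrow> x \<notin> K \<Longrightarrow> F x = 0"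
  shows "has_bochner_integral lborel (\<lambda>x. indicator U x * der F x v) 0"
proof -
  define G where "G x = (if x \<in> U then F x else 0)" for x
  define G' where "G' x = (if x \<in> U then der F x else (\<lambda>_. 0))" for x
  have oK: "open (- K)" using K(1) by (simp add: compact_imp_closed open_Compl)
  have G0: "G x = 0" if "x \<notin> K" for x using supp that by (simp add: G_def)
  have z: "(G has_derivative (\<lambda>_. 0)) (at x)" if x: "x \<notin> K" for x
  proof (rule has_derivative_transform_within_open[OF has_derivative_const oK])
    show "x \<in> - K" using x by simp
    show "0 = G y" if "y \<in> - K" for y using G0 that by simp
  qed
  have inU: "(G has_derivative der F x) (at x)" if x: "x \<in> U" for x
    by (rule has_derivative_transform_within_open[OF Ck_on_has_derivative[OF F x] U x]) (simp add: G_def)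
  have der: "(G has_derivative G' x) (at x)" for x
    using inU[of x] z[of x] K(2) by (auto simp: G'_def)
  have "G' x v = 0" if "x \<in> - K" for x
    using has_derivative_unique[OF der[of x] z[of x]] that by simp
  then have "continuous_on (- K) (\<lambda>x. G' x v)"
    using continuous_on_cong[of "- K" "- K" "\<lambda>x. G' x v" "\<lambda>_. 0"] by simp
  moreover have "continuous_on U (\<lambda>x. G' x v)"
    using continuous_on_cong[of U U "\<lambda>x. G' x v" "\<lambda>x. der F x v"] F by (simp add: G'_def)
  ultimately have "continuous_on (- K \<union> U) (\<lambda>x. G' x v)"
    using continuous_on_open_Un[OF oK U] by blast
  moreover have "- K \<union> U = UNIV" using K(2) by blast
  ultimately have cont: "continuous_on UNIV (\<lambda>x. G' x v)" by simp
  have "has_bochner_integral lborel (\<lambda>x. G' x v) 0"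
    by (rule integral_derivative_eq_0[OF K(1) G0 der cont])
  moreover have "(\<lambda>x. G' x v) = (\<lambda>x. indicator U x * der F x v)"
    by (auto simp: G'_def indicator_def)
  ultimately show ?thesis by simp
qed

text \<open>The frame of the image of \<open>f\<close> dual to the images of the coordinate vectors.\<close>
definition cocoord :: "(real^'n::finite \<Rightarrow> 'b::euclidean_space) \<Rightarrow> 'n \<Rightarrow> 'b" where
  "cocoord f i = (\<Sum>b\<in>Basis. (coords f b $ i) *\<^sub>R b)"

context
  fixes f :: "real^'n::finite \<Rightarrow> 'b::euclidean_space"
  assumes f: "linear f" "inj f"
begin

lemma coords_unique:
  assumes "\<And>c. f c \<bullet> (a - f d) = 0"
  shows "coords f a = d"
proof -
  have "f (coords f a - d) \<bullet> f (coords f a - d)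
      = f (coords f a - d) \<bullet> (a - f d) - f (coords f a - d) \<bullet> (a - f (coords f a))"
    by (simp add: linear_diff[OF f(1)] algebra_simps)
  also have "\<dots> = 0" using assms coords_orthogonal[OF f] by simp
  finally have "f (coords f a - d) = f 0" using linear_0[OF f(1)] by simp
  then show ?thesis using injD[OF f(2)] by fastforce
qed

lemma linear_coords: "linear (coords f)"
proof (rule linearI)
  show "coords f (a + b) = coords f a + coords f b" for a b
  proof (rule coords_unique)
    show "f c \<bullet> (a + b - f (coords f a + coords f b)) = 0" for c
      using coords_orthogonal[OF f, of c a] coords_orthogonal[OF f, of c b]
      by (simp add: linear_add[OF f(1)] algebra_simps)
  qed
  show "coords f (r *\<^sub>R a) = r *\<^sub>R coords f a" for r a
  proof (rule coords_unique)
    show "f c \<bullet> (r *\<^sub>R a - f (r *\<^sub>R coords f a)) = 0" for c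
      using coords_orthogonal[OF f, of c a] by (simp add: linear_cmul[OF f(1)] inner_diff_right)
  qed
qed

lemma cocoord_inner: "cocoord f i \<bullet> a = coords f a $ i"
proof -
  have "coords f a = coords f (\<Sum>b\<in>Basis. (a \<bullet> b) *\<^sub>R b)" by (simp add: euclidean_representation)
  also have "\<dots> = (\<Sum>b\<in>Basis. (a \<bullet> b) *\<^sub>R coords f b)"
    by (simp add: linear_sum[OF linear_coords] linear_cmul[OF linear_coords])
  finally have "coords f a $ i = (\<Sum>b\<in>Basis. (a \<bullet> b) * coords f b $ i)" by simp
  also have "\<dots> = (\<Sum>b\<in>Basis. coords f b $ i * (b \<bullet> a))"
    by (simp add: inner_commute mult.commute)
  finally show ?thesis by (simp only: cocoord_def inner_sum_left inner_scaleR_left)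
qed

text \<open>The map f after \<open>coords f\<close> is the orthogonal projection onto the range of
  f. Its self-adjointness, tested against all vectors, shows that it fixes the dual frame, which
  therefore lies in the range.\<close>

lemma apply_coords_cocoord: "f (coords f (cocoord f i)) = cocoord f i"
proof (rule euclidean_eqI)
  fix a :: 'b
  let ?e = "cocoord f i"
  have "f (coords f ?e) \<bullet> a = f (coords f ?e) \<bullet> f (coords f a)"
    using coords_orthogonal[OF f, of "coords f ?e" a] by (simp add: inner_diff_right)
  also have "\<dots> = ?e \<bullet> f (coords f a)"
    using coords_orthogonal[OF f, of "coords f a" ?e] by (simp add: inner_diff_right inner_commute)
  also have "\<dots> = ?e \<bullet> a" by (simp add: cocoord_inner coords_apply[OF f])
  finally show "f (coords f ?e) \<bullet> a = ?e \<bullet> a" .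
qed

lemma inner_cocoord: "f (axis k 1) \<bullet> cocoord f i = (if k = i then 1 else 0)"
  using cocoord_inner[of i "f (axis k 1)"] coords_apply[OF f, of "axis k 1"]
  by (simp add: inner_commute axis_def)

lemma sum_cocoord_cocoord: "(\<Sum>j\<in>UNIV. (cocoord f j \<bullet> cocoord f i) *\<^sub>R f (axis j 1)) = cocoord f i"
  using linear_eq_sum_axis[OF f(1), of "coords f (cocoord f i)"] apply_coords_cocoord[of i]
  by (simp add: cocoord_inner)

lemma trace_cocoord:
  assumes L: "linear L"
  shows "(\<Sum>b\<in>Basis. L (coords f b) \<bullet> b) = (\<Sum>i\<in>UNIV. L (axis i 1) \<bullet> cocoord f i)"
proof -
  have "(\<Sum>b\<in>Basis. L (coords f b) \<bullet> b) = (\<Sum>b\<in>Basis. \<Sum>i\<in>UNIV. coords f b $ i * (L (axis i 1) \<bullet> b))"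
    by (subst linear_eq_sum_axis[OF L]) (simp add: inner_sum_left)
  also have "\<dots> = (\<Sum>i\<in>UNIV. \<Sum>b\<in>Basis. coords f b $ i * (L (axis i 1) \<bullet> b))" by (rule sum.swap)
  finally show ?thesis by (simp add: cocoord_def inner_sum_right)
qed

text \<open>The inner products of the dual frame form the inverse metric, which is the inverse
  needed in \<open>Jacobi_formula\<close>.\<close>

lemma gram_mult_cocoord: "gram f ** (\<chi> i j. cocoord f i \<bullet> cocoord f j) = mat 1"
proof -
  have "(\<Sum>j\<in>UNIV. (f (axis k 1) \<bullet> f (axis j 1)) * (cocoord f j \<bullet> cocoord f i)) = (if k = i then 1 else 0)" for k i
  proof -
    have "(\<Sum>j\<in>UNIV. (f (axis k 1) \<bullet> f (axis j 1)) * (cocoord f j \<bullet> cocoord f i))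
        = f (axis k 1) \<bullet> (\<Sum>j\<in>UNIV. (cocoord f j \<bullet> cocoord f i) *\<^sub>R f (axis j 1))"
      by (simp add: inner_sum_right mult.commute)
    then show ?thesis by (simp add: sum_cocoord_cocoord inner_cocoord)
  qed
  then show ?thesis by (simp add: vec_eq_iff matrix_matrix_mult_def gram_def mat_def)
qed

end

text \<open>Jacobi's formula produces two halves that agree by symmetry of the metric; the resulting
  factor 2 cancels against the derivative of the root. The remaining sum is the contracted
  Christoffel symbol.\<close>

lemma sqrt_det_gram_matrix_has_derivative:
  assumes lp: "local_param \<Sigma> U \<phi>" and x: "x \<in> U"
  shows "((\<lambda>y. vol \<phi> y) has_derivative (\<lambda>h. vol \<phi> x *
      (\<Sum>i\<in>UNIV. der (\<lambda>y. der \<phi> y (axis i 1)) x h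
        \<bullet> cocoord (der \<phi> x) i))) (at x)"
proof -
  let ?d = "\<lambda>i y. der \<phi> y (axis i 1)" and ?f = "der \<phi> x"
  let ?D = "\<lambda>i. der (?d i) x" and ?c = "cocoord ?f"
  note f = local_param_linear[OF lp x] local_param_inj[OF lp x]
  have D: "(?d i has_derivative ?D i) (at x)" for i
    using local_param_Ck[OF lp, of "Suc (Suc 0)"] x by (auto simp: frechet_derivative_works)
  have "((\<lambda>y. det (gram_matrix \<phi> y)) has_derivative (\<lambda>h. det (gram_matrix \<phi> x) *
      (\<Sum>i\<in>UNIV. \<Sum>j\<in>UNIV. (\<chi> i j. ?c i \<bullet> ?c j) $ i $ j * (?d j x \<bullet> ?D i h + ?D j h \<bullet> ?d i x)))) (at x)"
  proof (rule Jacobi_formula)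
    show "((\<lambda>y. gram_matrix \<phi> y $ i $ j) has_derivative (\<lambda>h. ?d i x \<bullet> ?D j h + ?D i h \<bullet> ?d j x)) (at x)" for i j
      using has_derivative_inner[OF D[of i] D[of j]] by (simp add: gram_matrix_def)
    show "gram_matrix \<phi> x ** (\<chi> i j. ?c i \<bullet> ?c j) = mat 1"
      unfolding gram_matrix_eq_gram by (rule gram_mult_cocoord[OF f])
  qed
  moreover have "(\<Sum>i\<in>UNIV. \<Sum>j\<in>UNIV. (\<chi> i j. ?c i \<bullet> ?c j) $ i $ j * (?d j x \<bullet> ?D i h + ?D j h \<bullet> ?d i x))
      = 2 * (\<Sum>i\<in>UNIV. ?D i h \<bullet> ?c i)" for h
  proof -
    have 1: "(\<Sum>j\<in>UNIV. (?c j \<bullet> ?c i) * (?D i h \<bullet> ?d j x)) = ?D i h \<bullet> ?c i" for i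
    proof -
      have "?D i h \<bullet> (\<Sum>j\<in>UNIV. (?c j \<bullet> ?c i) *\<^sub>R ?d j x) = ?D i h \<bullet> ?c i"
        by (simp only: sum_cocoord_cocoord[OF f])
      then show ?thesis by (simp only: inner_sum_right inner_scaleR_right)
    qed
    have "(\<Sum>i\<in>UNIV. \<Sum>j\<in>UNIV. (?c i \<bullet> ?c j) * (?D j h \<bullet> ?d i x)) = (\<Sum>j\<in>UNIV. ?D j h \<bullet> ?c j)"
      by (subst sum.swap) (simp only: 1)
    moreover have "(\<Sum>i\<in>UNIV. \<Sum>j\<in>UNIV. (?c i \<bullet> ?c j) * (?d j x \<bullet> ?D i h)) = (\<Sum>i\<in>UNIV. ?D i h \<bullet> ?c i)"
      unfolding 1[symmetric] by (intro sum.cong refl) (simp add: inner_commute)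
    ultimately show ?thesis by (simp add: distrib_left sum.distrib)
  qed
  ultimately have "((\<lambda>y. det (gram_matrix \<phi> y)) has_derivative
      (\<lambda>h. det (gram_matrix \<phi> x) * (2 * (\<Sum>i\<in>UNIV. ?D i h \<bullet> ?c i)))) (at x)" by simp
  from DERIV_compose_FDERIV[OF DERIV_real_sqrt[OF det_gram_matrix_pos[OF lp x]] this]
  have der: "((\<lambda>y. vol \<phi> y) has_derivative (\<lambda>h. det (gram_matrix \<phi> x) *
      (2 * (\<Sum>i\<in>UNIV. ?D i h \<bullet> ?c i)) * (inverse (vol \<phi> x) / 2))) (at x)" .
  have eq: "det (gram_matrix \<phi> x) * (2 * s) * (inverse (vol \<phi> x) / 2)
      = vol \<phi> x * s" for s
    using det_gram_matrix_pos[OF lp x] by (simp add: divide_simps)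
  show ?thesis using der unfolding eq .
qed

text \<open>The classical formula for sqrt(det g) div X. Expanding X in the coordinate frame, the
  trace of its derivative consists of the derivatives of the components and a Christoffel term.
  Symmetry of the second derivatives of the chart identifies the latter with the derivative of the
  logarithm of the density.\<close>

lemma divergence_local_param:
  assumes sm: "submanifold \<Sigma>" and lp: "local_param \<Sigma> U \<phi>" and x: "x \<in> U"
    and X: "Ck_on_submanifold (Suc 0) \<Sigma> X" and tan: "\<And>p. p \<in> \<Sigma> \<Longrightarrow> X p \<in> tangent_space \<Sigma> p"
  shows "(\<Sum>k\<in>UNIV. der (\<lambda>y. vol \<phi> y *
      coords (der \<phi> y) (X (\<phi> y)) $ k) x (axis k 1))
    = vol \<phi> x * trace_blinfun (tderiv \<Sigma> X (\<phi> x))"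
proof -
  let ?d = "\<lambda>k y. der \<phi> y (axis k 1)" and ?f = "der \<phi> x"
  let ?D = "\<lambda>i. der (?d i) x" and ?c = "cocoord ?f"
  let ?g = "\<lambda>y. vol \<phi> y"
  define \<xi> where "\<xi> k y = coords (der \<phi> y) (X (\<phi> y)) $ k" for k y
  define \<xi>' where "\<xi>' k = der (\<xi> k) x" for k
  define w where "w h = (\<Sum>i\<in>UNIV. ?D i h \<bullet> ?c i)" for h
  note f = local_param_linear[OF lp x] local_param_inj[OF lp x]
  have "Ck_on (Suc 0) U (\<lambda>y. X (\<phi> y))" by (rule Ck_on_submanifoldD[OF X lp])
  then have "Ck_on (Suc 0) U (\<xi> k)" for k
    unfolding \<xi>_def[abs_def] by (rule Ck_on_coords[OF lp])
  then have \<xi>: "(\<xi> k has_derivative \<xi>' k) (at x)" for k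
    unfolding \<xi>'_def using x by (rule Ck_on_has_derivative)
  have g: "(?g has_derivative (\<lambda>h. ?g x * w h)) (at x)"
    unfolding w_def by (rule sqrt_det_gram_matrix_has_derivative[OF lp x])
  have D: "(?d i has_derivative ?D i) (at x)" for i
    using local_param_Ck[OF lp, of "Suc (Suc 0)"] x by (auto simp: frechet_derivative_works)
  have "((\<lambda>y. \<Sum>k\<in>UNIV. \<xi> k y *\<^sub>R ?d k y) has_derivative
      (\<lambda>h. \<Sum>k\<in>UNIV. \<xi> k x *\<^sub>R ?D k h + \<xi>' k h *\<^sub>R ?d k x)) (at x)"
    by (intro has_derivative_sum bounded_bilinear.FDERIV[OF bounded_bilinear_scaleR \<xi> D])
  then have X': "((\<lambda>y. X (\<phi> y)) has_derivative
      (\<lambda>h. \<Sum>k\<in>UNIV. \<xi> k x *\<^sub>R ?D k h + \<xi>' k h *\<^sub>R ?d k x)) (at x)" (is "(_ has_derivative ?L) _")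
  proof (rule has_derivative_transform_within_open[OF _ local_param_open[OF lp] x])
    fix y assume y: "y \<in> U"
    obtain c where c: "X (\<phi> y) = der \<phi> y c"
      using tan[OF local_param_mem[OF lp y]] tangent_space_local_param[OF lp y] by blast
    have "(\<Sum>k\<in>UNIV. \<xi> k y *\<^sub>R ?d k y) = der \<phi> y c"
      unfolding \<xi>_def c coords_apply[OF local_param_linear[OF lp y] local_param_inj[OF lp y]]
      by (rule linear_eq_sum_axis[OF local_param_linear[OF lp y], symmetric])
    then show "(\<Sum>k\<in>UNIV. \<xi> k y *\<^sub>R ?d k y) = X (\<phi> y)" using c by simp
  qed
  have sym: "?D k (axis i 1) = ?D i (axis k 1)" for i k
    by (rule symmetric_second_derivative[OF local_param_open[OF lp] x local_param_Ck[OF lp]])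
  have delta: "(\<Sum>k\<in>UNIV. a k * (if k = i then 1 else 0)) = a i" for a :: "_ \<Rightarrow> real" and i :: 'a
    by (simp add: if_distrib cong: if_cong)
  have "trace_blinfun (tderiv \<Sigma> X (\<phi> x)) = (\<Sum>b\<in>Basis. ?L (coords ?f b) \<bullet> b)"
    unfolding trace_blinfun_def tderiv_local_param[where f = X, OF sm lp x X'] ..
  also have "\<dots> = (\<Sum>i\<in>UNIV. ?L (axis i 1) \<bullet> ?c i)"
    by (rule trace_cocoord[OF f has_derivative_linear[OF X']])
  also have "\<dots> = (\<Sum>i\<in>UNIV. \<Sum>k\<in>UNIV. \<xi> k x * (?D k (axis i 1) \<bullet> ?c i)) + (\<Sum>i\<in>UNIV. \<xi>' i (axis i 1))"
    by (simp add: inner_sum_left inner_add_left sum.distrib inner_cocoord[OF f] delta)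
  also have "(\<Sum>i\<in>UNIV. \<Sum>k\<in>UNIV. \<xi> k x * (?D k (axis i 1) \<bullet> ?c i)) = (\<Sum>k\<in>UNIV. \<xi> k x * w (axis k 1))"
    unfolding w_def sum_distrib_left by (subst sum.swap) (simp only: sym)
  finally have tr: "trace_blinfun (tderiv \<Sigma> X (\<phi> x))
      = (\<Sum>k\<in>UNIV. \<xi> k x * w (axis k 1)) + (\<Sum>i\<in>UNIV. \<xi>' i (axis i 1))" .
  have "der (\<lambda>y. ?g y * \<xi> k y) x = (\<lambda>h. ?g x * \<xi>' k h + ?g x * w h * \<xi> k x)" for k
    by (rule frechet_derivative_at[symmetric]) (rule has_derivative_mult[OF g \<xi>])
  then show ?thesis
    unfolding \<xi>_def[symmetric] tr
    by (simp add: sum.distrib sum_distrib_left algebra_simps)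
qed

section \<open>Integration of divergences of compactly supported fields\<close>

lemma Ck_on_submanifold_continuous_on:
  assumes "submanifold \<Sigma>" and f: "Ck_on_submanifold 0 \<Sigma> f"
  shows "continuous_on \<Sigma> f"
  unfolding continuous_on_eq_continuous_within
proof
  fix p assume "p \<in> \<Sigma>"
  obtain U \<phi> x where lp: "local_param \<Sigma> U \<phi>" "x \<in> U" "p = \<phi> x"
    using submanifold_local_param[OF assms(1) \<open>p \<in> \<Sigma>\<close>] .
  obtain \<psi> where \<psi>: "continuous_on (\<phi> ` U) \<psi>" "\<And>q. q \<in> \<phi> ` U \<Longrightarrow> \<psi> q \<in> U" "\<And>q. q \<in> \<phi> ` U \<Longrightarrow> \<phi> (\<psi> q) = q"
    using local_param_inverse[OF lp(1)] by metis
  have "continuous_on U (\<lambda>x. f (\<phi> x))" using Ck_on_submanifoldD[OF f lp(1)] by simp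
  then have "continuous_on (\<phi> ` U) (\<lambda>q. f (\<phi> (\<psi> q)))"
    by (rule continuous_on_compose2[OF _ \<psi>(1)]) (use \<psi>(2) in auto)
  then have "continuous_on (\<phi> ` U) f"
    using continuous_on_cong[of "\<phi> ` U" "\<phi> ` U" "\<lambda>q. f (\<phi> (\<psi> q))" f] \<psi>(3) by simp
  then show "continuous (at p within \<Sigma>) f"
    using lp at_within_local_param[OF lp(1)] by (auto simp: continuous_on_eq_continuous_within continuous_within)
qed

lemma tderiv_eq_0:
  assumes "submanifold \<Sigma>" "p \<in> \<Sigma>" and W: "open W" "p \<in> W" "\<And>q. q \<in> \<Sigma> \<Longrightarrow> q \<in> W \<Longrightarrow> f q = 0"
  shows "tderiv \<Sigma> f p = 0"
proof -
  obtain d where d: "d > 0" "ball p d \<subseteq> W" using W openE by blast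
  have "(f has_derivative (\<lambda>_. 0)) (at p within \<Sigma>)"
  proof (rule has_derivative_transform_within[OF has_derivative_const d(1) assms(2)])
    show "0 = f q" if "q \<in> \<Sigma>" "dist q p < d" for q
      using W(3)[of q] d(2) that by (auto simp: dist_commute subset_eq)
  qed
  then show ?thesis by (intro blinfun_eqI) (simp add: tderiv_apply[OF assms(1,2)])
qed

text \<open>In the chart, density times divergence is a sum of coordinate derivatives of functions
  with compact support, each of integral zero.\<close>

lemma divergence_theorem_local_param:
  assumes sm: "submanifold \<Sigma>" and lp: "local_param \<Sigma> U \<phi>"
    and X: "Ck_on_submanifold (Suc 0) \<Sigma> X" and tan: "\<And>p. p \<in> \<Sigma> \<Longrightarrow> X p \<in> tangent_space \<Sigma> p"
    and K: "compact K" "K \<subseteq> \<phi> ` U" and supp: "\<And>p. p \<in> \<Sigma> \<Longrightarrow> p \<notin> K \<Longrightarrow> X p = 0"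
  shows "has_bochner_integral (area_measure \<Sigma>) (\<lambda>p. trace_blinfun (tderiv \<Sigma> X p)) 0"
proof (rule has_bochner_integral_area_measure[OF sm lp])
  have "Ck_on_submanifold 0 \<Sigma> (\<lambda>p. trace_blinfun (tderiv \<Sigma> X p))"
    by (rule Ck_on_submanifold_linear[OF bounded_linear_trace_blinfun Ck_on_submanifold_tderiv[OF sm X]])
  then show "(\<lambda>p. trace_blinfun (tderiv \<Sigma> X p)) \<in> borel_measurable (restrict_space borel \<Sigma>)"
    by (rule borel_measurable_continuous_on_restrict[OF Ck_on_submanifold_continuous_on[OF sm]])
  have oK: "open (- K)" using K(1) by (simp add: compact_imp_closed open_Compl)
  show "trace_blinfun (tderiv \<Sigma> X p) = 0" if "p \<in> \<Sigma>" "p \<notin> \<phi> ` U" for p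
  proof -
    have "p \<notin> K" using that(2) K(2) by blast
    then have "tderiv \<Sigma> X p = 0" using supp by (intro tderiv_eq_0[OF sm that(1) oK]) auto
    then show ?thesis by (simp add: trace_blinfun_def)
  qed
  obtain \<psi> where \<psi>: "continuous_on (\<phi> ` U) \<psi>" "\<And>x. x \<in> U \<Longrightarrow> \<psi> (\<phi> x) = x" "\<And>q. q \<in> \<phi> ` U \<Longrightarrow> \<psi> q \<in> U"
    using local_param_inverse[OF lp] by metis
  have K': "compact (\<psi> ` K)" "\<psi> ` K \<subseteq> U"
    using K \<psi> by (auto intro: compact_continuous_image continuous_on_subset)
  let ?F = "\<lambda>k y. vol \<phi> y * coords (der \<phi> y) (X (\<phi> y)) $ k"
  note o = local_param_open[OF lp]
  have F: "Ck_on (Suc 0) U (?F k)" for k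
  proof (intro Ck_on_mult[OF o] Ck_on_coords[OF lp] Ck_on_submanifoldD[OF X lp])
    let ?g = "\<lambda>y. det (gram_matrix \<phi> y)"
    have g: "Ck_on (Suc 0) U ?g" by (rule Ck_on_det_gram_matrix[OF lp])
    show "Ck_on (Suc 0) U (\<lambda>y. sqrt (?g y))"
    proof (rule Ck_onI[OF o])
      show "((\<lambda>y. sqrt (?g y)) has_derivative (\<lambda>v. der ?g y v * (inverse (sqrt (?g y)) / 2))) (at y)"
        if y: "y \<in> U" for y
        by (rule DERIV_compose_FDERIV[OF DERIV_real_sqrt[OF det_gram_matrix_pos[OF lp y]] Ck_on_has_derivative[OF g y]])
      show "Ck_on 0 U (\<lambda>y. der ?g y v * (inverse (sqrt (?g y)) / 2))" for v
        using g Ck_on_imp_continuous[OF g] det_gram_matrix_pos[OF lp]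
        by (auto intro!: continuous_intros simp: less_imp_neq[symmetric])
    qed
  qed
  have F0: "?F k x = 0" if "x \<in> U" "x \<notin> \<psi> ` K" for x k
  proof -
    have "\<phi> x \<notin> K" using that \<psi>(2) by force
    then have "X (\<phi> x) = 0" using supp local_param_mem[OF lp that(1)] by blast
    then show ?thesis
      using linear_0[OF linear_coords[OF local_param_linear[OF lp that(1)] local_param_inj[OF lp that(1)]]] by simp
  qed
  have "has_bochner_integral lborel
      (\<lambda>x. \<Sum>k\<in>UNIV. indicator U x * der (?F k) x (axis k 1)) (\<Sum>k\<in>(UNIV :: 'a set). 0)"
    by (intro has_bochner_integral_sum integral_derivative_compact_support[OF o F K' F0])
  moreover have "(\<lambda>x. \<Sum>k\<in>UNIV. indicator U x * der (?F k) x (axis k 1))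
      = (\<lambda>x. indicator U x * (vol \<phi> x * trace_blinfun (tderiv \<Sigma> X (\<phi> x))))"
  proof
    fix x
    show "(\<Sum>k\<in>UNIV. indicator U x * der (?F k) x (axis k 1))
      = indicator U x * (vol \<phi> x * trace_blinfun (tderiv \<Sigma> X (\<phi> x)))"
      using divergence_local_param[OF sm lp _ X tan, of x]
      by (cases "x \<in> U") (simp_all flip: sum_distrib_left)
  qed
  ultimately show "has_bochner_integral lborel
      (\<lambda>x. indicator U x * (vol \<phi> x * trace_blinfun (tderiv \<Sigma> X (\<phi> x)))) 0" by simp
qed

text \<open>Squaring removes the kink of the positive part: the derivative 2 max(0,t) is continuous.
  This provides elementary cut-off functions of class C^1.\<close>

lemma Ck_on_square_positive_part:
  fixes s :: "'a::euclidean_space \<Rightarrow> real"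
  assumes U: "open U" and s: "Ck_on (Suc 0) U s"
  shows "Ck_on (Suc 0) U (\<lambda>x. (max 0 (s x))\<^sup>2)"
proof (rule Ck_onI[OF U])
  have m: "((\<lambda>t::real. (max 0 t)\<^sup>2) has_real_derivative 2 * max 0 t) (at t)" for t
  proof -
    consider "t < 0" | "t = 0" | "t > 0" by linarith
    then show ?thesis
    proof cases
      case 1
      have "((\<lambda>t::real. 0) has_real_derivative 2 * max 0 t) (at t)" using 1 by simp
      then show ?thesis
        by (rule has_field_derivative_transform_within_open[of _ _ _ "{..<0}"]) (use 1 in auto)
    next
      case 2
      have "((\<lambda>h::real. (max 0 h)\<^sup>2 / h) \<longlongrightarrow> 0) (at 0)"
      proof (rule Lim_null_comparison[OF _ tendsto_norm_zero[OF tendsto_ident_at]])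
        have "norm ((max 0 h)\<^sup>2 / h) \<le> norm h" for h :: real
          by (cases "h > 0") (auto simp: power2_eq_square)
        then show "\<forall>\<^sub>F h in at 0. norm ((max 0 h)\<^sup>2 / h) \<le> norm (h::real)" by simp
      qed
      then show ?thesis using 2 by (simp add: DERIV_def)
    next
      case 3
      have "((\<lambda>t::real. t\<^sup>2) has_real_derivative 2 * max 0 t) (at t)"
        using 3 by (auto intro!: derivative_eq_intros)
      then show ?thesis
        by (rule has_field_derivative_transform_within_open[of _ _ _ "{0<..}"]) (use 3 in auto)
    qed
  qed
  show "((\<lambda>x. (max 0 (s x))\<^sup>2) has_derivative (\<lambda>v. der s x v * (2 * max 0 (s x)))) (at x)"
    if "x \<in> U" for x
    by (rule DERIV_compose_FDERIV[OF m Ck_on_has_derivative[OF s that]])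
  show "Ck_on 0 U (\<lambda>x. der s x v * (2 * max 0 (s x)))" for v
    using s Ck_on_imp_continuous[OF s] by (auto intro!: continuous_intros)
qed

text \<open>A finite partition of unity near K splits X into fields supported in single charts.
  Dividing by the sum of the bumps loses no regularity, because X is zero wherever that sum
  vanishes.\<close>

theorem divergence_theorem:
  fixes \<Sigma> :: "(complex^'n::finite) set"
  assumes sm: "submanifold \<Sigma>"
    and X: "Ck_on_submanifold (Suc 0) \<Sigma> X" and tan: "\<And>p. p \<in> \<Sigma> \<Longrightarrow> X p \<in> tangent_space \<Sigma> p"
    and K: "compact K" "K \<subseteq> \<Sigma>" and supp: "\<And>p. p \<in> \<Sigma> \<Longrightarrow> p \<notin> K \<Longrightarrow> X p = 0"
  shows "has_bochner_integral (area_measure \<Sigma>) (\<lambda>p. trace_blinfun (tderiv \<Sigma> X p)) 0"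
proof -
  \<comment> \<open>Radius, domain and chart are packed into one tuple for a single choice function.
    Closed balls are taken so that the part of K inside the ball is a compact subset of the chart
    image.\<close>
  have "\<exists>c. 0 < fst c \<and> local_param \<Sigma> (fst (snd c)) (snd (snd c)) \<and>
      \<Sigma> \<inter> cball p (fst c) \<subseteq> snd (snd c) ` fst (snd c)" if p: "p \<in> K" for p
  proof -
    obtain U \<phi> where lp: "local_param \<Sigma> U \<phi>" "p \<in> \<phi> ` U"
      using sm K(2) p unfolding submanifold_def by blast
    obtain O' where O: "open O'" "\<phi> ` U = \<Sigma> \<inter> O'"
      using lp(1) by (auto simp: local_param_def openin_open)
    then obtain r where r: "r > 0" "cball p r \<subseteq> O'" using lp(2) open_contains_cball[of O'] by blast
    then show ?thesis using lp(1) O(2) by (intro exI[of _ "(r, U, \<phi>)"]) auto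
  qed
  then obtain c where c: "\<And>p. p \<in> K \<Longrightarrow> 0 < fst (c p) \<and> local_param \<Sigma> (fst (snd (c p))) (snd (snd (c p))) \<and>
      \<Sigma> \<inter> cball p (fst (c p)) \<subseteq> snd (snd (c p)) ` fst (snd (c p))" by metis
  define r where "r p = fst (c p)" for p
  obtain C where C: "C \<subseteq> K" "finite C" "K \<subseteq> (\<Union>p\<in>C. ball p (r p))"
  proof (rule compactE_image[OF K(1), of K "\<lambda>p. ball p (r p)"])
    show "K \<subseteq> (\<Union>p\<in>K. ball p (r p))" using c by (fastforce simp: r_def)
  qed auto
  \<comment> \<open>A C^1 bump, positive on the open ball about p and, for p in \<open>C\<close>,
    zero outside it.\<close>
  define \<beta> where "\<beta> p q = (max 0 ((r p)\<^sup>2 - (q - p) \<bullet> (q - p)))\<^sup>2" for p q :: "complex^'n"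
  define D where "D q = (\<Sum>p\<in>C. \<beta> p q)" for q
  \<comment> \<open>Outside K the sum \<open>D\<close> may vanish, but there X, and hence
    \<open>Y\<close>, is zero.\<close>
  define Y where "Y q = inverse (D q) *\<^sub>R X q" for q
  define Z where "Z p q = \<beta> p q *\<^sub>R Y q" for p q
  have \<beta>_nonneg: "0 \<le> \<beta> p q" for p q by (simp add: \<beta>_def)
  have sq: "(q - p) \<bullet> (q - p) = (dist p q)\<^sup>2" for p q :: "complex^'n"
    using power2_norm_eq_inner[of "q - p"] by (simp add: dist_norm norm_minus_commute)
  have \<beta>_pos: "0 < \<beta> p q" if "q \<in> ball p (r p)" for p q
  proof -
    have "(dist p q)\<^sup>2 < (r p)\<^sup>2" using that by (intro power_strict_mono) auto
    then show ?thesis by (simp add: \<beta>_def sq)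
  qed
  have \<beta>_zero: "\<beta> p q = 0" if "q \<notin> cball p (r p)" "p \<in> C" for p q
  proof -
    have "0 < r p" using c that(2) C(1) by (auto simp: r_def)
    then have "(r p)\<^sup>2 \<le> (dist p q)\<^sup>2" using that by (intro power_mono) auto
    then show ?thesis by (simp add: \<beta>_def sq)
  qed
  have D_pos: "D q > 0" if "q \<in> K" for q
  proof -
    obtain p where "p \<in> C" "q \<in> ball p (r p)" using C(3) \<open>q \<in> K\<close> by blast
    then have "\<beta> p q \<le> D q"
      unfolding D_def using C(2) \<beta>_nonneg by (intro member_le_sum) auto
    then show ?thesis using \<beta>_pos \<open>q \<in> ball p (r p)\<close> by fastforce
  qed
  have X_eq: "X q = (\<Sum>p\<in>C. Z p q)" if "q \<in> \<Sigma>" for q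
  proof (cases "q \<in> K")
    case True
    have "(\<Sum>p\<in>C. Z p q) = D q *\<^sub>R Y q" by (simp add: Z_def D_def scaleR_left.sum)
    then show ?thesis using D_pos[OF True] by (simp add: Y_def)
  next
    case False
    then show ?thesis using supp that by (simp add: Z_def Y_def)
  qed
  have Ck_\<beta>: "Ck_on (Suc 0) U (\<lambda>x. \<beta> p (\<phi> x))" if lp: "local_param \<Sigma> U \<phi>" for U \<phi> p
  proof -
    note o = local_param_open[OF lp]
    have d: "Ck_on (Suc 0) U (\<lambda>x. \<phi> x + - p)" for p
      by (intro Ck_on_add Ck_on_const local_param_Ck[OF lp] o)
    have "Ck_on (Suc 0) U (\<lambda>x. (r p)\<^sup>2 + (- 1) * ((\<phi> x + - p) \<bullet> (\<phi> x + - p)))"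
      by (rule Ck_on_add[OF o Ck_on_const[OF o] Ck_on_mult[OF o Ck_on_const[OF o] Ck_on_inner[OF o d d]]])
    from Ck_on_square_positive_part[OF o this] show ?thesis by (simp add: \<beta>_def)
  qed
  have Ck_Y: "Ck_on (Suc 0) U (\<lambda>x. Y (\<phi> x))" if lp: "local_param \<Sigma> U \<phi>" for U \<phi>
  proof -
    note o = local_param_open[OF lp]
    have DC: "Ck_on (Suc 0) U (\<lambda>x. D (\<phi> x))"
      unfolding D_def by (rule Ck_on_sum[OF o Ck_\<beta>[OF lp]])
    \<comment> \<open>Regularity is checked on two open sets: on \<open>A\<close> the denominator is
      positive, on \<open>B\<close> the field is identically zero. They cover U because
      \<open>D\<close> is positive on K.\<close>
    define A where "A = {x \<in> U. D (\<phi> x) > 0}"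
    define B where "B = {x \<in> U. \<phi> x \<notin> K}"
    have "A = U \<inter> (\<lambda>x. D (\<phi> x)) -` {0<..}" by (auto simp: A_def)
    then have A: "open A"
      using continuous_open_preimage[OF Ck_on_imp_continuous[OF DC] o open_greaterThan] by simp
    have oK: "open (- K)" using K(1) by (simp add: compact_imp_closed open_Compl)
    have "B = U \<inter> \<phi> -` (- K)" by (auto simp: B_def)
    then have B: "open B"
      using continuous_open_preimage[OF local_param_continuous[OF lp] o oK] by simp
    have AB: "A \<union> B = U" using D_pos by (auto simp: A_def B_def)
    have "Ck_on (Suc 0) A (\<lambda>x. Y (\<phi> x))"
      unfolding Y_def
    proof (intro Ck_on_scaleR Ck_on_inverse A)
      show "D (\<phi> x) \<noteq> 0" if "x \<in> A" for x using that by (simp add: A_def)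
      show "Ck_on (Suc 0) A (\<lambda>x. D (\<phi> x))" by (rule Ck_on_subset[OF DC]) (auto simp: A_def)
      show "Ck_on (Suc 0) A (\<lambda>x. X (\<phi> x))"
        by (rule Ck_on_subset[OF Ck_on_submanifoldD[OF X lp]]) (auto simp: A_def)
    qed
    moreover have "Ck_on (Suc 0) B (\<lambda>x. Y (\<phi> x))"
    proof (rule Ck_on_cong[OF B _ Ck_on_const[OF B]])
      show "0 = Y (\<phi> x)" if "x \<in> B" for x
        using that supp[OF local_param_mem[OF lp]] by (simp add: B_def Y_def)
    qed
    ultimately show ?thesis using Ck_on_Un[OF A B] AB by metis
  qed
  have Ck_Z: "Ck_on_submanifold (Suc 0) \<Sigma> (Z p)" for p
  proof (rule Ck_on_submanifoldI)
    fix U \<phi> assume lp: "local_param \<Sigma> U \<phi>"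
    show "Ck_on (Suc 0) U (\<lambda>x. Z p (\<phi> x))"
      unfolding Z_def by (rule Ck_on_scaleR[OF local_param_open[OF lp] Ck_\<beta>[OF lp] Ck_Y[OF lp]])
  qed
  have int: "has_bochner_integral (area_measure \<Sigma>) (\<lambda>q. trace_blinfun (tderiv \<Sigma> (Z p) q)) 0" if p: "p \<in> C" for p
  proof (rule divergence_theorem_local_param[OF sm _ Ck_Z])
    have pK: "p \<in> K" using p C(1) by blast
    show "local_param \<Sigma> (fst (snd (c p))) (snd (snd (c p)))" using c[OF pK] by simp
    show "Z p q \<in> tangent_space \<Sigma> q" if "q \<in> \<Sigma>" for q
      unfolding Z_def Y_def by (intro subspace_scale subspace_tangent_space[OF sm] tan that)
    show "compact (K \<inter> cball p (r p))" using K(1) by (intro compact_Int) auto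
    show "K \<inter> cball p (r p) \<subseteq> snd (snd (c p)) ` fst (snd (c p))"
      using c[OF pK] K(2) by (auto simp: r_def)
    show "Z p q = 0" if "q \<in> \<Sigma>" "q \<notin> K \<inter> cball p (r p)" for q
    proof (cases "q \<in> K")
      case True
      then have "\<beta> p q = 0" using that(2) by (intro \<beta>_zero[OF _ p]) blast
      then show ?thesis by (simp add: Z_def)
    next
      case False
      then show ?thesis using supp that(1) by (simp add: Z_def Y_def)
    qed
  qed
  have tr: "trace_blinfun (tderiv \<Sigma> X q) = (\<Sum>p\<in>C. trace_blinfun (tderiv \<Sigma> (Z p) q))" if q: "q \<in> \<Sigma>" for q
  proof -
    note Z' = Ck_on_submanifold_has_derivative[OF sm q Ck_Z]
    have "((\<lambda>q. \<Sum>p\<in>C. Z p q) has_derivative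
        (\<lambda>h. \<Sum>p\<in>C. frechet_derivative (Z p) (at q within \<Sigma>) h)) (at q within \<Sigma>)"
      by (intro has_derivative_sum Z')
    then have "(X has_derivative (\<lambda>h. \<Sum>p\<in>C. frechet_derivative (Z p) (at q within \<Sigma>) h)) (at q within \<Sigma>)"
      using has_derivative_transform[where g = X, OF q X_eq] by blast
    then have "tderiv \<Sigma> X q = (\<Sum>p\<in>C. tderiv \<Sigma> (Z p) q)"
      by (intro blinfun_eqI) (simp add: tderiv_apply[OF sm q] tderiv_apply[OF sm q Z'] blinfun.sum_left)
    then show ?thesis by (simp add: linear_sum[OF bounded_linear.linear[OF bounded_linear_trace_blinfun]])
  qed
  have "has_bochner_integral (area_measure \<Sigma>) (\<lambda>q. \<Sum>p\<in>C. trace_blinfun (tderiv \<Sigma> (Z p) q)) (\<Sum>p\<in>C. 0)"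
    by (rule has_bochner_integral_sum) (rule int)
  moreover have "space (area_measure \<Sigma>) = \<Sigma>"
    using is_area_measure_area_measure[OF sm] sets_eq_imp_space_eq[of "area_measure \<Sigma>" "restrict_space borel \<Sigma>"]
    by (simp add: is_area_measure_def space_restrict_space)
  ultimately show ?thesis
    using tr has_bochner_integral_cong[of "area_measure \<Sigma>" "area_measure \<Sigma>" "\<lambda>p. trace_blinfun (tderiv \<Sigma> X p)"
        "\<lambda>q. \<Sum>p\<in>C. trace_blinfun (tderiv \<Sigma> (Z p) q)" 0 0] by simp
qed

theorem theorem1p1:
  fixes \<Sigma> :: "(complex^'n::finite) set" and T :: "complex^'n"
  assumes "lagrangian \<Sigma>" and "translating_soliton \<Sigma> T"
  shows "lagrangian_L_stable \<Sigma> T"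
  unfolding lagrangian_L_stable_def
proof (intro allI impI)
  fix V assume V: "lagrangian_variation \<Sigma> V \<and> compactly_supported \<Sigma> V"
  interpret lagrangian_variation_on_soliton \<Sigma> T V
    using assms V by unfold_locales auto
  let ?\<mu> = "area_measure \<Sigma>" and ?f = "\<lambda>p. (stability_operator \<Sigma> T V p \<bullet> V p) * exp (T \<bullet> p)"
  let ?d = "\<lambda>p. trace_blinfun (tderiv \<Sigma> X p)"
  define K where "K = \<Sigma> \<inter> closure {p \<in> \<Sigma>. V p \<noteq> 0}"
  have space: "space ?\<mu> = \<Sigma>"
    using is_area_measure_area_measure[OF sm] sets_eq_imp_space_eq[of ?\<mu> "restrict_space borel \<Sigma>"]
    by (simp add: is_area_measure_def space_restrict_space)
  have d: "has_bochner_integral ?\<mu> ?d 0"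
  proof (rule divergence_theorem[OF sm Ck_X X_tangent])
    show "compact K" using V by (simp add: K_def compactly_supported_def)
    show "K \<subseteq> \<Sigma>" by (simp add: K_def)
    show "X p = 0" if "p \<in> \<Sigma>" "p \<notin> K" for p
    proof -
      have "V p = 0" using that closure_subset[of "{p \<in> \<Sigma>. V p \<noteq> 0}"] by (auto simp: K_def)
      then show ?thesis by (simp add: X_def W_def cplx_J_simps)
    qed
  qed
  show "0 \<le> - (LINT p|?\<mu>. ?f p)"
  \<comment> \<open>The integral of a non-integrable function is 0 by default, so that case is
    immediate. Otherwise the integrand is subtracted from a divergence of integral zero, which
    leaves the weighted square of u.\<close>
  proof (cases "integrable ?\<mu> ?f")
    case False
    then show ?thesis by (simp add: not_integrable_integral_eq)
  next
    case True
    have "(LINT p|?\<mu>. ?d p - ?f p) = - (LINT p|?\<mu>. ?f p)"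
      using d True by (simp add: has_bochner_integral_iff)
    moreover have "(LINT p|?\<mu>. ?d p - ?f p) = (LINT p|?\<mu>. exp (T \<bullet> p) * (u p)\<^sup>2)"
      by (rule Bochner_Integration.integral_cong) (simp_all add: space divergence_X)
    moreover have "0 \<le> (LINT p|?\<mu>. exp (T \<bullet> p) * (u p)\<^sup>2)"
      by (rule Bochner_Integration.integral_nonneg) simp
    ultimately show ?thesis by simp
  qed
qed

end
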